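(* Fix $\ell\in\mathbb{N}$ and $\sigma>0$. For integers $n$ write $n=2\ell m+r$ with $m\in\mathbb{N}$ and $r\in\{-1,0,\ldots,2\ell-2\}$, and let $$V_n(x)=\sum_{j=0}^{n}a_j\cos(jx),\qquad x\in(0,2\pi),$$ where $a_0,\ldots,a_n$ are real random variables such that (i) the coefficients $a_{2\ell j+k}$ ($0\le j\le m-1$, $0\le k\le \ell-1$) together with the coefficients $a_j$ ($2\ell m\le j\le n$; there are $r+1$ of these, none if $r=-1$) form a family of i.i.d. random variables with Gaussian distribution $\mathcal{N}(0,\sigma^2)$; (ii) $a_{2\ell j+k}=a_{2\ell j+\ell+k}$ for all $j=0,\ldots,m-1$ and $k=0,\ldots,\ell-1$. Then $$\mathbb{E}[N_n(0,2\pi)]=\frac{2n}{\sqrt{3}}+O\!\left(n^{5/6}\right)\quad\text{as }n\to\infty .$$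
   Context: $\mathbb{N}=\{1,2,3,\ldots\}$. $N_n(0,2\pi)$ denotes the number of real zeros of $V_n$ in the interval $(0,2\pi)$, and $\mathbb{E}$ denotes mathematical expectation. Condition (ii) says that, splitting the first $2\ell m$ coefficients into consecutive blocks $A_i=(a_{\ell i},a_{\ell i+1},\ldots,a_{\ell i+\ell-1})$, $0\le i\le 2m-1$, of length $\ell$, one has $A_{2j}=A_{2j+1}$ for $j=0,\ldots,m-1$. The block length $\ell$ is fixed as $n\to\infty$. *)

theory Defs
  imports "HOL-Probability.Probability" "HOL-Library.Landau_Symbols"
begin

definition cos_poly :: "nat \<Rightarrow> (nat \<Rightarrow> real) \<Rightarrow> real \<Rightarrow> real" where
  "cos_poly n c x = (\<Sum>j\<le>n. c j * cos (real j * x))"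

(* Distinct zeros are counted.  card is 0 on infinite sets; for cos_poly on a bounded
   interval the zero set is infinite only if all coefficients vanish. *)
definition num_zeros :: "(real \<Rightarrow> real) \<Rightarrow> real set \<Rightarrow> nat" where
  "num_zeros f S = card {x \<in> S. f x = 0}"

(* Indices of the i.i.d. coefficients in (i): the first block of every pair of blocks of
   length l, and the remainder {2lm..n}, which is empty iff n = 2lm - 1. *)
definition free_indices :: "nat \<Rightarrow> nat \<Rightarrow> nat \<Rightarrow> nat set" where
  "free_indices l m n = {2 * l * j + k | j k. j < m \<and> k < l} \<union> {2 * l * m..n}"

definition paired_block_coeffs ::
  "'a measure \<Rightarrow> nat \<Rightarrow> real \<Rightarrow> nat \<Rightarrow> nat \<Rightarrow> (nat \<Rightarrow> 'a \<Rightarrow> real) \<Rightarrow> bool" where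
  "paired_block_coeffs M l \<sigma> m n a \<longleftrightarrow>
     prob_space.indep_vars M (\<lambda>_. borel) a (free_indices l m n) \<and>
     (\<forall>i \<in> free_indices l m n. distributed M lborel (a i) (normal_density 0 \<sigma>)) \<and>
     (\<forall>j<m. \<forall>k<l. \<forall>\<omega> \<in> space M. a (2 * l * j + k) \<omega> = a (2 * l * j + l + k) \<omega>)"

end

theory Submission
  imports Defs "HOL-Real_Asymp.Real_Asymp"
begin

text \<open>Write the polynomial as \<open>V(x) = \<Sum>i. b\<^sub>i g\<^sub>i(x)\<close> with independent standard Gaussian \<open>b\<^sub>i\<close>; the
  scale \<open>\<sigma>\<close> does not affect zeros. Three ideas give the asymptotics.

  First, the expected number of zeros of such a sum is \<open>1 / pi\<close> times the length of the curve
  \<open>v / norm v\<close>, where \<open>v(x) = (g\<^sub>i(x))\<close>; its speed is \<open>sqrt (A C - B\<^sup>2) / A\<close>, with \<open>A\<close>, \<open>B\<close>, \<open>C\<close> the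
  variance of \<open>V\<close>, the covariance of \<open>V\<close> and \<open>V'\<close>, and the variance of \<open>V'\<close>. The lemma
  \<open>expected_zeros_bounds\<close> states this Kac--Rice formula as a pair of inequalities. A sign change
  of \<open>V\<close> between \<open>x\<close> and \<open>y\<close> has probability \<open>1 / pi\<close> times the angle between \<open>v(x)\<close> and \<open>v(y)\<close>
  (\<open>prob_opposite_signs\<close>), because two linear forms in Gaussian variables have the joint law of
  \<open>\<alpha> X\<close> and \<open>\<beta> X + \<gamma> Y\<close>. A zero in a cell of length \<open>h\<close> that causes no sign change
  forces \<open>\<bar>V(x)\<bar> = O(h\<^sup>2)\<close> at the left end of the cell, which is too improbable to matter as \<open>h\<close>
  tends to \<open>0\<close>.

  Second, the pairing of the blocks turns \<open>cos (i x) + cos ((i + l) x)\<close> into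
  \<open>2 cos (l x / 2) cos ((i + l / 2) x)\<close>. Division by the common factor leaves pure cosines and at most
  \<open>2 l\<close> further terms. Where \<open>\<bar>sin (2 l x)\<bar> \<ge> \<delta>\<close>, the common factor is bounded away from \<open>0\<close> and
  Abel summation bounds the oscillating parts of \<open>A\<close>, \<open>B\<close> and \<open>C\<close>, so that the speed is
  \<open>n / sqrt 3 + O(1 / \<delta>\<^sup>2)\<close> (\<open>zero_density_bounds\<close>).

  Third, around each of the \<open>4 l + 1\<close> nodes \<open>k pi / (2 l)\<close> an interval of length \<open>2 d\<close> is left out. A
  trigonometric polynomial of degree \<open>n\<close> with \<open>k \<ge> exp 2 n L\<close> zeros in an interval of length \<open>L\<close> is
  at most \<open>exp (- k)\<close> times the sum of its absolute coefficients on that interval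
  (\<open>cos_poly_small_of_many_zeros\<close>); at a point where the variance is at least \<open>1\<close> this is very
  improbable. So the excluded intervals contribute \<open>O(n d)\<close> zeros
  (\<open>expected_zeros_short_interval\<close>). With \<open>d\<close> and \<open>\<delta>\<close> equal to \<open>n powr (- 1 / 6)\<close>, the
  two errors are \<open>O(n powr (1 / 3))\<close> and \<open>O(n powr (5 / 6))\<close>.\<close>

section \<open>Pairs of linear forms in independent Gaussian variables\<close>

abbreviation std_gauss :: "real measure" where
  "std_gauss \<equiv> density lborel std_normal_density"

interpretation std_gauss: prob_space std_gauss
  by (rule prob_space_normal_density) simp

text \<open>With \<open>f\<close> fixed, this is the rule by which the measurability prover handles curried functions.\<close>
lemma measurable_pair_borel_compose:
  fixes f :: "real \<Rightarrow> real \<Rightarrow> ennreal"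
  assumes "case_prod f \<in> borel_measurable (borel \<Otimes>\<^sub>M borel)"
    and "g \<in> borel_measurable N" "h \<in> borel_measurable N"
  shows "(\<lambda>x. f (g x) (h x)) \<in> borel_measurable N"
  using measurable_compose[OF measurable_Pair[OF assms(2,3)] assms(1)] by simp

text \<open>Two affine substitutions on the line, joined by Tonelli: \<open>b\<close> is replaced by \<open>u = c * a + s * b\<close>
  and then \<open>a\<close> by \<open>(c * u - a) / s\<close>; their Jacobians \<open>1 / \<bar>s\<bar>\<close> and \<open>\<bar>s\<bar>\<close> cancel.\<close>
lemma nn_integral_lborel_rotate:
  fixes c s :: real and f :: "real \<Rightarrow> real \<Rightarrow> ennreal"
  assumes f: "case_prod f \<in> borel_measurable (borel \<Otimes>\<^sub>M borel)"
    and cs: "c\<^sup>2 + s\<^sup>2 = 1" "s \<noteq> 0"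
  shows "(\<integral>\<^sup>+a. \<integral>\<^sup>+b. f (c * a + s * b) (c * b - s * a) \<partial>lborel \<partial>lborel)
       = (\<integral>\<^sup>+a. \<integral>\<^sup>+b. f a b \<partial>lborel \<partial>lborel)"
proof -
  note [measurable (raw)] = measurable_pair_borel_compose[OF f]
  have inner: "(\<integral>\<^sup>+b. f (c * a + s * b) (c * b - s * a) \<partial>lborel)
      = ennreal \<bar>1/s\<bar> * (\<integral>\<^sup>+u. f u ((c * u - a) / s) \<partial>lborel)" for a
  proof -
    have "(\<integral>\<^sup>+b. f (c * a + s * b) (c * b - s * a) \<partial>lborel)
       = ennreal \<bar>1/s\<bar> * (\<integral>\<^sup>+u. f (c * a + s * (- (c * a / s) + 1/s * u))
                                  (c * (- (c * a / s) + 1/s * u) - s * a) \<partial>lborel)"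
      using cs by (intro nn_integral_real_affine) auto
    moreover have "c * a + s * (- (c * a / s) + 1/s * u) = u" for u
      using cs by (simp add: field_simps)
    moreover have "c * (- (c * a / s) + 1/s * u) - s * a = (c * u - a) / s" for u
    proof -
      have "c * (- (c * a / s) + 1/s * u) - s * a = (c * u - (c\<^sup>2 + s\<^sup>2) * a) / s"
        using cs(2) by (simp add: field_simps power2_eq_square)
      then show ?thesis using cs(1) by simp
    qed
    ultimately show ?thesis by simp
  qed
  have outer: "(\<integral>\<^sup>+a. f u ((c * u - a) / s) \<partial>lborel) = ennreal \<bar>s\<bar> * (\<integral>\<^sup>+b. f u b \<partial>lborel)" for u
  proof -
    have "(\<integral>\<^sup>+a. f u ((c * u - a) / s) \<partial>lborel)
        = ennreal \<bar>-s\<bar> * (\<integral>\<^sup>+b. f u ((c * u - (c * u + (-s) * b)) / s) \<partial>lborel)"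
      using cs by (intro nn_integral_real_affine) auto
    then show ?thesis using cs by simp
  qed
  have "(\<integral>\<^sup>+a. \<integral>\<^sup>+b. f (c * a + s * b) (c * b - s * a) \<partial>lborel \<partial>lborel)
      = ennreal \<bar>1/s\<bar> * (\<integral>\<^sup>+a. \<integral>\<^sup>+u. f u ((c * u - a) / s) \<partial>lborel \<partial>lborel)"
    unfolding inner by (rule nn_integral_cmult) measurable
  also have "(\<integral>\<^sup>+a. \<integral>\<^sup>+u. f u ((c * u - a) / s) \<partial>lborel \<partial>lborel)
      = (\<integral>\<^sup>+u. \<integral>\<^sup>+a. f u ((c * u - a) / s) \<partial>lborel \<partial>lborel)"
    by (rule lborel_pair.Fubini') measurable
  also have "\<dots> = ennreal \<bar>s\<bar> * (\<integral>\<^sup>+u. \<integral>\<^sup>+b. f u b \<partial>lborel \<partial>lborel)"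
    unfolding outer by (rule nn_integral_cmult) measurable
  finally show ?thesis
    using cs(2) by (simp add: mult.assoc[symmetric] ennreal_mult[symmetric])
qed

lemma std_normal_density_rotate:
  assumes "c\<^sup>2 + s\<^sup>2 = 1"
  shows "std_normal_density (c * a + s * b) * std_normal_density (c * b - s * a)
       = std_normal_density a * std_normal_density b"
proof -
  have "(c * a + s * b)\<^sup>2 + (c * b - s * a)\<^sup>2 = (c\<^sup>2 + s\<^sup>2) * (a\<^sup>2 + b\<^sup>2)"
    by (simp add: power2_eq_square algebra_simps)
  then have "(c * a + s * b)\<^sup>2 + (c * b - s * a)\<^sup>2 = a\<^sup>2 + b\<^sup>2" using assms by simp
  then have "- (c * a + s * b)\<^sup>2 / 2 + - (c * b - s * a)\<^sup>2 / 2 = - a\<^sup>2 / 2 + - b\<^sup>2 / 2" by argo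
  then show ?thesis
    unfolding std_normal_density_def by (simp add: exp_add[symmetric] del: minus_divide_left)
qed

lemma nn_integral_std_gauss_pair:
  fixes f :: "real \<Rightarrow> real \<Rightarrow> ennreal"
  assumes f: "case_prod f \<in> borel_measurable (borel \<Otimes>\<^sub>M borel)"
  shows "(\<integral>\<^sup>+a. \<integral>\<^sup>+b. f a b \<partial>std_gauss \<partial>std_gauss)
    = (\<integral>\<^sup>+a. \<integral>\<^sup>+b. ennreal (std_normal_density a * std_normal_density b) * f a b \<partial>lborel \<partial>lborel)"
  using measurable_pair_borel_compose[OF f, measurable (raw)]
  by (simp add: nn_integral_density nn_integral_cmult[symmetric] ennreal_mult mult.assoc)

text \<open>The product density depends on \<open>a\<^sup>2 + b\<^sup>2\<close> only. The sign condition on \<open>c\<close> reduces the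
  case \<open>s = 0\<close>, which the substitution above does not cover, to the identity.\<close>
lemma nn_integral_std_gauss_rotate:
  fixes c s :: real and f :: "real \<Rightarrow> real \<Rightarrow> ennreal"
  assumes f [measurable]: "case_prod f \<in> borel_measurable (borel \<Otimes>\<^sub>M borel)"
    and cs: "c\<^sup>2 + s\<^sup>2 = 1" "c \<ge> 0"
  shows "(\<integral>\<^sup>+a. \<integral>\<^sup>+b. f (c * a + s * b) (c * b - s * a) \<partial>std_gauss \<partial>std_gauss)
       = (\<integral>\<^sup>+a. \<integral>\<^sup>+b. f a b \<partial>std_gauss \<partial>std_gauss)"
proof (cases "s = 0")
  case True
  then have "c = 1" using cs by (simp add: power2_eq_1_iff)
  then show ?thesis using True by simp
next
  case False
  note [measurable (raw)] = measurable_pair_borel_compose[OF f]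
  let ?g = "\<lambda>a b. ennreal (std_normal_density a * std_normal_density b) * f a b"
  have "(\<integral>\<^sup>+a. \<integral>\<^sup>+b. f (c * a + s * b) (c * b - s * a) \<partial>std_gauss \<partial>std_gauss)
    = (\<integral>\<^sup>+a. \<integral>\<^sup>+b. ?g (c * a + s * b) (c * b - s * a) \<partial>lborel \<partial>lborel)"
    by (subst nn_integral_std_gauss_pair) (simp_all add: std_normal_density_rotate[OF cs(1)])
  also have "\<dots> = (\<integral>\<^sup>+a. \<integral>\<^sup>+b. ?g a b \<partial>lborel \<partial>lborel)"
    using False cs by (intro nn_integral_lborel_rotate) simp_all
  also have "\<dots> = (\<integral>\<^sup>+a. \<integral>\<^sup>+b. f a b \<partial>std_gauss \<partial>std_gauss)"
    by (subst nn_integral_std_gauss_pair) simp_all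
  finally show ?thesis .
qed

lemma polar_form:
  fixes x y :: real
  obtains c s where "c\<^sup>2 + s\<^sup>2 = 1" "y \<ge> 0 \<Longrightarrow> c \<ge> 0" "y = c * sqrt (x\<^sup>2 + y\<^sup>2)" "x = s * sqrt (x\<^sup>2 + y\<^sup>2)"
proof (cases "x\<^sup>2 + y\<^sup>2 = 0")
  case True
  then show ?thesis using that[of 1 0] by (simp add: sum_power2_eq_zero_iff)
next
  case False
  define R where "R = sqrt (x\<^sup>2 + y\<^sup>2)"
  have R: "R > 0" "R\<^sup>2 = x\<^sup>2 + y\<^sup>2" using False by (auto simp: R_def sum_power2_gt_zero_iff)
  show ?thesis
    by (rule that[of "y / R" "x / R"])
       (use R in \<open>auto simp: R_def[symmetric] power_divide add_divide_distrib[symmetric] add.commute\<close>)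
qed

text \<open>A rotation of the pair \<open>(a, x)\<close> removes \<open>a\<close> from the first form; a rotation of \<open>(a, y)\<close> then
  absorbs into \<open>y\<close> what remains of \<open>a\<close> in the second form.\<close>
lemma add_gaussian_form_pair:
  fixes f :: "real \<Rightarrow> real \<Rightarrow> ennreal"
  assumes f [measurable]: "case_prod f \<in> borel_measurable (borel \<Otimes>\<^sub>M borel)"
    and "\<alpha> \<ge> 0" "\<gamma> \<ge> 0"
    and al': "\<alpha>' = sqrt (p\<^sup>2 + \<alpha>\<^sup>2)" and cs: "c\<^sup>2 + s\<^sup>2 = 1" "c \<ge> 0" "\<alpha> = c * \<alpha>'" "p = s * \<alpha>'"
    and be': "\<beta>' = q * s + \<beta> * c" and de: "\<delta> = q * c - \<beta> * s" and ga': "\<gamma>' = sqrt (\<delta>\<^sup>2 + \<gamma>\<^sup>2)"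
  shows "(\<integral>\<^sup>+a. \<integral>\<^sup>+x. \<integral>\<^sup>+y. f (p * a + \<alpha> * x) (q * a + (\<beta> * x + \<gamma> * y)) \<partial>std_gauss \<partial>std_gauss \<partial>std_gauss)
       = (\<integral>\<^sup>+x. \<integral>\<^sup>+y. f (\<alpha>' * x) (\<beta>' * x + \<gamma>' * y) \<partial>std_gauss \<partial>std_gauss)"
proof -
  note [measurable (raw)] = measurable_pair_borel_compose[OF f]
  obtain c' s' where cs': "c'\<^sup>2 + s'\<^sup>2 = 1" "c' \<ge> 0" "\<gamma> = c' * \<gamma>'" "\<delta> = s' * \<gamma>'"
    using polar_form[where x = \<delta> and y = \<gamma>] \<open>\<gamma> \<ge> 0\<close> unfolding ga' by metis
  define g where "g x a = (\<integral>\<^sup>+y. f (p * a + \<alpha> * x) (q * a + (\<beta> * x + \<gamma> * y)) \<partial>std_gauss)" for x a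
  have [measurable]: "case_prod g \<in> borel_measurable (borel \<Otimes>\<^sub>M borel)"
    unfolding g_def by measurable
  note [measurable (raw)] = measurable_pair_borel_compose[OF this]
  have e1: "p * (c * a - (-s) * x) + \<alpha> * (c * x + (-s) * a) = \<alpha>' * x" for a x
  proof -
    have "p * (c * a - (-s) * x) + \<alpha> * (c * x + (-s) * a) = (c\<^sup>2 + s\<^sup>2) * \<alpha>' * x"
      unfolding cs(3,4) by (simp add: power2_eq_square algebra_simps)
    then show ?thesis using cs(1) by simp
  qed
  have e2: "q * (c * a - (-s) * x) + (\<beta> * (c * x + (-s) * a) + \<gamma> * y)
      = \<beta>' * x + (\<delta> * a + \<gamma> * y)" for a x y
    by (simp add: be' de algebra_simps)
  have "(\<integral>\<^sup>+a. \<integral>\<^sup>+x. g x a \<partial>std_gauss \<partial>std_gauss) = (\<integral>\<^sup>+x. \<integral>\<^sup>+a. g x a \<partial>std_gauss \<partial>std_gauss)"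
    by (rule pair_sigma_finite.Fubini')
       (auto simp: pair_sigma_finite_def std_gauss.sigma_finite_measure_axioms)
  also have "\<dots> = (\<integral>\<^sup>+x. \<integral>\<^sup>+a. g (c * x + (-s) * a) (c * a - (-s) * x) \<partial>std_gauss \<partial>std_gauss)"
    using cs by (intro nn_integral_std_gauss_rotate[symmetric]) auto
  also have "\<dots> = (\<integral>\<^sup>+x. \<integral>\<^sup>+a. \<integral>\<^sup>+y. f (\<alpha>' * x) (\<beta>' * x + (\<delta> * a + \<gamma> * y)) \<partial>std_gauss \<partial>std_gauss \<partial>std_gauss)"
    unfolding g_def e1 e2 ..
  also have "\<dots> = (\<integral>\<^sup>+x. \<integral>\<^sup>+y. f (\<alpha>' * x) (\<beta>' * x + \<gamma>' * y) \<partial>std_gauss \<partial>std_gauss)"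
  proof (rule nn_integral_cong)
    fix x :: real
    define h where "h y a = f (\<alpha>' * x) (\<beta>' * x + (\<delta> * a + \<gamma> * y))" for y a
    have [measurable]: "case_prod h \<in> borel_measurable (borel \<Otimes>\<^sub>M borel)"
      unfolding h_def by measurable
    note [measurable (raw)] = measurable_pair_borel_compose[OF this]
    have "(\<integral>\<^sup>+a. \<integral>\<^sup>+y. h y a \<partial>std_gauss \<partial>std_gauss) = (\<integral>\<^sup>+y. \<integral>\<^sup>+a. h y a \<partial>std_gauss \<partial>std_gauss)"
      by (rule pair_sigma_finite.Fubini')
         (auto simp: pair_sigma_finite_def std_gauss.sigma_finite_measure_axioms)
    also have "\<dots> = (\<integral>\<^sup>+y. \<integral>\<^sup>+a. h (c' * y + (-s') * a) (c' * a - (-s') * y) \<partial>std_gauss \<partial>std_gauss)"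
      using cs' by (intro nn_integral_std_gauss_rotate[symmetric]) auto
    also have "\<dots> = (\<integral>\<^sup>+y. \<integral>\<^sup>+a. f (\<alpha>' * x) (\<beta>' * x + \<gamma>' * y) \<partial>std_gauss \<partial>std_gauss)"
    proof (intro nn_integral_cong)
      fix y a :: real
      have "\<delta> * (c' * a - (-s') * y) + \<gamma> * (c' * y + (-s') * a) = (c'\<^sup>2 + s'\<^sup>2) * \<gamma>' * y"
        unfolding cs'(3,4) by (simp add: power2_eq_square algebra_simps)
      then show "h (c' * y + (-s') * a) (c' * a - (-s') * y) = f (\<alpha>' * x) (\<beta>' * x + \<gamma>' * y)"
        unfolding h_def using cs'(1) by simp
    qed
    also have "\<dots> = (\<integral>\<^sup>+y. f (\<alpha>' * x) (\<beta>' * x + \<gamma>' * y) \<partial>std_gauss)"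
      by (simp add: std_gauss.emeasure_space_1[simplified])
    finally show "(\<integral>\<^sup>+a. \<integral>\<^sup>+y. f (\<alpha>' * x) (\<beta>' * x + (\<delta> * a + \<gamma> * y)) \<partial>std_gauss \<partial>std_gauss)
        = (\<integral>\<^sup>+y. f (\<alpha>' * x) (\<beta>' * x + \<gamma>' * y) \<partial>std_gauss)" unfolding h_def .
  qed
  finally show ?thesis unfolding g_def .
qed

locale iid_gaussian = prob_space M for M :: "'a measure" +
  fixes J :: "nat set" and b :: "nat \<Rightarrow> 'a \<Rightarrow> real"
  assumes finite_J: "finite J"
    and indep: "indep_vars (\<lambda>_. borel) b J"
    and gauss: "i \<in> J \<Longrightarrow> distributed M lborel (b i) std_normal_density"
begin

definition lin :: "(nat \<Rightarrow> real) \<Rightarrow> 'a \<Rightarrow> real" where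
  "lin p \<omega> = (\<Sum>i\<in>J. p i * b i \<omega>)"

lemma measurable_b [measurable]: "i \<in> J \<Longrightarrow> b i \<in> borel_measurable M"
  using indep unfolding indep_vars_def by auto

lemma measurable_lin [measurable]: "lin p \<in> borel_measurable M"
  unfolding lin_def by measurable

lemma distr_b: "i \<in> J \<Longrightarrow> distr M borel (b i) = std_gauss"
  using gauss[of i] unfolding distributed_def by (metis distr_cong sets_lborel)

text \<open>Independence of two random variables is stated for variables with values in one type; hence the
  proof treats \<open>b i\<close> as the family restricted to \<open>{i}\<close>.\<close>
lemma nn_integral_b_times_rest:
  fixes f :: "real \<times> real \<times> real \<Rightarrow> ennreal"
  assumes [measurable]: "f \<in> borel_measurable (borel \<Otimes>\<^sub>M borel \<Otimes>\<^sub>M borel)"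
    and "i \<in> J" "K \<subseteq> J" "i \<notin> K"
  shows "(\<integral>\<^sup>+\<omega>. f (b i \<omega>, \<Sum>k\<in>K. p k * b k \<omega>, \<Sum>k\<in>K. q k * b k \<omega>) \<partial>M)
    = (\<integral>\<^sup>+a. \<integral>\<^sup>+\<omega>. f (a, \<Sum>k\<in>K. p k * b k \<omega>, \<Sum>k\<in>K. q k * b k \<omega>) \<partial>M \<partial>std_gauss)"
proof -
  let ?X = "\<lambda>\<omega>. restrict (\<lambda>i. b i \<omega>) {i}" and ?Y = "\<lambda>\<omega>. restrict (\<lambda>i. b i \<omega>) K"
  let ?P = "PiM {i} (\<lambda>_. borel :: real measure)" and ?Q = "PiM K (\<lambda>_. borel :: real measure)"
  let ?F = "\<lambda>(g, h). f (g i, \<Sum>k\<in>K. p k * h k, \<Sum>k\<in>K. q k * h k)"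
  have mb [measurable]: "k \<in> K \<Longrightarrow> b k \<in> borel_measurable M" for k using assms(3) by auto
  have bi [measurable]: "b i \<in> borel_measurable M" using assms(2) by auto
  have X [measurable]: "?X \<in> measurable M ?P"
    using bi by (intro measurable_restrict) auto
  have Y [measurable]: "?Y \<in> measurable M ?Q"
    by (intro measurable_restrict mb)
  have F [measurable]: "?F \<in> borel_measurable (?P \<Otimes>\<^sub>M ?Q)"
    by measurable
  have "indep_var ?P ?X ?Q ?Y"
    using assms(2-4) by (intro indep_var_restrict[OF indep]) auto
  then have D: "distr M (?P \<Otimes>\<^sub>M ?Q) (\<lambda>\<omega>. (?X \<omega>, ?Y \<omega>)) = distr M ?P ?X \<Otimes>\<^sub>M distr M ?Q ?Y"
    by (simp add: indep_var_distribution_eq)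
  interpret Y: prob_space "distr M ?Q ?Y"
    by (rule prob_space_distr[OF Y])
  have F': "?F \<in> borel_measurable (distr M ?P ?X \<Otimes>\<^sub>M distr M ?Q ?Y)"
    using F by (simp cong: measurable_cong_sets add: sets_pair_measure_cong[OF sets_distr sets_distr])
  have "(\<integral>\<^sup>+\<omega>. f (b i \<omega>, \<Sum>k\<in>K. p k * b k \<omega>, \<Sum>k\<in>K. q k * b k \<omega>) \<partial>M)
     = (\<integral>\<^sup>+z. ?F z \<partial>distr M (?P \<Otimes>\<^sub>M ?Q) (\<lambda>\<omega>. (?X \<omega>, ?Y \<omega>)))"
    by (subst nn_integral_distr) (auto cong: sum.cong)
  also have "\<dots> = (\<integral>\<^sup>+g. \<integral>\<^sup>+h. ?F (g, h) \<partial>distr M ?Q ?Y \<partial>distr M ?P ?X)"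
    unfolding D by (rule Y.nn_integral_fst[OF F', symmetric])
  also have "\<dots> = (\<integral>\<^sup>+g. \<integral>\<^sup>+\<omega>. f (g i, \<Sum>k\<in>K. p k * b k \<omega>, \<Sum>k\<in>K. q k * b k \<omega>) \<partial>M \<partial>distr M ?P ?X)"
    by (intro nn_integral_cong, subst nn_integral_distr) (auto cong: sum.cong)
  also have "\<dots> = (\<integral>\<^sup>+a. \<integral>\<^sup>+\<omega>. f (a, \<Sum>k\<in>K. p k * b k \<omega>, \<Sum>k\<in>K. q k * b k \<omega>) \<partial>M \<partial>distr M borel (b i))"
    by (simp add: nn_integral_distr)
  finally show ?thesis using assms(2) by (simp add: distr_b)
qed

text \<open>The matrix with rows \<open>(\<alpha>, 0)\<close> and \<open>(\<beta>, \<gamma>)\<close> is a Cholesky factor of the covariance matrix of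
  the two forms. The variables are added one at a time, each addition being undone by two plane
  rotations.\<close>
lemma lin_pair_law_aux:
  assumes "K \<subseteq> J"
  shows "\<exists>\<alpha> \<beta> \<gamma>. \<alpha> \<ge> 0 \<and> \<gamma> \<ge> 0 \<and> \<alpha>\<^sup>2 = (\<Sum>i\<in>K. (p i)\<^sup>2) \<and> \<alpha> * \<beta> = (\<Sum>i\<in>K. p i * q i) \<and>
    \<beta>\<^sup>2 + \<gamma>\<^sup>2 = (\<Sum>i\<in>K. (q i)\<^sup>2) \<and>
    (\<forall>f. case_prod f \<in> borel_measurable (borel \<Otimes>\<^sub>M borel) \<longrightarrow>
      (\<integral>\<^sup>+\<omega>. (f (\<Sum>k\<in>K. p k * b k \<omega>) (\<Sum>k\<in>K. q k * b k \<omega>) :: ennreal) \<partial>M)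
      = (\<integral>\<^sup>+x. \<integral>\<^sup>+y. f (\<alpha> * x) (\<beta> * x + \<gamma> * y) \<partial>std_gauss \<partial>std_gauss))"
proof -
  have "finite K" using finite_subset[OF assms finite_J] .
  then show ?thesis using assms
  proof (induction K)
    case empty
    show ?case
      by (rule exI[of _ 0], rule exI[of _ 0], rule exI[of _ 0])
         (simp add: emeasure_space_1 std_gauss.emeasure_space_1[simplified])
  next
    case (insert i K)
    then obtain \<alpha> \<beta> \<gamma> where IH: "\<alpha> \<ge> 0" "\<gamma> \<ge> 0" "\<alpha>\<^sup>2 = (\<Sum>i\<in>K. (p i)\<^sup>2)" "\<alpha> * \<beta> = (\<Sum>i\<in>K. p i * q i)"
      "\<beta>\<^sup>2 + \<gamma>\<^sup>2 = (\<Sum>i\<in>K. (q i)\<^sup>2)"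
      "\<And>f. case_prod f \<in> borel_measurable (borel \<Otimes>\<^sub>M borel) \<Longrightarrow>
      (\<integral>\<^sup>+\<omega>. (f (\<Sum>k\<in>K. p k * b k \<omega>) (\<Sum>k\<in>K. q k * b k \<omega>) :: ennreal) \<partial>M)
      = (\<integral>\<^sup>+x. \<integral>\<^sup>+y. f (\<alpha> * x) (\<beta> * x + \<gamma> * y) \<partial>std_gauss \<partial>std_gauss)"
      by auto
    define \<alpha>' where "\<alpha>' = sqrt ((p i)\<^sup>2 + \<alpha>\<^sup>2)"
    obtain c s where cs: "c\<^sup>2 + s\<^sup>2 = 1" "c \<ge> 0" "\<alpha> = c * \<alpha>'" "p i = s * \<alpha>'"
      using polar_form[where x = "p i" and y = \<alpha>] IH(1) unfolding \<alpha>'_def by metis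
    define \<beta>' \<delta> where "\<beta>' = q i * s + \<beta> * c" and "\<delta> = q i * c - \<beta> * s"
    define \<gamma>' where "\<gamma>' = sqrt (\<delta>\<^sup>2 + \<gamma>\<^sup>2)"
    have "\<alpha>' \<ge> 0" "\<gamma>' \<ge> 0" by (simp_all add: \<alpha>'_def \<gamma>'_def)
    moreover have "\<alpha>'\<^sup>2 = (\<Sum>i\<in>insert i K. (p i)\<^sup>2)"
      using insert.hyps IH by (simp add: \<alpha>'_def sum_nonneg)
    moreover have "\<alpha>' * \<beta>' = (\<Sum>i\<in>insert i K. p i * q i)"
      using insert.hyps IH(4)[symmetric] cs(3,4) by (simp add: \<beta>'_def algebra_simps)
    moreover have "\<beta>'\<^sup>2 + \<gamma>'\<^sup>2 = (\<Sum>i\<in>insert i K. (q i)\<^sup>2)"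
    proof -
      have "\<beta>'\<^sup>2 + \<delta>\<^sup>2 = (c\<^sup>2 + s\<^sup>2) * ((q i)\<^sup>2 + \<beta>\<^sup>2)"
        unfolding \<beta>'_def \<delta>_def by (simp add: power2_eq_square algebra_simps)
      then show ?thesis using insert.hyps IH(5) cs(1) by (simp add: \<gamma>'_def)
    qed
    moreover have "(\<integral>\<^sup>+\<omega>. (f (\<Sum>k\<in>insert i K. p k * b k \<omega>) (\<Sum>k\<in>insert i K. q k * b k \<omega>) :: ennreal) \<partial>M)
      = (\<integral>\<^sup>+x. \<integral>\<^sup>+y. f (\<alpha>' * x) (\<beta>' * x + \<gamma>' * y) \<partial>std_gauss \<partial>std_gauss)"
      if f: "case_prod f \<in> borel_measurable (borel \<Otimes>\<^sub>M borel)" for f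
    proof -
      note [measurable (raw)] = measurable_pair_borel_compose[OF f]
      have "(\<integral>\<^sup>+\<omega>. f (\<Sum>k\<in>insert i K. p k * b k \<omega>) (\<Sum>k\<in>insert i K. q k * b k \<omega>) \<partial>M)
        = (\<integral>\<^sup>+\<omega>. f (p i * b i \<omega> + (\<Sum>k\<in>K. p k * b k \<omega>)) (q i * b i \<omega> + (\<Sum>k\<in>K. q k * b k \<omega>)) \<partial>M)"
        using insert.hyps by simp
      also have "\<dots> = (\<integral>\<^sup>+a. \<integral>\<^sup>+\<omega>. f (p i * a + (\<Sum>k\<in>K. p k * b k \<omega>)) (q i * a + (\<Sum>k\<in>K. q k * b k \<omega>)) \<partial>M \<partial>std_gauss)"
        using insert by (intro nn_integral_b_times_rest[where f = "\<lambda>(a, x, y). f (p i * a + x) (q i * a + y)", simplified]) auto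
      also have "\<dots> = (\<integral>\<^sup>+a. \<integral>\<^sup>+x. \<integral>\<^sup>+y. f (p i * a + \<alpha> * x) (q i * a + (\<beta> * x + \<gamma> * y)) \<partial>std_gauss \<partial>std_gauss \<partial>std_gauss)"
        by (intro nn_integral_cong, rule IH(6)[of "\<lambda>x y. f (p i * a + x) (q i * a + y)" for a]) auto
      also have "\<dots> = (\<integral>\<^sup>+x. \<integral>\<^sup>+y. f (\<alpha>' * x) (\<beta>' * x + \<gamma>' * y) \<partial>std_gauss \<partial>std_gauss)"
        by (rule add_gaussian_form_pair[OF f IH(1,2) \<alpha>'_def cs \<beta>'_def \<delta>_def \<gamma>'_def])
      finally show ?thesis .
    qed
    ultimately show ?case by blast
  qed
qed

end

section \<open>Signs and small values of Gaussian linear forms\<close>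

lemma nn_integral_even_halves:
  fixes f :: "real \<Rightarrow> ennreal"
  assumes [measurable]: "f \<in> borel_measurable borel" and even: "\<And>x. f (- x) = f x"
  shows "(\<integral>\<^sup>+x. f x \<partial>lborel) = 2 * (\<integral>\<^sup>+x. f x * indicator {0..} x \<partial>lborel)"
proof -
  have "(\<integral>\<^sup>+x. f x \<partial>lborel) = (\<integral>\<^sup>+x. f x * indicator {0..} x + f x * indicator {..0} x \<partial>lborel)"
    by (intro nn_integral_cong_AE AE_I[where N = "{0}"]) (auto simp: indicator_def)
  also have "\<dots> = (\<integral>\<^sup>+x. f x * indicator {0..} x \<partial>lborel) + (\<integral>\<^sup>+x. f x * indicator {..0} x \<partial>lborel)"
    by (rule nn_integral_add) auto
  also have "(\<integral>\<^sup>+x. f x * indicator {..0} x \<partial>lborel)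
      = (\<integral>\<^sup>+x. f (0 + (-1) * x) * indicator {..0} (0 + (-1) * x) \<partial>lborel)"
    by (subst nn_integral_real_affine[where c = "-1" and t = 0]) auto
  also have "\<dots> = (\<integral>\<^sup>+x. f x * indicator {0..} x \<partial>lborel)"
    by (intro nn_integral_cong) (auto simp: even indicator_def)
  finally show ?thesis by (simp add: mult_2)
qed

lemma nn_integral_abs_times_gaussian:
  assumes "c > 0"
  shows "(\<integral>\<^sup>+x. ennreal (\<bar>x\<bar> * exp (- (c * x\<^sup>2 / 2))) \<partial>lborel) = ennreal (2 / c)"
proof -
  let ?F = "\<lambda>x. - exp (- (c * x\<^sup>2 / 2)) / c"
  have "(\<integral>\<^sup>+x. ennreal (\<bar>x\<bar> * exp (- (c * x\<^sup>2 / 2))) * indicator {0..} x \<partial>lborel)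
      = (\<integral>\<^sup>+x. ennreal (x * exp (- (c * x\<^sup>2 / 2))) * indicator {0..} x \<partial>lborel)"
    by (intro nn_integral_cong) (auto simp: indicator_def)
  also have "\<dots> = ennreal (0 - ?F 0)"
  proof (rule nn_integral_FTC_atLeast)
    show "(?F has_real_derivative x * exp (- (c * x\<^sup>2 / 2))) (at x)" for x
      using assms by (auto intro!: derivative_eq_intros simp: field_simps)
    show "(?F \<longlongrightarrow> 0) at_top"
      using assms by real_asymp
  qed auto
  finally show ?thesis
    using assms by (subst nn_integral_even_halves) (auto simp: ennreal_mult[symmetric] simp flip: ennreal_numeral)
qed

text \<open>For \<open>\<gamma> > 0\<close> the probability is that of \<open>y / x < - \<beta> / \<gamma>\<close>, and the ratio of two independent standard
  Gaussian variables has the Cauchy density \<open>1 / (pi * (1 + w^2))\<close>.\<close>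
lemma opposite_sign_std_gauss:
  assumes "\<beta> > 0" "\<gamma> \<ge> 0"
  shows "(\<integral>\<^sup>+x. \<integral>\<^sup>+y. indicator {(x, y). x * (\<beta> * x + \<gamma> * y) < 0} (x, y) \<partial>std_gauss \<partial>std_gauss)
    = ennreal (arctan (\<gamma> / \<beta>) / pi)"
proof (cases "\<gamma> = 0")
  case True
  have "\<not> x * (\<beta> * x) < 0" for x
    using assms by (simp add: mult.left_commute[of x \<beta>] mult_less_0_iff not_less)
  then show ?thesis using True by (simp add: indicator_def)
next
  case False
  then have ga: "\<gamma> > 0" using assms by simp
  let ?\<phi> = std_normal_density
  have pos: "x * (\<beta> * x + \<gamma> * (x * w)) < 0 \<longleftrightarrow> w < - \<beta> / \<gamma>" if "x \<noteq> 0" for x w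
  proof -
    have "x * (\<beta> * x + \<gamma> * (x * w)) = x\<^sup>2 * (\<beta> + \<gamma> * w)" by (simp add: power2_eq_square algebra_simps)
    moreover have "\<beta> + \<gamma> * w < 0 \<longleftrightarrow> w < - \<beta> / \<gamma>" using ga by (simp only: pos_less_divide_eq) (simp add: mult.commute, arith)
    ultimately show ?thesis using that by (simp add: mult_less_0_iff not_less)
  qed
  have inner: "ennreal (?\<phi> x) * (\<integral>\<^sup>+y. ennreal (?\<phi> y) * indicator {(x, y). x * (\<beta> * x + \<gamma> * y) < 0} (x, y) \<partial>lborel)
      = (\<integral>\<^sup>+w. ennreal (?\<phi> x * ?\<phi> (x * w) * \<bar>x\<bar>) * indicator {..< - \<beta> / \<gamma>} w \<partial>lborel)" if "x \<noteq> 0" for x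
  proof -
    have "(\<integral>\<^sup>+y. ennreal (?\<phi> y) * indicator {(x, y). x * (\<beta> * x + \<gamma> * y) < 0} (x, y) \<partial>lborel)
      = ennreal \<bar>x\<bar> * (\<integral>\<^sup>+w. ennreal (?\<phi> (0 + x * w))
           * indicator {(x, y). x * (\<beta> * x + \<gamma> * y) < 0} (x, 0 + x * w) \<partial>lborel)"
      using that by (intro nn_integral_real_affine[where f = "\<lambda>y. ennreal (?\<phi> y)
           * indicator {(x, y). x * (\<beta> * x + \<gamma> * y) < 0} (x, y)"]) (auto simp: indicator_def)
    also have "\<dots> = ennreal \<bar>x\<bar> * (\<integral>\<^sup>+w. ennreal (?\<phi> (x * w)) * indicator {..< - \<beta> / \<gamma>} w \<partial>lborel)"
      using pos[OF that] by (simp add: indicator_def)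
    finally show ?thesis
      by (simp add: nn_integral_cmult[symmetric] ennreal_mult mult_ac)
  qed
  \<comment> \<open>The density of the ratio at \<open>w\<close>; the factor \<open>\<bar>x\<bar>\<close> is the Jacobian of \<open>y = x * w\<close>.\<close>
  have dens: "(\<integral>\<^sup>+x. ennreal (?\<phi> x * ?\<phi> (x * w) * \<bar>x\<bar>) \<partial>lborel) = ennreal (1 / (pi * (1 + w\<^sup>2)))" for w
  proof -
    have c: "1 + w\<^sup>2 > 0" by (simp add: add_pos_nonneg)
    have "?\<phi> x * ?\<phi> (x * w) * \<bar>x\<bar> = 1 / (2 * pi) * (\<bar>x\<bar> * exp (- ((1 + w\<^sup>2) * x\<^sup>2 / 2)))" for x
    proof -
      have "- x\<^sup>2 / 2 + - (x * w)\<^sup>2 / 2 = - ((1 + w\<^sup>2) * x\<^sup>2 / 2)"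
        by (simp add: power2_eq_square algebra_simps add_divide_distrib diff_divide_distrib)
      then have "exp (- x\<^sup>2 / 2) * exp (- (x * w)\<^sup>2 / 2) = exp (- ((1 + w\<^sup>2) * x\<^sup>2 / 2))"
        by (simp only: exp_add[symmetric])
      then show ?thesis unfolding std_normal_density_def by (simp add: field_simps)
    qed
    then have "(\<integral>\<^sup>+x. ennreal (?\<phi> x * ?\<phi> (x * w) * \<bar>x\<bar>) \<partial>lborel)
        = (\<integral>\<^sup>+x. ennreal (1 / (2 * pi)) * ennreal (\<bar>x\<bar> * exp (- ((1 + w\<^sup>2) * x\<^sup>2 / 2))) \<partial>lborel)"
      by (simp only: ennreal_mult[symmetric] zero_le_mult_iff abs_ge_zero exp_ge_zero
            zero_le_divide_iff pi_ge_zero zero_le_one zero_le_numeral simp_thms)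
    also have "\<dots> = ennreal (1 / (2 * pi)) * ennreal (2 / (1 + w\<^sup>2))"
      by (subst nn_integral_cmult) (auto simp: nn_integral_abs_times_gaussian[OF c])
    also have "\<dots> = ennreal (1 / (pi * (1 + w\<^sup>2)))"
      using c by (subst ennreal_mult[symmetric]) auto
    finally show ?thesis .
  qed
  have "(\<integral>\<^sup>+x. \<integral>\<^sup>+y. indicator {(x, y). x * (\<beta> * x + \<gamma> * y) < 0} (x, y) \<partial>std_gauss \<partial>std_gauss)
    = (\<integral>\<^sup>+x. ennreal (?\<phi> x) * (\<integral>\<^sup>+y. ennreal (?\<phi> y) * indicator {(x, y). x * (\<beta> * x + \<gamma> * y) < 0} (x, y) \<partial>lborel) \<partial>lborel)"
    by (simp add: nn_integral_density)
  also have "\<dots> = (\<integral>\<^sup>+x. \<integral>\<^sup>+w. ennreal (?\<phi> x * ?\<phi> (x * w) * \<bar>x\<bar>) * indicator {..< - \<beta> / \<gamma>} w \<partial>lborel \<partial>lborel)"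
    by (rule nn_integral_cong_AE, rule AE_I[where N = "{0}"]) (use inner in auto)
  also have "\<dots> = (\<integral>\<^sup>+w. \<integral>\<^sup>+x. ennreal (?\<phi> x * ?\<phi> (x * w) * \<bar>x\<bar>) * indicator {..< - \<beta> / \<gamma>} w \<partial>lborel \<partial>lborel)"
    by (rule lborel_pair.Fubini') simp
  also have "\<dots> = (\<integral>\<^sup>+w. ennreal (1 / (pi * (1 + w\<^sup>2))) * indicator {..< - \<beta> / \<gamma>} w \<partial>lborel)"
    by (simp add: nn_integral_multc dens)
  also have "\<dots> = (\<integral>\<^sup>+w. ennreal (1 / (pi * (1 + w\<^sup>2))) * indicator {\<beta> / \<gamma>..} w \<partial>lborel)"
    by (subst nn_integral_real_affine[where c = "-1" and t = 0], simp, simp)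
       (simp, intro nn_integral_cong_AE AE_I[where N = "{\<beta> / \<gamma>}"], auto simp: indicator_def)
  also have "\<dots> = ennreal (1 / 2 - arctan (\<beta> / \<gamma>) / pi)"
  proof (rule nn_integral_FTC_atLeast)
    show "((\<lambda>w. arctan w / pi) has_real_derivative 1 / (pi * (1 + x\<^sup>2))) (at x)" for x
      by (rule DERIV_cong[OF DERIV_cdivide[OF DERIV_arctan]]) (simp add: divide_inverse mult_ac)
    have "((\<lambda>w. arctan w / pi) \<longlongrightarrow> (pi / 2) / pi) at_top"
      by (intro tendsto_intros tendsto_arctan_at_top) auto
    then show "((\<lambda>w. arctan w / pi) \<longlongrightarrow> 1 / 2) at_top" by simp
  qed (auto simp: add_nonneg_nonneg)
  also have "1 / 2 - arctan (\<beta> / \<gamma>) / pi = arctan (\<gamma> / \<beta>) / pi"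
  proof -
    have "arctan (\<gamma> / \<beta>) = pi / 2 - arctan (\<beta> / \<gamma>)"
      using arctan_inverse[of "\<beta> / \<gamma>"] assms ga by simp
    then show ?thesis by (simp add: diff_divide_distrib)
  qed
  finally show ?thesis .
qed

context iid_gaussian
begin

lemma lin_pair_law:
  obtains \<alpha> \<beta> \<gamma> where "\<alpha> \<ge> 0" "\<gamma> \<ge> 0" "\<alpha>\<^sup>2 = (\<Sum>i\<in>J. (p i)\<^sup>2)" "\<alpha> * \<beta> = (\<Sum>i\<in>J. p i * q i)"
    "\<beta>\<^sup>2 + \<gamma>\<^sup>2 = (\<Sum>i\<in>J. (q i)\<^sup>2)"
    "\<And>A. A \<in> sets (borel \<Otimes>\<^sub>M borel) \<Longrightarrow> emeasure M {\<omega>\<in>space M. (lin p \<omega>, lin q \<omega>) \<in> A}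
      = (\<integral>\<^sup>+x. \<integral>\<^sup>+y. indicator A (\<alpha> * x, \<beta> * x + \<gamma> * y) \<partial>std_gauss \<partial>std_gauss)"
proof -
  obtain \<alpha> \<beta> \<gamma> where *: "\<alpha> \<ge> 0" "\<gamma> \<ge> 0" "\<alpha>\<^sup>2 = (\<Sum>i\<in>J. (p i)\<^sup>2)" "\<alpha> * \<beta> = (\<Sum>i\<in>J. p i * q i)"
    "\<beta>\<^sup>2 + \<gamma>\<^sup>2 = (\<Sum>i\<in>J. (q i)\<^sup>2)"
    "\<forall>f. case_prod f \<in> borel_measurable (borel \<Otimes>\<^sub>M borel) \<longrightarrow>
      (\<integral>\<^sup>+\<omega>. (f (lin p \<omega>) (lin q \<omega>) :: ennreal) \<partial>M)
      = (\<integral>\<^sup>+x. \<integral>\<^sup>+y. f (\<alpha> * x) (\<beta> * x + \<gamma> * y) \<partial>std_gauss \<partial>std_gauss)"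
    using lin_pair_law_aux[OF subset_refl, of p q] unfolding lin_def by blast
  show ?thesis
  proof (rule that[OF *(1-5)])
    fix A :: "(real \<times> real) set" assume [measurable]: "A \<in> sets (borel \<Otimes>\<^sub>M borel)"
    have "(\<lambda>\<omega>. (lin p \<omega>, lin q \<omega>)) \<in> measurable M (borel \<Otimes>\<^sub>M borel)" by measurable
    then have "{\<omega>\<in>space M. (lin p \<omega>, lin q \<omega>) \<in> A} \<in> sets M"
      using measurable_sets[of _ M "borel \<Otimes>\<^sub>M borel" A] by (simp add: vimage_def Int_def conj_commute)
    then have "emeasure M {\<omega>\<in>space M. (lin p \<omega>, lin q \<omega>) \<in> A}
      = (\<integral>\<^sup>+\<omega>. indicator {\<omega>\<in>space M. (lin p \<omega>, lin q \<omega>) \<in> A} \<omega> \<partial>M)"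
      by (rule nn_integral_indicator[symmetric])
    also have "\<dots> = (\<integral>\<^sup>+\<omega>. indicator A (lin p \<omega>, lin q \<omega>) \<partial>M)"
      by (intro nn_integral_cong) (auto simp: indicator_def)
    also have "\<dots> = (\<integral>\<^sup>+x. \<integral>\<^sup>+y. indicator A (\<alpha> * x, \<beta> * x + \<gamma> * y) \<partial>std_gauss \<partial>std_gauss)"
      using *(6)[rule_format, of "\<lambda>x y. indicator A (x, y)"] by simp
    finally show "emeasure M {\<omega>\<in>space M. (lin p \<omega>, lin q \<omega>) \<in> A}
      = (\<integral>\<^sup>+x. \<integral>\<^sup>+y. indicator A (\<alpha> * x, \<beta> * x + \<gamma> * y) \<partial>std_gauss \<partial>std_gauss)" .
  qed
qed

text \<open>Sheppard's formula: the argument of \<open>arctan\<close> is the tangent of the angle between the vectors \<open>p\<close>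
  and \<open>q\<close>, which is acute here, and in the normal form of the pair it is \<open>\<gamma> / \<beta>\<close>.\<close>
lemma prob_opposite_signs:
  assumes "(\<Sum>i\<in>J. p i * q i) > 0"
  shows "emeasure M {\<omega>\<in>space M. lin p \<omega> * lin q \<omega> < 0} = ennreal (arctan (
    sqrt ((\<Sum>i\<in>J. (p i)\<^sup>2) * (\<Sum>i\<in>J. (q i)\<^sup>2) - (\<Sum>i\<in>J. p i * q i)\<^sup>2) / (\<Sum>i\<in>J. p i * q i)) / pi)"
proof -
  obtain \<alpha> \<beta> \<gamma> where l: "\<alpha> \<ge> 0" "\<gamma> \<ge> 0" "\<alpha>\<^sup>2 = (\<Sum>i\<in>J. (p i)\<^sup>2)" "\<alpha> * \<beta> = (\<Sum>i\<in>J. p i * q i)"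
    "\<beta>\<^sup>2 + \<gamma>\<^sup>2 = (\<Sum>i\<in>J. (q i)\<^sup>2)"
    "\<And>A. A \<in> sets (borel \<Otimes>\<^sub>M borel) \<Longrightarrow> emeasure M {\<omega>\<in>space M. (lin p \<omega>, lin q \<omega>) \<in> A}
      = (\<integral>\<^sup>+x. \<integral>\<^sup>+y. indicator A (\<alpha> * x, \<beta> * x + \<gamma> * y) \<partial>std_gauss \<partial>std_gauss)"
    by (rule lin_pair_law[of p q], rule that)
  have "\<alpha> * \<beta> > 0" using l(4) assms by simp
  then have ab: "\<alpha> > 0" "\<beta> > 0" using l(1) by (auto simp: zero_less_mult_iff)
  have gb: "\<gamma> / \<beta> = sqrt ((\<Sum>i\<in>J. (p i)\<^sup>2) * (\<Sum>i\<in>J. (q i)\<^sup>2) - (\<Sum>i\<in>J. p i * q i)\<^sup>2) / (\<Sum>i\<in>J. p i * q i)"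
  proof -
    have "(\<Sum>i\<in>J. (p i)\<^sup>2) * (\<Sum>i\<in>J. (q i)\<^sup>2) - (\<Sum>i\<in>J. p i * q i)\<^sup>2 = (\<alpha> * \<gamma>)\<^sup>2"
      unfolding l(3-5)[symmetric] by (simp add: algebra_simps power_mult_distrib)
    then have "sqrt ((\<Sum>i\<in>J. (p i)\<^sup>2) * (\<Sum>i\<in>J. (q i)\<^sup>2) - (\<Sum>i\<in>J. p i * q i)\<^sup>2) = \<alpha> * \<gamma>"
      using ab l(2) by simp
    then show ?thesis using ab by (simp add: l(4)[symmetric])
  qed
  have "emeasure M {\<omega>\<in>space M. lin p \<omega> * lin q \<omega> < 0}
      = emeasure M {\<omega>\<in>space M. (lin p \<omega>, lin q \<omega>) \<in> {(x, y). x * y < 0}}"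
    by simp
  also have "\<dots> = (\<integral>\<^sup>+x. \<integral>\<^sup>+y. indicator {(x, y). x * y < 0} (\<alpha> * x, \<beta> * x + \<gamma> * y) \<partial>std_gauss \<partial>std_gauss)"
    unfolding case_prod_unfold
    by (rule l(6), unfold borel_prod, intro borel_open open_Collect_less continuous_intros)
  also have "\<dots> = (\<integral>\<^sup>+x. \<integral>\<^sup>+y. indicator {(x, y). x * (\<beta> * x + \<gamma> * y) < 0} (x, y) \<partial>std_gauss \<partial>std_gauss)"
    using ab by (intro nn_integral_cong) (auto simp: indicator_def mult.assoc mult_less_0_iff zero_less_mult_iff)
  also have "\<dots> = ennreal (arctan (\<gamma> / \<beta>) / pi)"
    by (rule opposite_sign_std_gauss) (use ab l(2) in auto)
  finally show ?thesis unfolding gb .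
qed

text \<open>A centred Gaussian variable of standard deviation at least \<open>\<alpha>\<close> has a density of at most
  \<open>1 / (2 * \<alpha>)\<close>.\<close>
lemma prob_small_lin:
  assumes "\<alpha> > 0" "\<alpha>\<^sup>2 \<le> (\<Sum>i\<in>J. (p i)\<^sup>2)" "t \<ge> 0"
  shows "emeasure M {\<omega>\<in>space M. \<bar>lin p \<omega>\<bar> \<le> t} \<le> ennreal (t / \<alpha>)"
proof -
  obtain \<alpha>' \<beta> \<gamma> where l: "\<alpha>' \<ge> 0" "\<gamma> \<ge> 0" "\<alpha>'\<^sup>2 = (\<Sum>i\<in>J. (p i)\<^sup>2)"
    "\<alpha>' * \<beta> = (\<Sum>i\<in>J. p i * p i)" "\<beta>\<^sup>2 + \<gamma>\<^sup>2 = (\<Sum>i\<in>J. (p i)\<^sup>2)"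
    "\<And>A. A \<in> sets (borel \<Otimes>\<^sub>M borel) \<Longrightarrow> emeasure M {\<omega>\<in>space M. (lin p \<omega>, lin p \<omega>) \<in> A}
      = (\<integral>\<^sup>+x. \<integral>\<^sup>+y. indicator A (\<alpha>' * x, \<beta> * x + \<gamma> * y) \<partial>std_gauss \<partial>std_gauss)"
    by (rule lin_pair_law[of p p], rule that)
  have "\<alpha> \<le> \<alpha>'" by (rule power2_le_imp_le) (use assms(2) l(1,3) in auto)
  then have al: "\<alpha>' > 0" using assms by simp
  have sd: "std_normal_density x \<le> 1 / 2" for x :: real
  proof -
    have "2 \<le> sqrt (2 * pi)" using pi_ge_two by (intro real_le_rsqrt) simp
    then have "1 / sqrt (2 * pi) * exp (- x\<^sup>2 / 2) \<le> 1 / 2 * 1"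
      by (intro mult_mono) (auto simp: field_simps)
    then show ?thesis by (simp add: std_normal_density_def)
  qed
  have "emeasure M {\<omega>\<in>space M. \<bar>lin p \<omega>\<bar> \<le> t} = emeasure M {\<omega>\<in>space M. (lin p \<omega>, lin p \<omega>) \<in> {(x, y). \<bar>x\<bar> \<le> t}}"
    by simp
  also have "\<dots> = (\<integral>\<^sup>+x. \<integral>\<^sup>+y. indicator {(x, y). \<bar>x\<bar> \<le> t} (\<alpha>' * x, \<beta> * x + \<gamma> * y) \<partial>std_gauss \<partial>std_gauss)"
    unfolding case_prod_unfold
    by (rule l(6), unfold borel_prod, intro borel_closed closed_Collect_le continuous_intros)
  also have "\<dots> = (\<integral>\<^sup>+x. indicator {- (t / \<alpha>')..t / \<alpha>'} x \<partial>std_gauss)"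
  proof (intro nn_integral_cong)
    fix x :: real
    have "indicator {(x, y). \<bar>x\<bar> \<le> t} (\<alpha>' * x, \<beta> * x + \<gamma> * y)
        = (indicator {- (t / \<alpha>')..t / \<alpha>'} x :: ennreal)" for y
      using al by (auto simp: indicator_def field_simps abs_le_iff)
    then show "(\<integral>\<^sup>+y. indicator {(x, y). \<bar>x\<bar> \<le> t} (\<alpha>' * x, \<beta> * x + \<gamma> * y) \<partial>std_gauss)
        = indicator {- (t / \<alpha>')..t / \<alpha>'} x"
      by (simp add: std_gauss.emeasure_space_1[simplified])
  qed
  also have "\<dots> = (\<integral>\<^sup>+x. ennreal (std_normal_density x) * indicator {- (t / \<alpha>')..t / \<alpha>'} x \<partial>lborel)"
    by (rule nn_integral_density) auto
  also have "\<dots> \<le> (\<integral>\<^sup>+x. ennreal (1 / 2) * indicator {- (t / \<alpha>')..t / \<alpha>'} x \<partial>lborel)"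
    by (intro nn_integral_mono mult_right_mono ennreal_leI sd) auto
  also have "\<dots> = ennreal (1 / 2 * (2 * (t / \<alpha>')))"
  proof -
    have "emeasure lborel {- (t / \<alpha>')..t / \<alpha>'} = ennreal (2 * (t / \<alpha>'))"
      using assms al by (subst emeasure_lborel_Icc) (auto simp: minus_le_iff)
    then show ?thesis
      using assms al by (subst nn_integral_cmult_indicator, simp, subst ennreal_mult) auto
  qed
  also have "\<dots> \<le> ennreal (t / \<alpha>)"
    using assms al \<open>\<alpha> \<le> \<alpha>'\<close> by (intro ennreal_leI) (simp add: frac_le)
  finally show ?thesis .
qed

lemma fourth_moment: "i \<in> J \<Longrightarrow> (\<integral>\<^sup>+\<omega>. ennreal (b i \<omega> ^ 4) \<partial>M) = 3"
proof -
  assume i: "i \<in> J"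
  have "(\<integral>\<^sup>+\<omega>. ennreal (b i \<omega> ^ 4) \<partial>M) = (\<integral>\<^sup>+x. ennreal (x ^ 4) \<partial>distr M borel (b i))"
    using i by (subst nn_integral_distr) auto
  also have "\<dots> = (\<integral>\<^sup>+x. ennreal (std_normal_density x * x ^ (2 * 2)) \<partial>lborel)"
    using i by (simp add: distr_b nn_integral_density ennreal_mult)
  also have "\<dots> = ennreal (fact (2 * 2) / (2^2 * fact 2))"
    using std_normal_moment_even[of 2]
    by (subst nn_integral_eq_integral) (auto simp: has_bochner_integral_iff)
  also have "\<dots> = 3" by (simp add: fact_numeral)
  finally show ?thesis .
qed

text \<open>If the sum exceeds \<open>T\<close>, some \<open>\<bar>b i\<bar>\<close> exceeds \<open>T / card J\<close>; Markov's inequality for fourth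
  moments does the rest. With \<open>T = 1 / sqrt h\<close> this power makes the bound quadratic in \<open>h\<close>, so that it
  is negligible even when summed over \<open>1 / h\<close> cells.\<close>
lemma prob_sum_abs_large:
  assumes "T > 0"
  shows "emeasure M {\<omega>\<in>space M. T < (\<Sum>i\<in>J. \<bar>b i \<omega>\<bar>)} \<le> ennreal (3 * real (card J) ^ 5 / T ^ 4)"
proof -
  define N where "N = real (card J)"
  have ind: "indicator {\<omega>\<in>space M. T < (\<Sum>i\<in>J. \<bar>b i \<omega>\<bar>)} \<omega> \<le> (\<Sum>i\<in>J. ennreal ((N / T) ^ 4) * ennreal (b i \<omega> ^ 4))" for \<omega>
  proof (cases "T < (\<Sum>i\<in>J. \<bar>b i \<omega>\<bar>)")
    case True
    have "\<exists>i\<in>J. \<bar>b i \<omega>\<bar> > T / N"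
    proof (rule ccontr)
      assume "\<not> ?thesis"
      then have "(\<Sum>i\<in>J. \<bar>b i \<omega>\<bar>) \<le> (\<Sum>i\<in>J. T / N)" by (intro sum_mono) auto
      also have "\<dots> \<le> T" using assms by (simp add: N_def)
      finally show False using True by simp
    qed
    then obtain i where i: "i \<in> J" "\<bar>b i \<omega>\<bar> > T / N" by blast
    then have N: "N > 0" using finite_J by (auto simp: N_def card_gt_0_iff)
    have "1 \<le> (N / T * \<bar>b i \<omega>\<bar>) ^ 4"
      using i N assms by (intro one_le_power) (simp add: field_simps)
    also have "\<dots> = (N / T) ^ 4 * b i \<omega> ^ 4" by (simp only: power_mult_distrib power_even_abs even_numeral)
    finally have "1 \<le> ennreal ((N / T) ^ 4) * ennreal (b i \<omega> ^ 4)"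
      by (simp add: ennreal_mult[symmetric] flip: ennreal_1)
    also have "\<dots> \<le> (\<Sum>i\<in>J. ennreal ((N / T) ^ 4) * ennreal (b i \<omega> ^ 4))"
      using i finite_J by (intro member_le_sum) auto
    finally show ?thesis by (auto simp: indicator_def)
  qed auto
  have "emeasure M {\<omega>\<in>space M. T < (\<Sum>i\<in>J. \<bar>b i \<omega>\<bar>)} = (\<integral>\<^sup>+\<omega>. indicator {\<omega>\<in>space M. T < (\<Sum>i\<in>J. \<bar>b i \<omega>\<bar>)} \<omega> \<partial>M)"
    by (rule nn_integral_indicator[symmetric]) measurable
  also have "\<dots> \<le> (\<integral>\<^sup>+\<omega>. (\<Sum>i\<in>J. ennreal ((N / T) ^ 4) * ennreal (b i \<omega> ^ 4)) \<partial>M)"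
    by (intro nn_integral_mono ind)
  also have "\<dots> = (\<Sum>i\<in>J. ennreal ((N / T) ^ 4) * 3)"
    by (subst nn_integral_sum) (auto simp: nn_integral_cmult fourth_moment)
  also have "\<dots> = ennreal (N * ((N / T) ^ 4 * 3))"
    using assms by (simp add: N_def ennreal_mult flip: ennreal_of_nat_eq_real_of_nat)
  also have "N * ((N / T) ^ 4 * 3) = 3 * N ^ 5 / T ^ 4"
    by (simp add: power_divide power_numeral_reduce)
  finally show ?thesis unfolding N_def .
qed

end

section \<open>Many zeros in a short interval force small values\<close>

text \<open>Rolle's theorem between neighbouring zeros. That the new zeros lie strictly between elements of
  \<open>Z\<close> is what the induction needs: a zero found to the right of the old maximum is then a new one.\<close>
lemma zeros_of_derivative:
  fixes f f' :: "real \<Rightarrow> real"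
  assumes "finite Z" "\<And>z. z \<in> Z \<Longrightarrow> f z = 0" "\<And>x. (f has_real_derivative f' x) (at x)"
  shows "\<exists>Z'. finite Z' \<and> card Z' = card Z - 1 \<and> (\<forall>z\<in>Z'. f' z = 0 \<and> (\<exists>u\<in>Z. \<exists>v\<in>Z. u < z \<and> z < v))"
  using assms(1,2)
proof (induction Z rule: finite_linorder_max_induct)
  case empty
  then show ?case by auto
next
  case (insert b A)
  show ?case
  proof (cases "A = {}")
    case True
    then show ?thesis by auto
  next
    case False
    obtain Z' where Z': "finite Z'" "card Z' = card A - 1"
      "\<forall>z\<in>Z'. f' z = 0 \<and> (\<exists>u\<in>A. \<exists>v\<in>A. u < z \<and> z < v)"
      using insert by auto
    define m where "m = Max A"
    have m: "m \<in> A" "\<And>a. a \<in> A \<Longrightarrow> a \<le> m" using False insert.hyps by (auto simp: m_def)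
    then have "m < b" using insert.hyps by blast
    moreover have "continuous_on {m..b} f"
      using assms(3) by (meson DERIV_isCont continuous_at_imp_continuous_on)
    ultimately obtain z where z: "m < z" "z < b" "f' z = 0"
      using MVT2[of m b f f'] assms(3) insert.prems m by (metis diff_self insertCI mult_eq_0_iff
          order_less_irrefl right_minus_eq)
    have "z \<notin> Z'" using Z' m z by force
    moreover have "card A > 0" using False insert.hyps by (simp add: card_gt_0_iff)
    ultimately show ?thesis
      using Z' z m insert.hyps
      by (intro exI[of _ "insert z Z'"]) auto
  qed
qed

lemma zero_of_iterated_derivative:
  fixes F :: "nat \<Rightarrow> real \<Rightarrow> real"
  assumes "\<And>i x. (F i has_real_derivative F (Suc i) x) (at x)"
    and "finite Z" "card Z = Suc k" "Z \<subseteq> {s..t}" "\<And>z. z \<in> Z \<Longrightarrow> F 0 z = 0"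
  shows "\<exists>z\<in>{s..t}. F k z = 0"
  using assms
proof (induction k arbitrary: F Z)
  case 0
  then obtain z where "z \<in> Z" by fastforce
  then show ?case using 0 by blast
next
  case (Suc k)
  obtain Z' where Z': "finite Z'" "card Z' = card Z - 1"
    "\<forall>z\<in>Z'. F 1 z = 0 \<and> (\<exists>u\<in>Z. \<exists>v\<in>Z. u < z \<and> z < v)"
    using zeros_of_derivative[of Z "F 0" "F 1"] Suc.prems by auto
  have "\<exists>z\<in>{s..t}. F (Suc k) z = 0"
  proof (rule Suc.IH[where F = "\<lambda>i. F (Suc i)"])
    show "Z' \<subseteq> {s..t}"
    proof
      fix z assume "z \<in> Z'"
      then obtain u v where "u \<in> Z" "v \<in> Z" "u < z" "z < v" using Z' by blast
      then show "z \<in> {s..t}" using Suc.prems(4) by force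
    qed
  qed (use Z' Suc.prems in auto)
  then show ?case .
qed

text \<open>The error term of polynomial interpolation at the nodes \<open>Z\<close>. The multiple \<open>c\<close> of the node
  polynomial \<open>P\<close> is chosen such that \<open>F 0 - c * P\<close> has \<open>x\<close> as one more zero; its derivative of order
  \<open>card Z\<close>, which is \<open>F (card Z) - c * fact (card Z)\<close>, therefore vanishes somewhere.\<close>
lemma bound_by_iterated_derivative:
  fixes F :: "nat \<Rightarrow> real \<Rightarrow> real"
  assumes F: "\<And>i x. (F i has_real_derivative F (Suc i) x) (at x)"
    and Z: "finite Z" "Z \<subseteq> {s..t}" "\<And>z. z \<in> Z \<Longrightarrow> F 0 z = 0"
    and B: "\<And>x. x \<in> {s..t} \<Longrightarrow> \<bar>F (card Z) x\<bar> \<le> B" and x: "x \<in> {s..t}"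
  shows "\<bar>F 0 x\<bar> \<le> B * (t - s) ^ card Z / fact (card Z)"
proof (cases "x \<in> Z")
  case True
  have "0 \<le> B" using B[OF x] by simp
  then show ?thesis using True Z x by simp
next
  case False
  define P where "P = (\<Prod>z\<in>Z. [:- z, 1:])"
  define k where "k = card Z"
  have poly_P: "poly P y = (\<Prod>z\<in>Z. y - z)" for y by (simp add: P_def poly_prod)
  have "degree P = k"
    unfolding P_def k_def by (simp add: degree_prod_eq_sum_degree)
  moreover have "lead_coeff P = 1"
    unfolding P_def by (subst lead_coeff_prod) simp
  ultimately have P: "degree P = k" "coeff P k = 1" by auto
  then have dk: "poly ((pderiv ^^ k) P) y = fact k" for y
  proof -
    have "degree ((pderiv ^^ k) P) = 0" using P by (simp add: degree_higher_pderiv)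
    then obtain a where a: "(pderiv ^^ k) P = [:a:]" by (rule degree_eq_zeroE)
    have "coeff ((pderiv ^^ k) P) 0 = pochhammer (of_nat (Suc 0)) k * coeff P k"
      by (subst coeff_higher_pderiv) simp
    then have "a = fact k" using a P by (simp add: pochhammer_fact)
    then show ?thesis using a by simp
  qed
  define c where "c = F 0 x / poly P x"
  have Px: "poly P x \<noteq> 0" using False Z by (simp add: poly_P)
  have "\<exists>z\<in>{s..t}. F k z - c * poly ((pderiv ^^ k) P) z = 0"
  proof (rule zero_of_iterated_derivative[where F = "\<lambda>i y. F i y - c * poly ((pderiv ^^ i) P) y"])
    show "((\<lambda>y. F i y - c * poly ((pderiv ^^ i) P) y) has_real_derivative
        F (Suc i) y - c * poly ((pderiv ^^ Suc i) P) y) (at y)" for i y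
      by (auto intro!: derivative_eq_intros F)
    show "F 0 z - c * poly ((pderiv ^^ 0) P) z = 0" if "z \<in> insert x Z" for z
      using that Z Px by (auto simp: c_def poly_P intro!: prod_zero)
  qed (use Z x False in \<open>auto simp: k_def\<close>)
  then obtain \<xi> where \<xi>: "\<xi> \<in> {s..t}" "F k \<xi> = c * fact k" by (auto simp: dk)
  have "\<bar>c\<bar> * fact k \<le> B" using B[OF \<xi>(1)] \<xi>(2) by (simp add: k_def abs_mult)
  then have c: "\<bar>c\<bar> \<le> B / fact k" by (simp add: field_simps)
  have "\<bar>poly P x\<bar> \<le> (\<Prod>z\<in>Z. t - s)"
    unfolding poly_P abs_prod using x Z by (intro prod_mono) (force simp: abs_le_iff)
  then have "\<bar>c\<bar> * \<bar>poly P x\<bar> \<le> B / fact k * (t - s) ^ k"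
    using c by (intro mult_mono) (auto simp: k_def intro: order_trans[OF abs_ge_zero])
  moreover have "\<bar>F 0 x\<bar> = \<bar>c\<bar> * \<bar>poly P x\<bar>" using Px by (simp add: c_def)
  ultimately show ?thesis by (simp add: k_def)
qed

lemma power_div_fact_le_exp: "x \<ge> 0 \<Longrightarrow> x ^ k / fact k \<le> exp (x::real)"
  using sum_le_suminf[of "\<lambda>n. x ^ n / fact n" "{k}"] summable_exp[of x]
  by (simp add: exp_def divide_inverse scaleR_conv_of_real mult.commute)

text \<open>With \<open>k\<close> zeros the interpolation error is at most \<open>a ^ k / fact k\<close> times the coefficient sum, where
  \<open>a = n * (t - s)\<close>. This factor drops below \<open>exp (- k)\<close> once \<open>k \<ge> exp 2 * a\<close>, by
  \<open>y ^ k / fact k \<le> exp y\<close> at \<open>y = exp 2 * a\<close>.\<close>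
lemma cos_poly_small_of_many_zeros:
  assumes Z: "finite Z" "Z \<subseteq> {s..t}" "\<And>z. z \<in> Z \<Longrightarrow> cos_poly n c z = 0"
    and k: "exp 2 * (real n * (t - s)) \<le> real (card Z)" and x: "x \<in> {s..t}"
  shows "\<bar>cos_poly n c x\<bar> \<le> exp (- real (card Z)) * (\<Sum>j\<le>n. \<bar>c j\<bar>)"
proof -
  define F where "F i y = (\<Sum>j\<le>n. c j * real j ^ i * cos (real j * y + real i * (pi / 2)))" for i y
  define k where "k = card Z"
  define S where "S = (\<Sum>j\<le>n. \<bar>c j\<bar>)"
  define a where "a = real n * (t - s)"
  have S: "S \<ge> 0" by (simp add: S_def sum_nonneg)
  have a: "a \<ge> 0" using x by (simp add: a_def)
  have F0: "F 0 = cos_poly n c" by (simp add: F_def cos_poly_def fun_eq_iff)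
  have D: "(F i has_real_derivative F (Suc i) y) (at y)" for i y
  proof -
    have "cos (real j * y + real (Suc i) * (pi / 2)) = - sin (real j * y + real i * (pi / 2))" for j
    proof -
      have "real j * y + real (Suc i) * (pi / 2) = (real j * y + real i * (pi / 2)) + pi / 2"
        by (simp add: distrib_right add_divide_distrib)
      then show ?thesis by (simp only: cos_add cos_pi_half sin_pi_half mult_zero_right mult_1_right diff_0)
    qed
    note c = this
    show ?thesis
      unfolding F_def
    proof (rule DERIV_sum)
      fix j
      show "((\<lambda>y. c j * real j ^ i * cos (real j * y + real i * (pi / 2))) has_real_derivative
         c j * real j ^ Suc i * cos (real j * y + real (Suc i) * (pi / 2))) (at y)"
        unfolding c by (auto intro!: derivative_eq_intros)
    qed
  qed
  have B: "\<bar>F k y\<bar> \<le> real n ^ k * S" for y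
  proof -
    have "\<bar>F k y\<bar> \<le> (\<Sum>j\<le>n. \<bar>c j * real j ^ k * cos (real j * y + real k * (pi / 2))\<bar>)"
      unfolding F_def by (rule sum_abs)
    also have "\<dots> \<le> (\<Sum>j\<le>n. \<bar>c j\<bar> * (real n ^ k * 1))"
      unfolding abs_mult mult.assoc by (intro sum_mono mult_left_mono mult_mono) (auto intro: power_mono)
    also have "\<dots> = real n ^ k * S" by (simp add: S_def sum_distrib_left mult.commute)
    finally show ?thesis .
  qed
  have small: "a ^ k / fact k \<le> exp (- real k)"
  proof -
    have "(exp 2 * a) ^ k / fact k \<le> exp (exp 2 * a)"
      using a by (intro power_div_fact_le_exp) simp
    also have "\<dots> \<le> exp (real k)" using k by (simp add: a_def k_def)
    also have "exp (real k) = exp (- real k) * exp 2 ^ k"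
      by (simp add: exp_of_nat_mult[symmetric] exp_add[symmetric] algebra_simps)
    finally have "exp 2 ^ k * (a ^ k / fact k) \<le> exp 2 ^ k * exp (- real k)"
      by (simp add: power_mult_distrib mult.commute)
    then show ?thesis by (rule mult_left_le_imp_le) simp
  qed
  have "\<bar>F 0 x\<bar> \<le> real n ^ k * S * (t - s) ^ k / fact k"
    unfolding k_def using Z x B D by (intro bound_by_iterated_derivative) (auto simp: F0 k_def)
  also have "\<dots> = S * (a ^ k / fact k)" by (simp add: a_def power_mult_distrib)
  also have "\<dots> \<le> S * exp (- real k)" by (rule mult_left_mono[OF small S])
  finally show ?thesis by (simp add: F0 S_def k_def mult.commute)
qed

section \<open>Counting zeros through the cells of a partition\<close>

text \<open>Unlike \<open>num_zeros\<close>, this count is infinite when there are infinitely many zeros, so it is monotone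
  and additive in \<open>S\<close> without any finiteness assumption. Where it is finite, the two counts agree.\<close>
definition zero_count :: "(real \<Rightarrow> real) \<Rightarrow> real set \<Rightarrow> ennreal" where
  "zero_count f S = emeasure (count_space UNIV) {x \<in> S. f x = 0}"

lemma enn2real_zero_count: "enn2real (zero_count f S) = real (num_zeros f S)"
  by (cases "finite {x \<in> S. f x = 0}") (simp_all add: zero_count_def num_zeros_def emeasure_count_space)

lemma zero_count_mono: "A \<subseteq> B \<Longrightarrow> zero_count f A \<le> zero_count f B"
  unfolding zero_count_def by (rule emeasure_mono) auto

lemma zero_count_Un: "zero_count f (A \<union> B) \<le> zero_count f A + zero_count f B"
proof -
  have "{x \<in> A \<union> B. f x = 0} = {x \<in> A. f x = 0} \<union> {x \<in> B. f x = 0}" by auto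
  then show ?thesis unfolding zero_count_def by (simp add: emeasure_subadditive)
qed

lemma zero_count_UN_le:
  assumes "finite K"
  shows "zero_count f (\<Union>k\<in>K. S k) \<le> (\<Sum>k\<in>K. zero_count f (S k))"
proof -
  have "{x \<in> (\<Union>k\<in>K. S k). f x = 0} = (\<Union>k\<in>K. {x \<in> S k. f x = 0})" by auto
  then show ?thesis unfolding zero_count_def using assms
    by (simp add: emeasure_subadditive_finite)
qed

lemma zero_count_UN_disjoint:
  assumes "finite K" "disjoint_family_on S K"
  shows "(\<Sum>k\<in>K. zero_count f (S k)) = zero_count f (\<Union>k\<in>K. S k)"
proof -
  have "{x \<in> (\<Union>k\<in>K. S k). f x = 0} = (\<Union>k\<in>K. {x \<in> S k. f x = 0})" by auto
  moreover have "disjoint_family_on (\<lambda>k. {x \<in> S k. f x = 0}) K"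
    using assms(2) unfolding disjoint_family_on_def by blast
  ultimately show ?thesis unfolding zero_count_def using assms(1)
    by (simp add: sum_emeasure)
qed

lemma zero_count_cong:
  assumes "\<And>x. x \<in> S \<Longrightarrow> f x = 0 \<longleftrightarrow> g x = 0"
  shows "zero_count f S = zero_count g S"
proof -
  have "{x \<in> S. f x = 0} = {x \<in> S. g x = 0}" using assms by auto
  then show ?thesis by (simp add: zero_count_def)
qed

lemma zero_count_insert:
  assumes "z \<notin> S"
  shows "zero_count f (insert z S) = zero_count f S + (if f z = 0 then 1 else 0)"
proof -
  have "{x \<in> insert z S. f x = 0} = {x \<in> S. f x = 0} \<union> (if f z = 0 then {z} else {})" by auto
  moreover have "emeasure (count_space UNIV) {x \<in> S. f x = 0} + emeasure (count_space UNIV) (if f z = 0 then {z} else {})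
      = emeasure (count_space UNIV) ({x \<in> S. f x = 0} \<union> (if f z = 0 then {z} else {}))"
    using assms by (intro plus_emeasure) auto
  ultimately show ?thesis by (simp add: zero_count_def split: if_splits)
qed

text \<open>A bound for every finite set of zeros is a bound for the count, also when that is infinite.\<close>
lemma emeasure_count_space_le:
  assumes "\<And>F. finite F \<Longrightarrow> F \<subseteq> Z \<Longrightarrow> of_nat (card F) \<le> B"
  shows "emeasure (count_space UNIV) Z \<le> (B :: ennreal)"
proof (cases "finite Z")
  case True
  then show ?thesis using assms[of Z] by (simp add: emeasure_count_space)
next
  case False
  have "of_nat m \<le> B" for m
    using infinite_arbitrarily_large[OF False, of m] assms by metis
  then have "B = \<top>"
    by (metis ennreal_Ex_less_of_nat linorder_not_less top.not_eq_extremum)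
  then show ?thesis by simp
qed

text \<open>The cells are half-open, so that every zero lies in exactly one of them.\<close>
definition cell :: "real \<Rightarrow> real \<Rightarrow> nat \<Rightarrow> nat \<Rightarrow> real set" where
  "cell s t k i = {s + (t - s) * (real i / real k) ..< s + (t - s) * (real (Suc i) / real k)}"

definition cells_with_zero :: "(real \<Rightarrow> real) \<Rightarrow> real \<Rightarrow> real \<Rightarrow> nat \<Rightarrow> nat" where
  "cells_with_zero f s t k = card {i. i < k \<and> (\<exists>x\<in>cell s t k i. f x = 0)}"

lemma mem_cell_iff:
  assumes "s < t" "k > 0" "x \<ge> s"
  shows "x \<in> cell s t k i \<longleftrightarrow> nat \<lfloor>(x - s) * real k / (t - s)\<rfloor> = i"
proof -
  let ?y = "(x - s) * real k / (t - s)"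
  have "x \<in> cell s t k i \<longleftrightarrow> real i \<le> ?y \<and> ?y < real (Suc i)"
    using assms unfolding cell_def by (auto simp: field_simps)
  also have "\<dots> \<longleftrightarrow> \<lfloor>?y\<rfloor> = int i" by (simp add: floor_eq_iff add.commute)
  also have "\<dots> \<longleftrightarrow> nat \<lfloor>?y\<rfloor> = i" using assms by auto
  finally show ?thesis .
qed

lemma cell_subset:
  assumes "s < t" "i < k"
  shows "cell s t k i \<subseteq> {s..<t}"
proof -
  have "(t - s) * (real (Suc i) / real k) \<le> (t - s) * 1"
    using assms by (intro mult_left_mono) auto
  then show ?thesis using assms unfolding cell_def by (auto intro: order_trans[rotated])
qed

lemma cells_containing_zero_eq:
  assumes "s < t" "k > 0"
  shows "{i. i < k \<and> (\<exists>x\<in>cell s t k i. f x = 0)}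
      = (\<lambda>x. nat \<lfloor>(x - s) * real k / (t - s)\<rfloor>) ` {x \<in> {s..<t}. f x = 0}"
proof (intro subset_antisym subsetI)
    fix i assume "i \<in> {i. i < k \<and> (\<exists>x\<in>cell s t k i. f x = 0)}"
    then obtain x where x: "i < k" "x \<in> cell s t k i" "f x = 0" by blast
    then have "x \<in> {s..<t}" using cell_subset[OF assms(1) x(1)] by blast
    then show "i \<in> (\<lambda>x. nat \<lfloor>(x - s) * real k / (t - s)\<rfloor>) ` {x \<in> {s..<t}. f x = 0}"
      using x mem_cell_iff[OF assms, of x i] by force
  next
    fix i assume "i \<in> (\<lambda>x. nat \<lfloor>(x - s) * real k / (t - s)\<rfloor>) ` {x \<in> {s..<t}. f x = 0}"
    then obtain x where x: "x \<in> {s..<t}" "f x = 0" "i = nat \<lfloor>(x - s) * real k / (t - s)\<rfloor>" by blast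
    then have "x \<in> cell s t k i" using mem_cell_iff[OF assms, of x i] by simp
    moreover have "i < k"
    proof -
      have "(x - s) * real k / (t - s) < real k" using x assms by (simp add: field_simps)
      then show ?thesis using x assms by (simp add: nat_less_iff floor_less_iff)
    qed
    ultimately show "i \<in> {i. i < k \<and> (\<exists>x\<in>cell s t k i. f x = 0)}" using x by blast
qed

lemma cells_with_zero_eq:
  assumes "s < t" "k > 0"
  shows "cells_with_zero f s t k = card ((\<lambda>x. nat \<lfloor>(x - s) * real k / (t - s)\<rfloor>) ` {x \<in> {s..<t}. f x = 0})"
  by (simp add: cells_with_zero_def cells_containing_zero_eq[OF assms])

lemma cells_with_zero_le:
  assumes "s < t" "k > 0"
  shows "of_nat (cells_with_zero f s t k) \<le> zero_count f {s..<t}"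
proof (cases "finite {x \<in> {s..<t}. f x = 0}")
  case True
  then show ?thesis
    unfolding cells_with_zero_eq[OF assms] zero_count_def
    by (simp add: emeasure_count_space card_image_le)
qed (simp add: zero_count_def emeasure_count_space)

lemma eventually_cells_separate:
  assumes "s < t" "finite F" "F \<subseteq> {x \<in> {s..<t}. f x = 0}"
  shows "eventually (\<lambda>k. card F \<le> cells_with_zero f s t k) sequentially"
proof -
  have "eventually (\<lambda>k. \<forall>x\<in>F. \<forall>y\<in>F. x \<noteq> y \<longrightarrow> real k * \<bar>x - y\<bar> > t - s) sequentially"
  proof (intro eventually_ball_finite ballI assms(2))
    fix x y assume "x \<in> F" "y \<in> F"
    show "eventually (\<lambda>k. x \<noteq> y \<longrightarrow> real k * \<bar>x - y\<bar> > t - s) sequentially"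
    proof (cases "x = y")
      case False
      then have "filterlim (\<lambda>k. real k * \<bar>x - y\<bar>) at_top sequentially" 
        by real_asymp
      then show ?thesis unfolding filterlim_at_top_dense by (auto elim: eventually_mono)
    qed simp
  qed
  moreover have "eventually (\<lambda>k. k > 0) sequentially" by (rule eventually_gt_at_top)
  ultimately show ?thesis
  proof eventually_elim
    case (elim k)
    let ?g = "\<lambda>x. nat \<lfloor>(x - s) * real k / (t - s)\<rfloor>"
    have "inj_on ?g F"
    proof (rule inj_onI, rule ccontr)
      fix x y assume xy: "x \<in> F" "y \<in> F" "?g x = ?g y" "x \<noteq> y"
      have "0 \<le> \<lfloor>(x - s) * real k / (t - s)\<rfloor>" "0 \<le> \<lfloor>(y - s) * real k / (t - s)\<rfloor>"
        using xy assms by auto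
      then have "\<lfloor>(x - s) * real k / (t - s)\<rfloor> = \<lfloor>(y - s) * real k / (t - s)\<rfloor>"
        using xy(3) by linarith
      then have "\<bar>(x - s) * real k / (t - s) - (y - s) * real k / (t - s)\<bar> < 1" by linarith
      also have "(x - s) * real k / (t - s) - (y - s) * real k / (t - s) = real k * (x - y) / (t - s)"
        by (simp add: diff_divide_distrib[symmetric] algebra_simps)
      finally have "real k * \<bar>x - y\<bar> < t - s" using assms by (simp add: abs_mult)
      then show False using elim xy by force
    qed
    moreover have "finite (?g ` {x \<in> {s..<t}. f x = 0})"
      unfolding cells_containing_zero_eq[OF assms(1) elim(2), symmetric] by simp
    ultimately have "card F \<le> card (?g ` {x \<in> {s..<t}. f x = 0})"
      using card_mono[OF _ image_mono[OF assms(3)], of ?g] by (simp only: card_image)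
    then show ?case by (simp only: cells_with_zero_eq[OF assms(1) elim(2)])
  qed
qed

text \<open>The cells with a zero never outnumber the zeros, and they reach any finite number of zeros once
  the mesh separates these. As a lower limit of cell counts, the number of zeros is measurable and
  Fatou's lemma applies to it.\<close>
lemma zero_count_eq_liminf:
  assumes "s < t"
  shows "zero_count f {s..<t} = liminf (\<lambda>k. of_nat (cells_with_zero f s t k))"
proof (rule antisym)
  show "zero_count f {s..<t} \<le> liminf (\<lambda>k. of_nat (cells_with_zero f s t k))"
    unfolding zero_count_def
  proof (rule emeasure_count_space_le)
    fix F assume "finite F" "F \<subseteq> {x \<in> {s..<t}. f x = 0}"
    from eventually_cells_separate[OF assms this]
    show "of_nat (card F) \<le> liminf (\<lambda>k. of_nat (cells_with_zero f s t k) :: ennreal)"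
      by (intro Liminf_bounded) (auto elim: eventually_mono)
  qed
  show "liminf (\<lambda>k. of_nat (cells_with_zero f s t k)) \<le> zero_count f {s..<t}"
  proof -
    have "liminf (\<lambda>k. of_nat (cells_with_zero f s t k)) \<le> liminf (\<lambda>k::nat. zero_count f {s..<t})"
      by (intro Liminf_mono eventually_mono[OF eventually_gt_at_top[of 0]]) (rule cells_with_zero_le[OF assms])
    then show ?thesis by (simp add: Liminf_const)
  qed
qed

text \<open>The interval is exhausted by the compact intervals \<open>{u..v - 1 / Suc j}\<close>, on which a continuous
  function that takes arbitrarily small values has a zero. The right-hand side involves countably many
  values of \<open>f\<close> only, hence measurability of the event.\<close>
lemma exists_zero_iff_rational:
  fixes f :: "real \<Rightarrow> real"
  assumes "continuous_on {u..v} f"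
  shows "(\<exists>x\<in>{u..<v}. f x = 0) \<longleftrightarrow>
    (\<exists>j::nat. \<forall>m::nat. \<exists>q::rat. u \<le> real_of_rat q \<and> real_of_rat q < v - 1 / Suc j \<and> \<bar>f (real_of_rat q)\<bar> < 1 / Suc m)"
proof
  assume "\<exists>x\<in>{u..<v}. f x = 0"
  then obtain x where x: "u \<le> x" "x < v" "f x = 0" by auto
  obtain j where j: "1 / real (Suc j) < v - x"
    using x by (metis diff_gt_0_iff_gt nat_approx_posE)
  show "\<exists>j::nat. \<forall>m::nat. \<exists>q::rat. u \<le> real_of_rat q \<and> real_of_rat q < v - 1 / Suc j \<and> \<bar>f (real_of_rat q)\<bar> < 1 / Suc m"
  proof (intro exI[of _ j] allI)
    fix m :: nat
    obtain d where d: "d > 0" "\<And>y. y \<in> {u..v} \<Longrightarrow> dist y x < d \<Longrightarrow> dist (f y) (f x) < 1 / Suc m"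
      using assms x unfolding continuous_on_iff
      by (metis atLeastAtMost_iff less_eq_real_def of_nat_0_less_iff zero_less_Suc zero_less_divide_1_iff)
    obtain q where q: "x < real_of_rat q" "real_of_rat q < min (x + d) (v - 1 / Suc j)"
      using of_rat_dense[of x "min (x + d) (v - 1 / Suc j)"] d j by auto
    have "dist (f (real_of_rat q)) (f x) < 1 / Suc m"
      using q x by (intro d(2)) (auto simp: dist_real_def intro: order_trans[of _ "v - 1 / Suc j"])
    then show "\<exists>q::rat. u \<le> real_of_rat q \<and> real_of_rat q < v - 1 / Suc j \<and> \<bar>f (real_of_rat q)\<bar> < 1 / Suc m"
      using q x by (intro exI[of _ q]) (auto simp: dist_real_def)
  qed
next
  assume "\<exists>j::nat. \<forall>m::nat. \<exists>q::rat. u \<le> real_of_rat q \<and> real_of_rat q < v - 1 / Suc j \<and> \<bar>f (real_of_rat q)\<bar> < 1 / Suc m"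
  then obtain j :: nat and q :: "nat \<Rightarrow> rat" where q: "\<And>m. u \<le> real_of_rat (q m)" "\<And>m. real_of_rat (q m) < v - 1 / Suc j"
      "\<And>m. \<bar>f (real_of_rat (q m))\<bar> < 1 / Suc m" by metis
  have "seq_compact {u..v - 1 / Suc j}" by (simp add: compact_eq_seq_compact_metric[symmetric])
  moreover have "\<forall>m. real_of_rat (q m) \<in> {u..v - 1 / Suc j}" using q by (auto simp: less_imp_le)
  ultimately obtain x r where x: "x \<in> {u..v - 1 / Suc j}" "strict_mono (r :: nat \<Rightarrow> nat)"
      "((\<lambda>m. real_of_rat (q m)) \<circ> r) \<longlonglongrightarrow> x"
    by (rule seq_compactE)
  have pos: "0 < 1 / real (Suc j)" by simp
  have "{u..v - e} \<subseteq> {u..<v}" if "0 < e" for e using that by auto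
  from this[OF pos] have sub: "{u..v - 1 / Suc j} \<subseteq> {u..<v}" .
  then have sub': "{u..v - 1 / Suc j} \<subseteq> {u..v}" by force
  have qv: "real_of_rat (q m) \<in> {u..v}" for m
    using q(1,2)[of m] by (intro subsetD[OF sub']) (simp only: atLeastAtMost_iff less_imp_le simp_thms)
  have "(\<lambda>m. f (real_of_rat (q (r m)))) \<longlonglongrightarrow> f x"
    by (rule continuous_on_tendsto_compose[OF assms])
       (use x(3) subsetD[OF sub' x(1)] qv in \<open>auto simp: comp_def\<close>)
  moreover have "(\<lambda>m. f (real_of_rat (q (r m)))) \<longlonglongrightarrow> 0"
  proof (rule Lim_null_comparison)
    show "(\<lambda>m. 1 / real (Suc m)) \<longlonglongrightarrow> 0" by real_asymp 
    show "eventually (\<lambda>m. norm (f (real_of_rat (q (r m)))) \<le> 1 / real (Suc m)) sequentially"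
    proof (intro always_eventually allI)
      fix m
      have "1 / real (Suc (r m)) \<le> 1 / real (Suc m)"
        using seq_suble[OF x(2), of m] by (simp add: frac_le)
      then show "norm (f (real_of_rat (q (r m)))) \<le> 1 / real (Suc m)"
        using q(3)[of "r m"] by simp
    qed
  qed
  ultimately have "f x = 0" by (rule LIMSEQ_unique)
  moreover have "x < v" using x(1) sub by auto
  ultimately show "\<exists>x\<in>{u..<v}. f x = 0" using x(1) by auto
qed

lemma measurable_exists_zero:
  fixes W :: "real \<Rightarrow> 'a \<Rightarrow> real"
  assumes cont: "\<And>\<omega>. \<omega> \<in> space M \<Longrightarrow> continuous_on {u..v} (\<lambda>x. W x \<omega>)"
    and W [measurable]: "\<And>x. W x \<in> borel_measurable M"
  shows "{\<omega>\<in>space M. \<exists>x\<in>{u..<v}. W x \<omega> = 0} \<in> sets M"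
proof -
  have "{\<omega>\<in>space M. \<exists>x\<in>{u..<v}. W x \<omega> = 0} = {\<omega>\<in>space M. \<exists>j::nat. \<forall>m::nat. \<exists>q::rat.
     u \<le> real_of_rat q \<and> real_of_rat q < v - 1 / Suc j \<and> \<bar>W (real_of_rat q) \<omega>\<bar> < 1 / Suc m}"
    using exists_zero_iff_rational[OF cont] by (intro Collect_cong conj_cong refl) simp
  also have "\<dots> \<in> sets M" by measurable
  finally show ?thesis .
qed

lemma cells_with_zero_eq_sum:
  "of_nat (cells_with_zero f s t k) = (\<Sum>i<k. of_bool (\<exists>x\<in>cell s t k i. f x = 0) :: ennreal)"
proof -
  have "(\<Sum>i<k. of_bool (\<exists>x\<in>cell s t k i. f x = 0) :: ennreal)
      = of_nat (card ({..<k} \<inter> {i. \<exists>x\<in>cell s t k i. f x = 0}))"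
    by (simp add: sum.If_cases of_bool_def)
  moreover have "{..<k} \<inter> {i. \<exists>x\<in>cell s t k i. f x = 0} = {i. i < k \<and> (\<exists>x\<in>cell s t k i. f x = 0)}"
    by auto
  ultimately show ?thesis by (simp add: cells_with_zero_def)
qed

lemma measurable_cell_zero:
  fixes W :: "real \<Rightarrow> 'a \<Rightarrow> real"
  assumes "s < t" "i < k"
    and cont: "\<And>\<omega>. \<omega> \<in> space M \<Longrightarrow> continuous_on {s..t} (\<lambda>x. W x \<omega>)"
    and W: "\<And>x. W x \<in> borel_measurable M"
  shows "{\<omega>\<in>space M. \<exists>x\<in>cell s t k i. W x \<omega> = 0} \<in> sets M"
  unfolding cell_def
proof (rule measurable_exists_zero[OF continuous_on_subset[OF cont] W])
  have *: "{s + a..s + b} \<subseteq> {s..t}" if "0 \<le> a" "b \<le> t - s" for a b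
    using that by auto
  show "{s + (t - s) * (real i / real k)..s + (t - s) * (real (Suc i) / real k)} \<subseteq> {s..t}"
    using assms(1,2) by (intro * mult_left_le) auto
qed

lemma measurable_cells_with_zero:
  fixes W :: "real \<Rightarrow> 'a \<Rightarrow> real"
  assumes "s < t"
    and cont: "\<And>\<omega>. \<omega> \<in> space M \<Longrightarrow> continuous_on {s..t} (\<lambda>x. W x \<omega>)"
    and W: "\<And>x. W x \<in> borel_measurable M"
  shows "(\<lambda>\<omega>. of_nat (cells_with_zero (\<lambda>x. W x \<omega>) s t k) :: ennreal) \<in> borel_measurable M"
  unfolding cells_with_zero_eq_sum
proof (intro borel_measurable_sum)
  fix i assume "i \<in> {..<k}"
  then have "{\<omega>\<in>space M. \<exists>x\<in>cell s t k i. W x \<omega> = 0} \<in> sets M"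
    using measurable_cell_zero[OF assms(1) _ cont W] by simp
  then show "(\<lambda>\<omega>. of_bool (\<exists>x\<in>cell s t k i. W x \<omega> = 0) :: ennreal) \<in> borel_measurable M"
    unfolding of_bool_def by (intro measurable_If) (auto simp: pred_def)
qed

lemma measurable_zero_count:
  fixes W :: "real \<Rightarrow> 'a \<Rightarrow> real"
  assumes "s < t"
    and cont: "\<And>\<omega>. \<omega> \<in> space M \<Longrightarrow> continuous_on {s..t} (\<lambda>x. W x \<omega>)"
    and W: "\<And>x. W x \<in> borel_measurable M"
  shows "(\<lambda>\<omega>. zero_count (\<lambda>x. W x \<omega>) {s..<t}) \<in> borel_measurable M"
  unfolding zero_count_eq_liminf[OF assms(1)]
  by (intro borel_measurable_liminf measurable_cells_with_zero[OF assms])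

section \<open>The angle between nearby points of a curve\<close>

text \<open>The vector on the left is \<open>A\<close> times the component of \<open>w\<close> orthogonal to \<open>v\<close>. So the Gram
  determinant on the right is, up to \<open>sqrt A\<close>, the square of a seminorm of \<open>w\<close>, and the triangle
  inequality applies to it.\<close>
lemma L2_set_gram:
  assumes "A = (\<Sum>i\<in>J. (v i)\<^sup>2)"
  shows "L2_set (\<lambda>i. A * w i - (\<Sum>j\<in>J. v j * w j) * v i) J
    = sqrt A * sqrt (A * (\<Sum>i\<in>J. (w i)\<^sup>2) - (\<Sum>i\<in>J. v i * w i)\<^sup>2)"
proof -
  define s where "s = (\<Sum>i\<in>J. v i * w i)"
  have "(\<Sum>i\<in>J. (A * w i - s * v i)\<^sup>2)
      = (\<Sum>i\<in>J. A\<^sup>2 * (w i)\<^sup>2 - 2 * A * s * (v i * w i) + s\<^sup>2 * (v i)\<^sup>2)"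
    by (intro sum.cong) (auto simp: power2_eq_square algebra_simps)
  also have "\<dots> = A\<^sup>2 * (\<Sum>i\<in>J. (w i)\<^sup>2) - 2 * A * s * s + s\<^sup>2 * A"
    by (simp add: sum.distrib sum_subtractf sum_distrib_left[symmetric] s_def assms)
  also have "\<dots> = A * (A * (\<Sum>i\<in>J. (w i)\<^sup>2) - s\<^sup>2)"
    by (simp add: power2_eq_square algebra_simps)
  finally show ?thesis unfolding L2_set_def s_def by (simp add: real_sqrt_mult)
qed

text \<open>For \<open>\<theta> = arctan (X / K)\<close> the left-hand side is \<open>sin \<theta> * cos \<theta> = sin (2 * \<theta>) / 2\<close>.\<close>
lemma arctan_ge_ratio:
  assumes "X \<ge> 0" "K > 0"
  shows "X * K / (K\<^sup>2 + X\<^sup>2) \<le> arctan (X / K)"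
proof -
  define r where "r = X / K"
  have r: "r \<ge> 0" using assms by (simp add: r_def)
  have p: "1 + r\<^sup>2 > 0" by (simp add: add_pos_nonneg)
  have "sin (2 * arctan r) = 2 * (r / (1 + r\<^sup>2))"
    using p by (simp add: sin_double sin_arctan cos_arctan)
  moreover have "sin (2 * arctan r) \<le> 2 * arctan r" using r by (intro sin_x_le_x) simp
  ultimately have "r / (1 + r\<^sup>2) \<le> arctan r" by simp
  moreover have "r / (1 + r\<^sup>2) = X * K / (K\<^sup>2 + X\<^sup>2)"
    using assms p by (simp add: r_def field_simps power2_eq_square)
  ultimately show ?thesis by (simp add: r_def)
qed

text \<open>Here \<open>v\<close> and \<open>u\<close> are points of a curve at parameter distance \<open>h\<close> and \<open>d\<close> is the tangent at
  \<open>v\<close>; the angle between \<open>v\<close> and \<open>u\<close> is \<open>arctan (X / K)\<close>. The area \<open>X\<close> of the parallelogram on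
  \<open>v\<close> and \<open>u\<close> differs from \<open>h * sqrt E\<close>, the one on \<open>v\<close> and \<open>h d\<close>, by at most
  \<open>\<eta> * h\<^sup>2 * A\<close>, and \<open>K\<close> differs from \<open>A\<close> by at most \<open>\<kappa> * h * A\<close>. So the angle is close to \<open>h\<close>
  times the speed \<open>sqrt E / A\<close>, which lies between \<open>lo\<close> and \<open>hi\<close>.\<close>
lemma angle_of_secant:
  fixes v u d :: "nat \<Rightarrow> real" and J :: "nat set"
  defines "A \<equiv> (\<Sum>i\<in>J. (v i)\<^sup>2)" and "K \<equiv> (\<Sum>i\<in>J. v i * u i)"
  defines "X \<equiv> sqrt (A * (\<Sum>i\<in>J. (u i)\<^sup>2) - K\<^sup>2)"
  defines "E \<equiv> A * (\<Sum>i\<in>J. (d i)\<^sup>2) - (\<Sum>i\<in>J. v i * d i)\<^sup>2"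
  assumes J: "finite J" and h: "h > 0" and D: "D \<ge> 0" "D' \<ge> 0" and \<mu>: "\<mu> > 0" "\<mu> \<le> A"
    and R: "\<And>i. i \<in> J \<Longrightarrow> \<bar>u i - v i - h * d i\<bar> \<le> D * h\<^sup>2"
    and w: "\<And>i. i \<in> J \<Longrightarrow> \<bar>u i - v i\<bar> \<le> D' * h"
    and lohi: "lo \<ge> 0" "hi \<ge> 0" "lo\<^sup>2 * A\<^sup>2 \<le> E" "E \<le> hi\<^sup>2 * A\<^sup>2"
    and \<kappa>: "\<kappa> = sqrt (real (card J)) * D' / sqrt \<mu>" "\<kappa> * h < 1"
    and \<eta>: "\<eta> = sqrt (real (card J)) * D / sqrt \<mu>"
  shows "K > 0" "arctan (X / K) \<le> (h * hi + \<eta> * h\<^sup>2) / (1 - \<kappa> * h)"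
    "(h * lo - \<eta> * h\<^sup>2) * (1 - \<kappa> * h) / (1 + \<kappa> * h)\<^sup>2 \<le> arctan (X / K)"
proof -
  define N where "N = real (card J)"
  define T where "T w = L2_set (\<lambda>i. A * w i - (\<Sum>j\<in>J. v j * w j) * v i) J" for w
  define r where "r i = u i - v i - h * d i" for i
  have A: "A > 0" "sqrt A > 0" using \<mu> by auto
  have nn: "\<kappa> \<ge> 0" "\<eta> \<ge> 0" using D \<mu> by (auto simp: \<kappa> \<eta>)
  have sA: "sqrt A = A / sqrt A" using A by (simp add: real_div_sqrt)
  have sA': "c * sqrt A \<le> A * (c / sqrt \<mu>)" if "c \<ge> 0" for c
  proof -
    have "c * sqrt A = A * (c / sqrt A)" using sA by (metis mult.commute times_divide_eq_right)
    also have "\<dots> \<le> A * (c / sqrt \<mu>)"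
      using \<mu> A that by (intro mult_left_mono divide_left_mono) auto
    finally show ?thesis .
  qed
  have TU: "T u = sqrt A * X" unfolding T_def X_def K_def by (rule L2_set_gram) (simp add: A_def)
  have TD: "T d = sqrt A * sqrt E" unfolding T_def E_def by (rule L2_set_gram) (simp add: A_def)
  have split: "A * u i - (\<Sum>j\<in>J. v j * u j) * v i
      = h * (A * d i - (\<Sum>j\<in>J. v j * d j) * v i) + (A * r i - (\<Sum>j\<in>J. v j * r j) * v i)" for i
  proof -
    have Sr: "(\<Sum>j\<in>J. v j * r j) = (\<Sum>j\<in>J. v j * u j) - A - h * (\<Sum>j\<in>J. v j * d j)"
      by (simp add: r_def A_def right_diff_distrib sum_subtractf sum_distrib_left power2_eq_square mult_ac)
    show ?thesis unfolding Sr by (simp add: r_def algebra_simps)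
  qed
  have hT: "L2_set (\<lambda>i. h * (A * d i - (\<Sum>j\<in>J. v j * d j) * v i)) J = h * T d"
    unfolding T_def using h by (simp add: L2_set_left_distrib[symmetric] L2_set_right_distrib)
  have TR: "T r \<le> A * (sqrt N * (D * h\<^sup>2))"
  proof -
    have "T r = sqrt A * sqrt (A * (\<Sum>i\<in>J. (r i)\<^sup>2) - (\<Sum>i\<in>J. v i * r i)\<^sup>2)"
      unfolding T_def by (rule L2_set_gram) (simp add: A_def)
    also have "\<dots> \<le> sqrt A * sqrt (A * (\<Sum>i\<in>J. (r i)\<^sup>2))"
      using A by (intro mult_left_mono real_sqrt_le_mono) auto
    also have "\<dots> \<le> sqrt A * sqrt (A * (N * (D * h\<^sup>2)\<^sup>2))"
    proof -
      have "(\<Sum>i\<in>J. (r i)\<^sup>2) \<le> (\<Sum>i\<in>J. (D * h\<^sup>2)\<^sup>2)"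
        using R D by (intro sum_mono) (auto simp: r_def intro!: abs_le_square_iff[THEN iffD1])
      then show ?thesis using A by (intro mult_left_mono real_sqrt_le_mono) (auto simp: N_def)
    qed
    also have "\<dots> = A * (sqrt N * (D * h\<^sup>2))"
      using A D by (simp add: real_sqrt_mult)
    finally show ?thesis .
  qed
  have "sqrt A * (sqrt A * c) = A * c" for c using A by (simp add: mult.assoc[symmetric])
  then have TR': "T r \<le> sqrt A * (sqrt A * (sqrt N * (D * h\<^sup>2)))" using TR by (simp only:)
  have up: "T u \<le> h * T d + T r"
    unfolding hT[symmetric] unfolding T_def split by (rule L2_set_triangle_ineq)
  have low: "h * T d \<le> T u + T r"
  proof -
    have eq: "h * (A * d i - (\<Sum>j\<in>J. v j * d j) * v i)
      = (A * u i - (\<Sum>j\<in>J. v j * u j) * v i) + - (A * r i - (\<Sum>j\<in>J. v j * r j) * v i)" for i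
      unfolding split by simp
    have "h * T d \<le> T u + L2_set (\<lambda>i. - (A * r i - (\<Sum>j\<in>J. v j * r j) * v i)) J"
      unfolding hT[symmetric] unfolding T_def eq by (rule L2_set_triangle_ineq)
    then show ?thesis by (simp only: T_def L2_set_def power2_minus)
  qed
  have N0: "sqrt N * (D * h\<^sup>2) \<ge> 0" using D by (simp add: N_def)
  have \<eta>': "sqrt N * (D * h\<^sup>2) / sqrt \<mu> = \<eta> * h\<^sup>2" by (simp add: \<eta> N_def)
  have X0: "X \<ge> 0"
    using TU A by (metis L2_set_nonneg T_def zero_le_mult_iff not_less)
  have sE: "lo * A \<le> sqrt E" "sqrt E \<le> hi * A"
    using lohi A by (auto intro!: real_le_rsqrt real_le_lsqrt simp: power_mult_distrib)
  have Xup: "X \<le> A * (h * hi + \<eta> * h\<^sup>2)"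
  proof -
    have "sqrt A * X \<le> sqrt A * (h * sqrt E + sqrt A * (sqrt N * (D * h\<^sup>2)))"
      using up TR' unfolding TU TD by (simp add: distrib_left mult.left_commute)
    then have "X \<le> h * sqrt E + sqrt N * (D * h\<^sup>2) * sqrt A" using A by (simp add: mult.commute)
    also have "\<dots> \<le> h * (hi * A) + A * (\<eta> * h\<^sup>2)"
      using sE h sA'[OF N0] unfolding \<eta>' by (intro add_mono mult_left_mono) auto
    finally show ?thesis by (simp add: algebra_simps)
  qed
  have Xlow: "A * (h * lo - \<eta> * h\<^sup>2) \<le> X"
  proof -
    have "sqrt A * (h * sqrt E) \<le> sqrt A * (X + sqrt A * (sqrt N * (D * h\<^sup>2)))"
      using low TR' unfolding TU TD by (simp add: distrib_left mult.left_commute)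
    then have "h * sqrt E \<le> X + sqrt N * (D * h\<^sup>2) * sqrt A" using A by (simp add: mult.commute)
    then have "h * (lo * A) \<le> X + A * (\<eta> * h\<^sup>2)"
      using mult_left_mono[OF sE(1), of h] h sA'[OF N0] unfolding \<eta>' by linarith
    then show ?thesis by (simp add: algebra_simps)
  qed
  define z where "z i = u i - v i" for i
  define s where "s = (\<Sum>i\<in>J. v i * z i)"
  have Z: "(\<Sum>i\<in>J. (z i)\<^sup>2) \<le> N * (D' * h)\<^sup>2"
  proof -
    have "(\<Sum>i\<in>J. (z i)\<^sup>2) \<le> (\<Sum>i\<in>J. (D' * h)\<^sup>2)"
      using w D h by (intro sum_mono) (auto simp: z_def intro!: abs_le_square_iff[THEN iffD1])
    then show ?thesis by (simp add: N_def)
  qed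
  have "\<bar>s\<bar> \<le> (\<Sum>i\<in>J. \<bar>v i\<bar> * \<bar>z i\<bar>)"
    unfolding s_def by (rule order_trans[OF sum_abs]) (simp add: abs_mult)
  also have "\<dots> \<le> L2_set v J * L2_set z J" by (rule L2_set_mult_ineq)
  also have "\<dots> \<le> sqrt A * sqrt (N * (D' * h)\<^sup>2)"
    unfolding L2_set_def A_def using Z by (intro mult_left_mono real_sqrt_le_mono) (auto simp: sum_nonneg)
  also have "\<dots> = (sqrt N * (D' * h)) * sqrt A" using D h by (simp add: real_sqrt_mult)
  also have "\<dots> \<le> A * (sqrt N * (D' * h) / sqrt \<mu>)"
    using D h by (intro sA') (simp add: N_def)
  also have "\<dots> = A * (\<kappa> * h)" by (simp add: \<kappa> N_def)
  finally have s: "\<bar>s\<bar> \<le> A * (\<kappa> * h)" .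
  have Ks: "K = A + s"
    by (simp add: K_def A_def s_def z_def right_diff_distrib sum_subtractf power2_eq_square)
  then have K: "A * (1 - \<kappa> * h) \<le> K" using s by (simp add: algebra_simps abs_le_iff)
  moreover have "A * (1 - \<kappa> * h) > 0" using A \<kappa> by simp
  ultimately show K0: "K > 0" by simp
  have "arctan (X / K) \<le> X / K" using X0 K0 by (intro arctan_le_self) simp
  also have "\<dots> \<le> (A * (h * hi + \<eta> * h\<^sup>2)) / (A * (1 - \<kappa> * h))"
    using Xup K X0 A \<kappa>(2) by (intro frac_le) (auto intro: order_trans[OF X0])
  also have "\<dots> = (h * hi + \<eta> * h\<^sup>2) / (1 - \<kappa> * h)" using A by simp
  finally show "arctan (X / K) \<le> (h * hi + \<eta> * h\<^sup>2) / (1 - \<kappa> * h)" .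
  define B where "B = (\<Sum>i\<in>J. (u i)\<^sup>2)"
  have "B = (\<Sum>i\<in>J. (v i)\<^sup>2 + 2 * (v i * z i) + (z i)\<^sup>2)"
    unfolding B_def z_def by (intro sum.cong) (auto simp: power2_eq_square algebra_simps)
  also have "\<dots> = A + 2 * s + (\<Sum>i\<in>J. (z i)\<^sup>2)"
    by (simp add: sum.distrib A_def s_def sum_distrib_left)
  also have "\<dots> \<le> A + 2 * (A * (\<kappa> * h)) + A * (\<kappa> * h)\<^sup>2"
  proof -
    have "N * (D' * h)\<^sup>2 = \<mu> * (\<kappa> * h)\<^sup>2"
      using \<mu> by (simp add: \<kappa> N_def power_mult_distrib power_divide)
    also have "\<dots> \<le> A * (\<kappa> * h)\<^sup>2" using \<mu> by (intro mult_right_mono) auto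
    finally show ?thesis using s Z by linarith
  qed
  also have "\<dots> = A * (1 + \<kappa> * h)\<^sup>2" by (simp add: power2_eq_square algebra_simps)
  finally have B: "B \<le> A * (1 + \<kappa> * h)\<^sup>2" .
  show "(h * lo - \<eta> * h\<^sup>2) * (1 - \<kappa> * h) / (1 + \<kappa> * h)\<^sup>2 \<le> arctan (X / K)"
  proof (cases "h * lo - \<eta> * h\<^sup>2 \<ge> 0")
    case False
    then have "(h * lo - \<eta> * h\<^sup>2) * (1 - \<kappa> * h) / (1 + \<kappa> * h)\<^sup>2 \<le> 0"
      using \<kappa>(2) by (intro divide_nonpos_nonneg mult_nonpos_nonneg) auto
    also have "0 \<le> arctan (X / K)" using X0 K0 by simp
    finally show ?thesis .
  next
    case True
    have "A * B - K\<^sup>2 = (T u / sqrt A)\<^sup>2 \<or> A * B - K\<^sup>2 \<ge> 0"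
      using X0 by (auto simp: X_def B_def)
    then have XX: "K\<^sup>2 + X\<^sup>2 = A * B"
      using X0 unfolding X_def B_def[symmetric] by (auto simp: real_sqrt_ge_0_iff)
    have "(h * lo - \<eta> * h\<^sup>2) * (1 - \<kappa> * h) / (1 + \<kappa> * h)\<^sup>2
        = (A * (h * lo - \<eta> * h\<^sup>2)) * (A * (1 - \<kappa> * h)) / (A * (A * (1 + \<kappa> * h)\<^sup>2))"
    proof -
      have "(A * p) * (A * q) / (A * (A * c)) = p * q / c" for p q c
        using A by (simp add: mult.left_commute)
      then show ?thesis by simp
    qed
    also have "\<dots> \<le> X * K / (K\<^sup>2 + X\<^sup>2)"
    proof (rule frac_le)
      show "0 < K\<^sup>2 + X\<^sup>2" using K0 by (simp add: add_pos_nonneg)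
      show "K\<^sup>2 + X\<^sup>2 \<le> A * (A * (1 + \<kappa> * h)\<^sup>2)" unfolding XX using B A by simp
      show "A * (h * lo - \<eta> * h\<^sup>2) * (A * (1 - \<kappa> * h)) \<le> X * K"
        using Xlow K X0 A \<kappa>(2) by (intro mult_mono) auto
    qed (use X0 K0 in simp)
    also have "\<dots> \<le> arctan (X / K)" by (rule arctan_ge_ratio[OF X0 K0])
    finally show ?thesis .
  qed
qed

text \<open>By the mean value theorem \<open>f'\<close> takes the values \<open>- f x / (z - x)\<close> and \<open>f y / (y - z)\<close> at two points
  \<open>p < q\<close>. As these do not have the same strict sign, \<open>\<bar>f' p\<bar> \<le> \<bar>f' q - f' p\<bar> \<le> B * (y - x)\<close>.\<close>
lemma zero_without_sign_change:
  fixes f f' f'' :: "real \<Rightarrow> real"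
  assumes "z \<in> {x..<y}" "f z = 0" "\<not> f x * f y < 0"
    and d1: "\<And>\<xi>. \<xi> \<in> {x..y} \<Longrightarrow> (f has_real_derivative f' \<xi>) (at \<xi>)"
    and d2: "\<And>\<xi>. \<xi> \<in> {x..y} \<Longrightarrow> (f' has_real_derivative f'' \<xi>) (at \<xi>)"
    and B: "\<And>\<xi>. \<xi> \<in> {x..y} \<Longrightarrow> \<bar>f'' \<xi>\<bar> \<le> B"
  shows "\<bar>f x\<bar> \<le> B * (y - x)\<^sup>2"
proof (cases "z = x")
  case True
  have "0 \<le> B" using B[of x] assms(1) by (auto intro: order_trans[OF abs_ge_zero])
  then show ?thesis using True assms by simp
next
  case False
  then have z: "x < z" "z < y" using assms(1) by auto
  obtain p where p: "x < p" "p < z" "f z - f x = (z - x) * f' p"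
    using MVT2[OF z(1), of f f'] d1 z by auto
  obtain q where q: "z < q" "q < y" "f y - f z = (y - z) * f' q"
    using MVT2[OF z(2), of f f'] d1 z by auto
  obtain m where m: "p < m" "m < q" "f' q - f' p = (q - p) * f'' m"
    using MVT2[of p q f' f''] d2 z p q by auto
  have "0 \<le> f x * f y" using assms(3) by simp
  also have "\<dots> = - ((z - x) * (y - z)) * (f' p * f' q)"
  proof -
    have "f x = - ((z - x) * f' p)" "f y = (y - z) * f' q" using p(3) q(3) assms(2) by linarith+
    then show ?thesis by simp
  qed
  finally have "f' p * f' q \<le> 0"
    using z by (simp add: mult_le_0_iff zero_le_mult_iff)
  then have "\<bar>f' p\<bar> \<le> \<bar>f' q - f' p\<bar>"
    by (auto simp: mult_le_0_iff)
  also have "\<dots> = (q - p) * \<bar>f'' m\<bar>" using m(3) p q by (simp add: abs_mult)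
  also have "\<dots> \<le> (y - x) * B"
    using B[of m] m p q by (intro mult_mono) auto
  finally have *: "\<bar>f' p\<bar> \<le> (y - x) * B" .
  have "\<bar>f x\<bar> = (z - x) * \<bar>f' p\<bar>" using p(3) assms(2) z by (metis abs_minus_cancel abs_mult abs_of_pos
        diff_0 diff_gt_0_iff_gt)
  also have "\<dots> \<le> (y - x) * ((y - x) * B)" using z * by (intro mult_mono) auto
  finally show ?thesis by (simp add: power2_eq_square mult_ac)
qed

section \<open>The expected number of zeros of a Gaussian process\<close>

context iid_gaussian
begin

lemma DERIV_lin:
  assumes "\<And>i. i \<in> J \<Longrightarrow> (G i has_real_derivative G' i x) (at x)"
  shows "((\<lambda>x. lin (\<lambda>i. G i x) \<omega>) has_real_derivative lin (\<lambda>i. G' i x) \<omega>) (at x)"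
  unfolding lin_def using assms by (auto intro!: DERIV_sum derivative_eq_intros)

lemma abs_lin_le:
  assumes "\<And>i. i \<in> J \<Longrightarrow> \<bar>p i\<bar> \<le> D"
  shows "\<bar>lin p \<omega>\<bar> \<le> D * (\<Sum>i\<in>J. \<bar>b i \<omega>\<bar>)"
proof -
  have "\<bar>lin p \<omega>\<bar> \<le> (\<Sum>i\<in>J. \<bar>p i\<bar> * \<bar>b i \<omega>\<bar>)"
    unfolding lin_def by (rule order_trans[OF sum_abs]) (simp add: abs_mult)
  also have "\<dots> \<le> (\<Sum>i\<in>J. D * \<bar>b i \<omega>\<bar>)" using assms by (intro sum_mono mult_right_mono) auto
  finally show ?thesis by (simp add: sum_distrib_left)
qed

text \<open>A sign change entails a zero. Conversely, a zero without a sign change makes the value at \<open>x\<close> at most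
  \<open>D * h\<^sup>2\<close> times the sum of the \<open>\<bar>b i\<bar>\<close>; so either that sum exceeds \<open>1 / sqrt h\<close>, or the value at
  \<open>x\<close> is at most \<open>D * (h * sqrt h)\<close>. The two last summands of the upper bound account for these events.\<close>
lemma prob_zero_in_cell:
  fixes G G' G'' :: "nat \<Rightarrow> real \<Rightarrow> real"
  assumes xy: "x < y" "y - x \<le> 1"
    and d1: "\<And>i \<xi>. i \<in> J \<Longrightarrow> \<xi> \<in> {x..y} \<Longrightarrow> (G i has_real_derivative G' i \<xi>) (at \<xi>)"
    and d2: "\<And>i \<xi>. i \<in> J \<Longrightarrow> \<xi> \<in> {x..y} \<Longrightarrow> (G' i has_real_derivative G'' i \<xi>) (at \<xi>)"
    and D: "\<And>i \<xi>. i \<in> J \<Longrightarrow> \<xi> \<in> {x..y} \<Longrightarrow> \<bar>G'' i \<xi>\<bar> \<le> D"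
           "\<And>i \<xi>. i \<in> J \<Longrightarrow> \<xi> \<in> {x..y} \<Longrightarrow> \<bar>G' i \<xi>\<bar> \<le> D'" "D \<ge> 0" "D' \<ge> 0"
    and \<mu>: "\<mu> > 0" "\<mu> \<le> (\<Sum>i\<in>J. (G i x)\<^sup>2)"
    and lohi: "lo \<ge> 0" "hi \<ge> 0"
      "lo\<^sup>2 * (\<Sum>i\<in>J. (G i x)\<^sup>2)\<^sup>2 \<le> (\<Sum>i\<in>J. (G i x)\<^sup>2) * (\<Sum>i\<in>J. (G' i x)\<^sup>2) - (\<Sum>i\<in>J. G i x * G' i x)\<^sup>2"
      "(\<Sum>i\<in>J. (G i x)\<^sup>2) * (\<Sum>i\<in>J. (G' i x)\<^sup>2) - (\<Sum>i\<in>J. G i x * G' i x)\<^sup>2 \<le> hi\<^sup>2 * (\<Sum>i\<in>J. (G i x)\<^sup>2)\<^sup>2"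
    and h: "h = y - x"
    and \<kappa>: "\<kappa> = sqrt (real (card J)) * D' / sqrt \<mu>" "\<kappa> * h < 1"
    and \<eta>: "\<eta> = sqrt (real (card J)) * D / sqrt \<mu>"
  defines "Z \<equiv> {\<omega>\<in>space M. \<exists>z\<in>{x..<y}. lin (\<lambda>i. G i z) \<omega> = 0}"
  shows "ennreal ((h * lo - \<eta> * h\<^sup>2) * (1 - \<kappa> * h) / (1 + \<kappa> * h)\<^sup>2 / pi) \<le> emeasure M Z"
    "emeasure M Z \<le> ennreal ((h * hi + \<eta> * h\<^sup>2) / (1 - \<kappa> * h) / pi
        + (3 * real (card J) ^ 5 * h\<^sup>2 + D * (h * sqrt h) / sqrt \<mu>))"
proof -
  have h0: "h > 0" using xy h by simp
  define V where "V z \<omega> = lin (\<lambda>i. G i z) \<omega>" for z \<omega>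
  define V' where "V' z \<omega> = lin (\<lambda>i. G' i z) \<omega>" for z \<omega>
  define V'' where "V'' z \<omega> = lin (\<lambda>i. G'' i z) \<omega>" for z \<omega>
  have dV: "((\<lambda>z. V z \<omega>) has_real_derivative V' \<xi> \<omega>) (at \<xi>)" if "\<xi> \<in> {x..y}" for \<xi> \<omega>
    unfolding V_def V'_def using that by (intro DERIV_lin d1)
  have dV': "((\<lambda>z. V' z \<omega>) has_real_derivative V'' \<xi> \<omega>) (at \<xi>)" if "\<xi> \<in> {x..y}" for \<xi> \<omega>
    unfolding V''_def V'_def using that by (intro DERIV_lin d2)
  have cV: "continuous_on {x..y} (\<lambda>z. V z \<omega>)" for \<omega>
    using dV by (meson DERIV_isCont continuous_at_imp_continuous_on)
  have mV [measurable]: "V z \<in> borel_measurable M" for z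
    unfolding V_def by (rule measurable_lin)
  have Z_sets: "Z \<in> sets M"
    unfolding Z_def V_def[symmetric] by (intro measurable_exists_zero cV mV)
  define Opp where "Opp = {\<omega>\<in>space M. V x \<omega> * V y \<omega> < 0}"
  have Opp_sets [measurable]: "Opp \<in> sets M" unfolding Opp_def by measurable
  have Taylor: "\<bar>G i y - G i x - h * G' i x\<bar> \<le> D * h\<^sup>2 \<and> \<bar>G i y - G i x\<bar> \<le> D' * h" if i: "i \<in> J" for i
  proof -
    obtain p where p: "x < p" "p < y" "G i y - G i x = (y - x) * G' i p"
      using MVT2[OF xy(1), of "G i" "G' i"] d1[OF i] by auto
    obtain q where q: "x < q" "q < p" "G' i p - G' i x = (p - x) * G'' i q"
      using MVT2[OF p(1), of "G' i" "G'' i"] d2[OF i] p by auto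
    have "G i y - G i x - h * G' i x = h * ((p - x) * G'' i q)"
      using p(3) q(3) h by (simp add: right_diff_distrib[symmetric])
    then have "\<bar>G i y - G i x - h * G' i x\<bar> = h * ((p - x) * \<bar>G'' i q\<bar>)"
      using h0 p by (simp add: abs_mult)
    also have "\<dots> \<le> h * (h * D)"
      using D(1)[OF i, of q] p q h h0 by (intro mult_left_mono mult_mono) auto
    finally have 1: "\<bar>G i y - G i x - h * G' i x\<bar> \<le> D * h\<^sup>2" by (simp add: power2_eq_square mult_ac)
    have "\<bar>G i y - G i x\<bar> = h * \<bar>G' i p\<bar>" using p(3) h h0 by (simp add: abs_mult)
    also have "\<dots> \<le> h * D'" using D(2)[OF i, of p] p h0 by (intro mult_left_mono) auto
    finally show ?thesis using 1 by (simp add: mult.commute)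
  qed
  define A where "A = (\<Sum>i\<in>J. (G i x)\<^sup>2)"
  define K where "K = (\<Sum>i\<in>J. G i x * G i y)"
  define X where "X = sqrt (A * (\<Sum>i\<in>J. (G i y)\<^sup>2) - K\<^sup>2)"
  have ang: "K > 0" "arctan (X / K) \<le> (h * hi + \<eta> * h\<^sup>2) / (1 - \<kappa> * h)"
    "(h * lo - \<eta> * h\<^sup>2) * (1 - \<kappa> * h) / (1 + \<kappa> * h)\<^sup>2 \<le> arctan (X / K)"
    unfolding X_def K_def A_def
    by (rule angle_of_secant[where d = "\<lambda>i. G' i x" and D = D and D' = D' and \<mu> = \<mu>];
        use finite_J h0 D \<mu> Taylor lohi \<kappa> \<eta> in blast)+
  have PO: "emeasure M Opp = ennreal (arctan (X / K) / pi)"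
    using prob_opposite_signs[of "\<lambda>i. G i x" "\<lambda>i. G i y"] ang(1)
    unfolding Opp_def V_def X_def K_def A_def by simp
  have "Opp \<subseteq> Z"
  proof
    fix \<omega> assume "\<omega> \<in> Opp"
    then have w: "\<omega> \<in> space M" "V x \<omega> * V y \<omega> < 0" by (auto simp: Opp_def)
    have "\<exists>z. x \<le> z \<and> z \<le> y \<and> V z \<omega> = 0"
    proof (cases "V x \<omega> < 0")
      case True
      then show ?thesis using w cV xy by (intro IVT') (auto simp: mult_less_0_iff)
    next
      case False
      then show ?thesis using w cV xy by (intro IVT2') (auto simp: mult_less_0_iff)
    qed
    then obtain z where "x \<le> z" "z \<le> y" "V z \<omega> = 0" by blast
    moreover have "z \<noteq> y" using calculation w(2) by auto
    ultimately show "\<omega> \<in> Z" using w(1) unfolding Z_def V_def by force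
  qed
  then have "emeasure M Opp \<le> emeasure M Z" using Z_sets by (rule emeasure_mono)
  moreover have "ennreal ((h * lo - \<eta> * h\<^sup>2) * (1 - \<kappa> * h) / (1 + \<kappa> * h)\<^sup>2 / pi) \<le> emeasure M Opp"
    unfolding PO by (intro ennreal_leI divide_right_mono ang(3)) simp
  ultimately show "ennreal ((h * lo - \<eta> * h\<^sup>2) * (1 - \<kappa> * h) / (1 + \<kappa> * h)\<^sup>2 / pi) \<le> emeasure M Z"
    by (rule order_trans[rotated])
  define E1 where "E1 = {\<omega>\<in>space M. 1 / sqrt h < (\<Sum>i\<in>J. \<bar>b i \<omega>\<bar>)}"
  define E2 where "E2 = {\<omega>\<in>space M. \<bar>V x \<omega>\<bar> \<le> D * (h * sqrt h)}"
  have [measurable]: "E1 \<in> sets M" "E2 \<in> sets M" unfolding E1_def E2_def by measurable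
  have "Z \<subseteq> Opp \<union> (E1 \<union> E2)"
  proof
    fix \<omega> assume Z: "\<omega> \<in> Z"
    show "\<omega> \<in> Opp \<union> (E1 \<union> E2)"
    proof (rule ccontr)
      assume n: "\<omega> \<notin> Opp \<union> (E1 \<union> E2)"
      have w: "\<omega> \<in> space M" using Z by (simp add: Z_def)
      define S where "S = (\<Sum>i\<in>J. \<bar>b i \<omega>\<bar>)"
      have S: "S \<le> 1 / sqrt h" "S \<ge> 0" using n w by (auto simp: E1_def S_def sum_nonneg)
      obtain z where "z \<in> {x..<y}" "V z \<omega> = 0" using Z by (auto simp: Z_def V_def)
      moreover have "\<not> V x \<omega> * V y \<omega> < 0" using n w by (simp add: Opp_def)
      moreover have "\<bar>V'' \<xi> \<omega>\<bar> \<le> D * S" if "\<xi> \<in> {x..y}" for \<xi>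
        unfolding V''_def S_def using D(1) that by (intro abs_lin_le)
      ultimately have "\<bar>V x \<omega>\<bar> \<le> D * S * (y - x)\<^sup>2"
        using dV dV' by (intro zero_without_sign_change)
      also have "\<dots> \<le> D * (1 / sqrt h) * h\<^sup>2"
        unfolding h using S D xy h by (intro mult_right_mono mult_left_mono) auto
      also have "\<dots> = D * (h * sqrt h)"
      proof -
        have "h\<^sup>2 / sqrt h = h * (h / sqrt h)" by (simp add: power2_eq_square)
        also have "h / sqrt h = sqrt h" using h0 by (simp add: real_div_sqrt)
        finally have "D * (h\<^sup>2 / sqrt h) = D * (h * sqrt h)" by simp
        then show ?thesis by simp
      qed
      finally show False using n w by (simp add: E2_def)
    qed
  qed
  then have "emeasure M Z \<le> emeasure M (Opp \<union> (E1 \<union> E2))" by (rule emeasure_mono) measurable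
  also have "\<dots> \<le> emeasure M Opp + (emeasure M E1 + emeasure M E2)"
    by (intro order_trans[OF emeasure_subadditive] add_left_mono emeasure_subadditive) auto
  also have "\<dots> \<le> ennreal ((h * hi + \<eta> * h\<^sup>2) / (1 - \<kappa> * h) / pi)
      + (ennreal (3 * real (card J) ^ 5 * h\<^sup>2) + ennreal (D * (h * sqrt h) / sqrt \<mu>))"
  proof (intro add_mono)
    show "emeasure M Opp \<le> ennreal ((h * hi + \<eta> * h\<^sup>2) / (1 - \<kappa> * h) / pi)"
      unfolding PO by (intro ennreal_leI divide_right_mono ang(2)) simp
    have "emeasure M E1 \<le> ennreal (3 * real (card J) ^ 5 / (1 / sqrt h) ^ 4)"
      unfolding E1_def using h0 by (intro prob_sum_abs_large) simp
    moreover have "sqrt h ^ 4 = h\<^sup>2" using h0 by (simp add: power4_eq_xxxx power2_eq_square)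
    ultimately show "emeasure M E1 \<le> ennreal (3 * real (card J) ^ 5 * h\<^sup>2)"
      by (simp add: power_divide)
    show "emeasure M E2 \<le> ennreal (D * (h * sqrt h) / sqrt \<mu>)"
      unfolding E2_def V_def using \<mu> D h0 by (intro prob_small_lin) auto
  qed
  also have "\<dots> = ennreal ((h * hi + \<eta> * h\<^sup>2) / (1 - \<kappa> * h) / pi
        + (3 * real (card J) ^ 5 * h\<^sup>2 + D * (h * sqrt h) / sqrt \<mu>))"
  proof -
    have "(h * hi + \<eta> * h\<^sup>2) / (1 - \<kappa> * h) / pi \<ge> 0"
      using h0 lohi D \<mu> \<kappa>(2) by (auto simp: \<eta>)
    moreover have "D * (h * sqrt h) / sqrt \<mu> \<ge> 0" using h0 D \<mu> by simp
    ultimately show ?thesis by (simp add: ennreal_plus)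
  qed
  finally show "emeasure M Z \<le> ennreal ((h * hi + \<eta> * h\<^sup>2) / (1 - \<kappa> * h) / pi
        + (3 * real (card J) ^ 5 * h\<^sup>2 + D * (h * sqrt h) / sqrt \<mu>))" .
qed

text \<open>The quotient \<open>sqrt (E x) / A x\<close> is the speed at \<open>x\<close> of the curve \<open>(G i x)\<close> projected to the unit
  sphere, and the expected number of zeros is \<open>1 / pi\<close> times the length of that projection. The proof
  sums the estimate for one cell over \<open>k\<close> equal cells and lets \<open>k\<close> tend to infinity; the upper bound
  passes to the limit by Fatou's lemma.\<close>
lemma expected_zeros_bounds:
  fixes G G' G'' :: "nat \<Rightarrow> real \<Rightarrow> real"
  defines "A \<equiv> \<lambda>x. \<Sum>i\<in>J. (G i x)\<^sup>2"
  defines "E \<equiv> \<lambda>x. A x * (\<Sum>i\<in>J. (G' i x)\<^sup>2) - (\<Sum>i\<in>J. G i x * G' i x)\<^sup>2"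
  assumes st: "s < t"
    and d1: "\<And>i x. i \<in> J \<Longrightarrow> x \<in> {s..t} \<Longrightarrow> (G i has_real_derivative G' i x) (at x)"
    and d2: "\<And>i x. i \<in> J \<Longrightarrow> x \<in> {s..t} \<Longrightarrow> (G' i has_real_derivative G'' i x) (at x)"
    and c2: "\<And>i. i \<in> J \<Longrightarrow> continuous_on {s..t} (G'' i)"
    and \<mu>: "\<mu> > 0" "\<And>x. x \<in> {s..t} \<Longrightarrow> \<mu> \<le> A x"
    and lohi: "lo \<ge> 0" "hi \<ge> 0" "\<And>x. x \<in> {s..t} \<Longrightarrow> lo\<^sup>2 * (A x)\<^sup>2 \<le> E x"
      "\<And>x. x \<in> {s..t} \<Longrightarrow> E x \<le> hi\<^sup>2 * (A x)\<^sup>2"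
  shows "ennreal (lo * (t - s) / pi) \<le> (\<integral>\<^sup>+\<omega>. zero_count (\<lambda>x. lin (\<lambda>i. G i x) \<omega>) {s..<t} \<partial>M)"
    "(\<integral>\<^sup>+\<omega>. zero_count (\<lambda>x. lin (\<lambda>i. G i x) \<omega>) {s..<t} \<partial>M) \<le> ennreal (hi * (t - s) / pi)"
proof -
  \<comment> \<open>Continuity on the compact interval gives one bound for the whole finite family.\<close>
  have bdd: "\<exists>D\<ge>0. \<forall>i\<in>J. \<forall>x\<in>{s..t}. \<bar>g i x\<bar> \<le> D"
    if "\<And>i. i \<in> J \<Longrightarrow> continuous_on {s..t} (g i)" for g :: "nat \<Rightarrow> real \<Rightarrow> real"
  proof -
    have "\<forall>i\<in>J. \<exists>D. \<forall>x\<in>{s..t}. \<bar>g i x\<bar> \<le> D"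
    proof
      fix i assume "i \<in> J"
      then have "bounded (g i ` {s..t})"
        by (intro compact_imp_bounded compact_continuous_image that) auto
      then show "\<exists>D. \<forall>x\<in>{s..t}. \<bar>g i x\<bar> \<le> D" by (auto simp: bounded_iff)
    qed
    then obtain d where d: "\<And>i x. i \<in> J \<Longrightarrow> x \<in> {s..t} \<Longrightarrow> \<bar>g i x\<bar> \<le> d i" by metis
    have "\<bar>g i x\<bar> \<le> (\<Sum>i\<in>J. \<bar>d i\<bar>)" if "i \<in> J" "x \<in> {s..t}" for i x
    proof -
      have "\<bar>g i x\<bar> \<le> \<bar>d i\<bar>" using d[OF that] by simp
      also have "\<dots> \<le> (\<Sum>i\<in>J. \<bar>d i\<bar>)" using that finite_J by (intro member_le_sum) auto
      finally show ?thesis .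
    qed
    then show ?thesis by (intro exI[of _ "\<Sum>i\<in>J. \<bar>d i\<bar>"]) (auto simp: sum_nonneg)
  qed
  obtain D where D: "D \<ge> 0" "\<And>i x. i \<in> J \<Longrightarrow> x \<in> {s..t} \<Longrightarrow> \<bar>G'' i x\<bar> \<le> D"
    using bdd[of G'', OF c2] by auto
  have "continuous_on {s..t} (G' i)" if "i \<in> J" for i
    using d2[OF that] by (meson DERIV_isCont continuous_at_imp_continuous_on)
  from bdd[of G', OF this] obtain D' where D': "D' \<ge> 0" "\<And>i x. i \<in> J \<Longrightarrow> x \<in> {s..t} \<Longrightarrow> \<bar>G' i x\<bar> \<le> D'"
    by auto
  define \<kappa> where "\<kappa> = sqrt (real (card J)) * D' / sqrt \<mu>"
  define \<eta> where "\<eta> = sqrt (real (card J)) * D / sqrt \<mu>"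
  have nn: "\<kappa> \<ge> 0" "\<eta> \<ge> 0" using D D' \<mu> by (auto simp: \<kappa>_def \<eta>_def)
  define L where "L = t - s"
  have L: "L > 0" using st by (simp add: L_def)
  define V where "V x \<omega> = lin (\<lambda>i. G i x) \<omega>" for x \<omega>
  have mV [measurable]: "V x \<in> borel_measurable M" for x
    unfolding V_def by (rule measurable_lin)
  have cV: "continuous_on {s..t} (\<lambda>x. V x \<omega>)" for \<omega>
  proof -
    have "((\<lambda>x. V x \<omega>) has_real_derivative lin (\<lambda>i. G' i x) \<omega>) (at x)" if "x \<in> {s..t}" for x
      unfolding V_def using d1 that by (intro DERIV_lin)
    then show ?thesis by (meson DERIV_isCont continuous_at_imp_continuous_on)
  qed
  define low where "low h = (h * lo - \<eta> * h\<^sup>2) * (1 - \<kappa> * h) / (1 + \<kappa> * h)\<^sup>2 / pi" for h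
  define up where "up h = (h * hi + \<eta> * h\<^sup>2) / (1 - \<kappa> * h) / pi
        + (3 * real (card J) ^ 5 * h\<^sup>2 + D * (h * sqrt h) / sqrt \<mu>)" for h
  define I where "I k = (\<integral>\<^sup>+\<omega>. of_nat (cells_with_zero (\<lambda>x. V x \<omega>) s t k) \<partial>M)" for k
  have mI: "(\<lambda>\<omega>. of_nat (cells_with_zero (\<lambda>x. V x \<omega>) s t k) :: ennreal) \<in> borel_measurable M" for k
    by (intro measurable_cells_with_zero[OF st] cV mV)
  have cells: "ennreal (real k * low (L / k)) \<le> I k \<and> I k \<le> ennreal (real k * up (L / k))"
    if k: "k > 0" "\<kappa> * (L / k) < 1" "L / k \<le> 1" for k :: nat
  proof -
    have cell1: "ennreal (low (L / k)) \<le> emeasure M {\<omega>\<in>space M. \<exists>x\<in>cell s t k i. V x \<omega> = 0} \<and>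
        emeasure M {\<omega>\<in>space M. \<exists>x\<in>cell s t k i. V x \<omega> = 0} \<le> ennreal (up (L / k))" if i: "i < k" for i
    proof -
      define x where "x = s + (t - s) * (real i / real k)"
      define y where "y = s + (t - s) * (real (Suc i) / real k)"
      have yx: "y - x = L / k"
        by (simp add: x_def y_def L_def add_divide_distrib distrib_left)
      moreover have "L / k > 0" using L k by simp
      ultimately have xy: "x < y" "y - x \<le> 1" using k(3) by linarith+
      have "(t - s) * (real (Suc i) / real k) \<le> t - s"
        using st i by (intro mult_left_le) auto
      then have y: "y \<le> t" unfolding y_def by linarith
      have x: "s \<le> x" using st by (simp add: x_def)
      have sub: "{x..y} \<subseteq> {s..t}" using x y by auto
      have xst: "x \<in> {s..t}" using x y xy by auto
      have cx: "cell s t k i = {x..<y}" by (simp add: cell_def x_def y_def)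
      have *: "ennreal ((L / k * lo - \<eta> * (L / k)\<^sup>2) * (1 - \<kappa> * (L / k)) / (1 + \<kappa> * (L / k))\<^sup>2 / pi)
            \<le> emeasure M {\<omega>\<in>space M. \<exists>z\<in>{x..<y}. lin (\<lambda>i. G i z) \<omega> = 0}"
          "emeasure M {\<omega>\<in>space M. \<exists>z\<in>{x..<y}. lin (\<lambda>i. G i z) \<omega> = 0} \<le>
            ennreal ((L / k * hi + \<eta> * (L / k)\<^sup>2) / (1 - \<kappa> * (L / k)) / pi
             + (3 * real (card J) ^ 5 * (L / k)\<^sup>2 + D * ((L / k) * sqrt (L / k)) / sqrt \<mu>))"
        by (rule prob_zero_in_cell[where G = G and G' = G' and G'' = G'' and D = D and D' = D' and \<mu> = \<mu>];
            (rule xy D D' \<mu> d1 d2 \<kappa>_def \<eta>_def k yx[symmetric] lohi(1,2) lohi(3,4)[OF xst, unfolded E_def A_def] 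
              \<mu>(2)[OF xst, unfolded A_def] subsetD[OF sub] | assumption)+)+
      then show ?thesis unfolding cx V_def low_def up_def by blast
    qed
    have Isum: "I k = (\<Sum>i<k. emeasure M {\<omega>\<in>space M. \<exists>x\<in>cell s t k i. V x \<omega> = 0})"
    proof -
      have m: "{\<omega>\<in>space M. \<exists>x\<in>cell s t k i. V x \<omega> = 0} \<in> sets M" if "i \<in> {..<k}" for i
        using that measurable_cell_zero[OF st _ cV mV] by simp
      have "I k = (\<integral>\<^sup>+\<omega>. (\<Sum>i<k. indicator {\<omega>\<in>space M. \<exists>x\<in>cell s t k i. V x \<omega> = 0} \<omega>) \<partial>M)"
        unfolding I_def cells_with_zero_eq_sum
        by (intro nn_integral_cong sum.cong refl) (auto simp: indicator_def)
      also have "\<dots> = (\<Sum>i<k. (\<integral>\<^sup>+\<omega>. indicator {\<omega>\<in>space M. \<exists>x\<in>cell s t k i. V x \<omega> = 0} \<omega> \<partial>M))"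
        using m by (intro nn_integral_sum) simp
      finally show ?thesis using m by simp
    qed
    have "(\<Sum>i<k. ennreal (low (L / k))) \<le> I k" "I k \<le> (\<Sum>i<k. ennreal (up (L / k)))"
      unfolding Isum using cell1 by (intro sum_mono; simp)+
    then show ?thesis
      by (simp add: ennreal_mult' flip: ennreal_of_nat_eq_real_of_nat)
  qed
  have "(\<lambda>k. 1 - \<kappa> * (L / real k)) \<longlonglongrightarrow> 1 - \<kappa> * 0"
    by (intro tendsto_intros lim_const_over_n)
  then have "eventually (\<lambda>k. 1 - \<kappa> * (L / real k) > 0) sequentially"
    by (intro order_tendstoD) auto
  moreover have "eventually (\<lambda>k. L / real k < 1) sequentially"
    using lim_const_over_n[of L] by (intro order_tendstoD) auto
  ultimately have ev: "eventually (\<lambda>k. ennreal (real k * low (L / k)) \<le> I k \<and> I k \<le> ennreal (real k * up (L / k))) sequentially"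
    using eventually_gt_at_top[of 0]
    by eventually_elim (intro cells; simp)
  have lim_h: "(\<lambda>k. L / real k) \<longlonglongrightarrow> 0" by (rule lim_const_over_n)
  have "(\<lambda>k. (L * lo - \<eta> * (L * (L / real k))) * (1 - \<kappa> * (L / real k)) / (1 + \<kappa> * (L / real k))\<^sup>2 / pi)
      \<longlonglongrightarrow> (L * lo - \<eta> * (L * 0)) * (1 - \<kappa> * 0) / (1 + \<kappa> * 0)\<^sup>2 / pi"
    by (intro tendsto_intros lim_h) auto
  then have "(\<lambda>k. (L * lo - \<eta> * (L * (L / real k))) * (1 - \<kappa> * (L / real k)) / (1 + \<kappa> * (L / real k))\<^sup>2 / pi) \<longlonglongrightarrow> L * lo / pi"
    by (simp only: mult_zero_right diff_0_right add_0_right power_one div_by_1 mult_1_right)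
  then have lim_low: "(\<lambda>k. real k * low (L / real k)) \<longlonglongrightarrow> L * lo / pi"
  proof (rule Lim_transform_eventually)
    show "eventually (\<lambda>k. (L * lo - \<eta> * (L * (L / real k))) * (1 - \<kappa> * (L / real k)) / (1 + \<kappa> * (L / real k))\<^sup>2 / pi
        = real k * low (L / real k)) sequentially"
      using eventually_gt_at_top[of 0]
    proof eventually_elim
      case (elim k)
      have "L * lo - \<eta> * (L * (L / real k)) = real k * ((L / real k) * lo - \<eta> * (L / real k)\<^sup>2)"
        using elim by (simp add: power2_eq_square field_simps)
      then show ?case by (simp add: low_def)
    qed
  qed
  have "(\<lambda>k. (L * hi + \<eta> * (L * (L / real k))) / (1 - \<kappa> * (L / real k)) / pi
          + (3 * real (card J) ^ 5 * (L * (L / real k)) + D * (L * sqrt (L / real k)) / sqrt \<mu>))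
      \<longlonglongrightarrow> (L * hi + \<eta> * (L * 0)) / (1 - \<kappa> * 0) / pi
          + (3 * real (card J) ^ 5 * (L * 0) + D * (L * sqrt 0) / sqrt \<mu>)"
    using \<mu> by (intro tendsto_intros lim_h) auto
  then have "(\<lambda>k. (L * hi + \<eta> * (L * (L / real k))) / (1 - \<kappa> * (L / real k)) / pi
          + (3 * real (card J) ^ 5 * (L * (L / real k)) + D * (L * sqrt (L / real k)) / sqrt \<mu>))
      \<longlonglongrightarrow> L * hi / pi"
    by (simp only: mult_zero_right diff_0_right add_0_right div_by_1 real_sqrt_zero div_0)
  then have lim_up: "(\<lambda>k. real k * up (L / real k)) \<longlonglongrightarrow> L * hi / pi"
  proof (rule Lim_transform_eventually)
    show "eventually (\<lambda>k. (L * hi + \<eta> * (L * (L / real k))) / (1 - \<kappa> * (L / real k)) / pi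
          + (3 * real (card J) ^ 5 * (L * (L / real k)) + D * (L * sqrt (L / real k)) / sqrt \<mu>)
        = real k * up (L / real k)) sequentially"
      using eventually_gt_at_top[of 0]
    proof eventually_elim
      case (elim k)
      have "L * hi + \<eta> * (L * (L / real k)) = real k * ((L / real k) * hi + \<eta> * (L / real k)\<^sup>2)"
        "L * (L / real k) = real k * (L / real k)\<^sup>2" "L = real k * (L / real k)"
        using elim by (simp_all add: power2_eq_square field_simps)
      then show ?case using elim by (simp add: up_def distrib_left)
    qed
  qed
  have zc: "zero_count (\<lambda>x. lin (\<lambda>i. G i x) \<omega>) {s..<t} = liminf (\<lambda>k. of_nat (cells_with_zero (\<lambda>x. V x \<omega>) s t k))" for \<omega>
    using zero_count_eq_liminf[OF st] unfolding V_def by simp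
  show "(\<integral>\<^sup>+\<omega>. zero_count (\<lambda>x. lin (\<lambda>i. G i x) \<omega>) {s..<t} \<partial>M) \<le> ennreal (hi * (t - s) / pi)"
  proof -
    have "(\<integral>\<^sup>+\<omega>. zero_count (\<lambda>x. lin (\<lambda>i. G i x) \<omega>) {s..<t} \<partial>M) \<le> liminf I"
      unfolding zc I_def by (intro nn_integral_liminf mI)
    also have "\<dots> \<le> liminf (\<lambda>k. ennreal (real k * up (L / k)))"
      using ev by (intro Liminf_mono) (auto elim: eventually_mono)
    also have "\<dots> = ennreal (L * hi / pi)"
      using lim_up by (intro lim_imp_Liminf tendsto_ennrealI) auto
    finally show ?thesis by (simp add: L_def mult.commute)
  qed
  show "ennreal (lo * (t - s) / pi) \<le> (\<integral>\<^sup>+\<omega>. zero_count (\<lambda>x. lin (\<lambda>i. G i x) \<omega>) {s..<t} \<partial>M)"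
  proof -
    have "(\<lambda>k. ennreal (real k * low (L / real k))) \<longlonglongrightarrow> ennreal (L * lo / pi)"
      using lim_low by (rule tendsto_ennrealI)
    moreover have "eventually (\<lambda>k. ennreal (real k * low (L / real k))
        \<le> (\<integral>\<^sup>+\<omega>. zero_count (\<lambda>x. lin (\<lambda>i. G i x) \<omega>) {s..<t} \<partial>M)) sequentially"
      using ev eventually_gt_at_top[of 0]
    proof eventually_elim
      case (elim k)
      have "I k \<le> (\<integral>\<^sup>+\<omega>. zero_count (\<lambda>x. lin (\<lambda>i. G i x) \<omega>) {s..<t} \<partial>M)"
        unfolding I_def V_def using elim by (intro nn_integral_mono cells_with_zero_le[OF st]) simp
      then show ?case using elim by auto
    qed
    ultimately have "ennreal (L * lo / pi) \<le> (\<integral>\<^sup>+\<omega>. zero_count (\<lambda>x. lin (\<lambda>i. G i x) \<omega>) {s..<t} \<partial>M)"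
      by (rule tendsto_upperbound) simp
    then show ?thesis by (simp add: L_def mult.commute)
  qed
qed

end

section \<open>Zeros in a short interval\<close>

context iid_gaussian
begin

text \<open>If there are at least \<open>k \<ge> K\<close> zeros, then the value at \<open>\<xi>\<close> is at most \<open>exp (- k)\<close> times the sum of
  the absolute coefficients. So either this sum exceeds \<open>exp (k / 2)\<close> or the value is at most
  \<open>exp (- k / 2)\<close>; since the variance at \<open>\<xi>\<close> is at least \<open>1\<close>, both events have probabilities that
  decay geometrically in \<open>k\<close>, and the number of zeros is at most \<open>K\<close> plus the number of these events.\<close>
lemma expected_zeros_short_interval:
  fixes c :: "nat \<Rightarrow> 'a \<Rightarrow> real" and g :: "nat \<Rightarrow> real"
  assumes \<xi>: "\<xi> \<in> {s..t}"
    and V: "\<And>\<omega>. \<omega> \<in> space M \<Longrightarrow> cos_poly n (\<lambda>j. c j \<omega>) \<xi> = lin g \<omega>"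
    and S: "\<And>\<omega>. \<omega> \<in> space M \<Longrightarrow> (\<Sum>j\<le>n. \<bar>c j \<omega>\<bar>) \<le> 2 * (\<Sum>i\<in>J. \<bar>b i \<omega>\<bar>)"
    and g: "1 \<le> (\<Sum>i\<in>J. (g i)\<^sup>2)"
    and K: "exp 2 * (real n * (t - s)) \<le> real K"
  shows "(\<integral>\<^sup>+\<omega>. zero_count (cos_poly n (\<lambda>j. c j \<omega>)) {s..t} \<partial>M)
    \<le> ennreal (real K + 3 * (48 * real (card J) ^ 5 * exp (- real K) + 1))"
proof -
  define E1 where "E1 k = {\<omega>\<in>space M. exp (real k / 2) / 2 < (\<Sum>i\<in>J. \<bar>b i \<omega>\<bar>)}" for k :: nat
  define E2 where "E2 k = {\<omega>\<in>space M. \<bar>lin g \<omega>\<bar> \<le> exp (- (real k / 2))}" for k :: nat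
  define q where "q = 48 * real (card J) ^ 5 * exp (- real K) + 1"
  have q: "q \<ge> 0" by (simp add: q_def)
  have [measurable]: "E1 k \<in> sets M" "E2 k \<in> sets M" for k
    unfolding E1_def E2_def by measurable
  have bad: "\<omega> \<in> E1 k \<union> E2 k"
    if w: "\<omega> \<in> space M" and F: "finite F" "F \<subseteq> {x \<in> {s..t}. cos_poly n (\<lambda>j. c j \<omega>) x = 0}" "card F = k" "K \<le> k"
    for \<omega> F k
  proof (rule ccontr)
    assume n: "\<omega> \<notin> E1 k \<union> E2 k"
    have "real K \<le> real (card F)" using F(3,4) by simp
    with K have kF: "exp 2 * (real n * (t - s)) \<le> real (card F)" by linarith
    have "\<bar>lin g \<omega>\<bar> \<le> exp (- real k) * (\<Sum>j\<le>n. \<bar>c j \<omega>\<bar>)"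
      unfolding V[OF w, symmetric] F(3)[symmetric]
      using F(1,2) by (intro cos_poly_small_of_many_zeros[OF _ _ _ kF \<xi>]) auto
    also have "\<dots> \<le> exp (- real k) * exp (real k / 2)"
    proof (rule mult_left_mono)
      have "(\<Sum>i\<in>J. \<bar>b i \<omega>\<bar>) \<le> exp (real k / 2) / 2" using n w by (simp add: E1_def not_less)
      then show "(\<Sum>j\<le>n. \<bar>c j \<omega>\<bar>) \<le> exp (real k / 2)" using S[OF w] by linarith
    qed simp
    also have "\<dots> = exp (- (real k / 2))" by (simp add: exp_add[symmetric])
    finally show False using n w by (simp add: E2_def)
  qed
  have count: "zero_count (cos_poly n (\<lambda>j. c j \<omega>)) {s..t}
      \<le> of_nat K + (\<Sum>i. indicator (E1 (K + i) \<union> E2 (K + i)) \<omega>)" if w: "\<omega> \<in> space M" for \<omega>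
    unfolding zero_count_def
  proof (rule emeasure_count_space_le)
    fix F assume F: "finite F" "F \<subseteq> {x \<in> {s..t}. cos_poly n (\<lambda>j. c j \<omega>) x = 0}"
    have "indicator (E1 (K + i) \<union> E2 (K + i)) \<omega> = (1 :: ennreal)" if i: "i < card F - K" for i
    proof -
      obtain F' where "F' \<subseteq> F" "card F' = K + i"
        using i by (metis obtain_subset_with_card_n add.commute less_diff_conv less_imp_le)
      then show ?thesis using bad[OF w, of F' "K + i"] F finite_subset[of F' F] by auto
    qed
    then have "(\<Sum>i<card F - K. indicator (E1 (K + i) \<union> E2 (K + i)) \<omega>) = (of_nat (card F - K) :: ennreal)"
      by simp
    moreover have "(\<Sum>i<card F - K. indicator (E1 (K + i) \<union> E2 (K + i)) \<omega>)
        \<le> (\<Sum>i. indicator (E1 (K + i) \<union> E2 (K + i)) \<omega> :: ennreal)"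
      by (rule sum_le_suminf) auto
    ultimately have "(of_nat K + of_nat (card F - K) :: ennreal) \<le> of_nat K + (\<Sum>i. indicator (E1 (K + i) \<union> E2 (K + i)) \<omega>)"
      by (simp add: add_left_mono)
    moreover have "(of_nat (card F) :: ennreal) \<le> of_nat K + of_nat (card F - K)"
      unfolding of_nat_add[symmetric] by (rule of_nat_mono) simp
    ultimately show "of_nat (card F) \<le> of_nat K + (\<Sum>i. indicator (E1 (K + i) \<union> E2 (K + i)) \<omega> :: ennreal)"
      by (rule order_trans[rotated])
  qed
  have PE: "emeasure M (E1 (K + i) \<union> E2 (K + i)) \<le> ennreal (q * (2 / 3) ^ i)" for i
  proof -
    define k where "k = K + i"
    have exp_half: "exp (- (real k / 2)) \<le> (2 / 3) ^ i"
    proof -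
      have "1 + 1 / 2 \<le> exp (1 / 2 :: real)" by (rule exp_ge_add_one_self)
      then have "exp (- (1 / 2)) \<le> (2 / 3 :: real)"
        using le_imp_inverse_le[of "3 / 2" "exp (1 / 2 :: real)"] by (simp add: exp_minus)
      then have "exp (- (1 / 2)) ^ i \<le> (2 / 3 :: real) ^ i" by (intro power_mono) auto
      moreover have "exp (- (real k / 2)) \<le> exp (real i * (- (1 / 2)))" by (simp add: k_def)
      ultimately show ?thesis by (simp only: exp_of_nat_mult)
    qed
    have "emeasure M (E1 k) \<le> ennreal (3 * real (card J) ^ 5 / (exp (real k / 2) / 2) ^ 4)"
      unfolding E1_def by (intro prob_sum_abs_large) simp
    also have "\<dots> \<le> ennreal (48 * real (card J) ^ 5 * exp (- real K) * (2 / 3) ^ i)"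
    proof (rule ennreal_leI)
      have "exp (real k / 2) ^ 4 = exp (2 * real k)"
        by (simp add: exp_of_nat_mult[symmetric])
      then have "3 * real (card J) ^ 5 / (exp (real k / 2) / 2) ^ 4 = 48 * real (card J) ^ 5 * exp (- (2 * real k))"
        by (simp add: power_divide exp_minus field_simps)
      also have "real K \<le> real k" by (simp add: k_def)
      then have "exp (- (2 * real k)) \<le> exp (- real K + - (real k / 2))"
        unfolding exp_le_cancel_iff by linarith
      then have "exp (- (2 * real k)) \<le> exp (- real K) * exp (- (real k / 2))"
        by (simp only: exp_add)
      then have "48 * real (card J) ^ 5 * exp (- (2 * real k)) \<le> 48 * real (card J) ^ 5 * (exp (- real K) * exp (- (real k / 2)))"
        by (intro mult_left_mono) auto
      also have "\<dots> \<le> 48 * real (card J) ^ 5 * (exp (- real K) * (2 / 3) ^ i)"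
        using exp_half by (intro mult_left_mono) auto
      finally show "3 * real (card J) ^ 5 / (exp (real k / 2) / 2) ^ 4 \<le> 48 * real (card J) ^ 5 * exp (- real K) * (2 / 3) ^ i"
        by (simp add: mult.assoc)
    qed
    finally have 1: "emeasure M (E1 k) \<le> ennreal (48 * real (card J) ^ 5 * exp (- real K) * (2 / 3) ^ i)" .
    have "emeasure M (E2 k) \<le> ennreal (exp (- (real k / 2)) / 1)"
      unfolding E2_def using g by (intro prob_small_lin) auto
    also have "\<dots> \<le> ennreal ((2 / 3) ^ i)" using exp_half by (intro ennreal_leI) simp
    finally have "emeasure M (E1 k \<union> E2 k) \<le> ennreal (48 * real (card J) ^ 5 * exp (- real K) * (2 / 3) ^ i) + ennreal ((2 / 3) ^ i)"
      using 1 by (intro order_trans[OF emeasure_subadditive add_mono]) auto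
    also have "\<dots> = ennreal (q * (2 / 3) ^ i)"
      by (subst ennreal_plus[symmetric]) (auto simp: q_def algebra_simps)
    finally show ?thesis unfolding k_def .
  qed
  have "(\<integral>\<^sup>+\<omega>. zero_count (cos_poly n (\<lambda>j. c j \<omega>)) {s..t} \<partial>M)
     \<le> (\<integral>\<^sup>+\<omega>. of_nat K + (\<Sum>i. indicator (E1 (K + i) \<union> E2 (K + i)) \<omega>) \<partial>M)"
    by (intro nn_integral_mono count)
  also have "\<dots> = of_nat K + (\<Sum>i. emeasure M (E1 (K + i) \<union> E2 (K + i)))"
    by (subst nn_integral_add, simp, simp, subst nn_integral_suminf) (simp_all add: emeasure_space_1)
  also have "\<dots> \<le> of_nat K + (\<Sum>i. ennreal (q * (2 / 3) ^ i))"
    by (intro add_left_mono suminf_le PE) auto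
  also have "(\<Sum>i. ennreal (q * (2 / 3) ^ i)) = ennreal (q * 3)"
  proof (rule suminf_ennreal_eq)
    have "(\<lambda>i. (2 / 3 :: real) ^ i) sums (1 / (1 - 2 / 3))" by (rule geometric_sums) simp
    from sums_mult[OF this, of q] show "(\<lambda>i. q * (2 / 3) ^ i) sums (q * 3)" by simp
  qed (use q in auto)
  also have "of_nat K + ennreal (q * 3) = ennreal (real K + 3 * q)"
    using q by (simp add: ennreal_plus mult.commute flip: ennreal_of_nat_eq_real_of_nat)
  finally show ?thesis unfolding q_def .
qed

end

section \<open>Trigonometric sums\<close>

text \<open>Abel summation: \<open>1 - z\<close> times the sum, plus \<open>c m * z ^ m\<close>, equals \<open>c 0\<close> plus the increments of \<open>c\<close>
  times powers of \<open>z\<close>, and the increments are nonnegative.\<close>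
lemma norm_abel_sum_le:
  fixes z :: complex and c :: "nat \<Rightarrow> real"
  assumes "norm z = 1" "incseq c" "c 0 \<ge> 0"
  shows "norm (1 - z) * norm (\<Sum>j<m. of_real (c j) * z ^ j) \<le> 2 * c m"
proof -
  have c: "0 \<le> c j" "c j \<le> c (Suc j)" for j
    using assms(2,3) incseqD[of c 0 j] incseq_SucD[of c j] by auto
  have main: "norm ((1 - z) * (\<Sum>j<m. of_real (c j) * z ^ j) + of_real (c m) * z ^ m) \<le> c m"
  proof (induction m)
    case 0
    then show ?case using c by simp
  next
    case (Suc m)
    have "(1 - z) * (\<Sum>j<Suc m. of_real (c j) * z ^ j) + of_real (c (Suc m)) * z ^ Suc m
        = ((1 - z) * (\<Sum>j<m. of_real (c j) * z ^ j) + of_real (c m) * z ^ m)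
          + of_real (c (Suc m) - c m) * z ^ Suc m"
      by (simp add: algebra_simps)
    also have "norm \<dots> \<le> c m + norm (of_real (c (Suc m) - c m) * z ^ Suc m)"
      by (intro norm_triangle_mono Suc.IH order_refl)
    also have "norm (of_real (c (Suc m) - c m) * z ^ Suc m) = c (Suc m) - c m"
      using c[of m] assms(1) unfolding norm_mult norm_power norm_of_real by simp
    finally show ?case by simp
  qed
  have "norm ((1 - z) * (\<Sum>j<m. of_real (c j) * z ^ j))
      \<le> norm ((1 - z) * (\<Sum>j<m. of_real (c j) * z ^ j) + of_real (c m) * z ^ m) + norm (of_real (c m) * z ^ m)"
    using norm_triangle_ineq4[of "(1 - z) * (\<Sum>j<m. of_real (c j) * z ^ j) + of_real (c m) * z ^ m" "of_real (c m) * z ^ m"]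
    by simp
  also have "norm (of_real (c m) * z ^ m) = c m"
    using assms(1) c by (simp add: norm_mult norm_power)
  finally show ?thesis using main by (simp add: norm_mult)
qed

lemma norm_one_minus_cis: "norm (1 - cis (2 * t)) = 2 * \<bar>sin t\<bar>"
proof -
  have "(norm (1 - cis (2 * t)))\<^sup>2 = (1 - cos (2 * t))\<^sup>2 + (sin (2 * t))\<^sup>2"
    by (simp add: cmod_power2)
  also have "\<dots> = 2 - 2 * cos (2 * t)"
    using sin_cos_squared_add[of "2 * t"] by (simp add: power2_diff)
  also have "\<dots> = (2 * \<bar>sin t\<bar>)\<^sup>2" by (simp only: cos_double_sin power_mult_distrib power2_abs) simp
  finally have "(norm (1 - cis (2 * t)))\<^sup>2 = (2 * \<bar>sin t\<bar>)\<^sup>2" .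
  then show ?thesis by (rule power2_eq_imp_eq) auto
qed

text \<open>The frequencies form an arithmetic progression, so these are the real and imaginary part of
  a unimodular number times a sum as above with \<open>z = cis (4 * l * x)\<close>, for which
  \<open>norm (1 - z) = 2 * \<bar>sin (2 * l * x)\<bar>\<close>.\<close>
lemma weighted_trig_sum_le:
  fixes \<beta> :: "nat \<Rightarrow> real"
  assumes \<beta>: "\<And>j. \<beta> j = 2 * l * real j + \<gamma>" "l \<ge> 0" "\<gamma> \<ge> 0"
    and \<delta>: "\<delta> > 0" "\<delta> \<le> \<bar>sin (2 * l * x)\<bar>"
  shows "\<bar>\<Sum>j<m. \<beta> j ^ p * cos (2 * \<beta> j * x)\<bar> \<le> \<beta> m ^ p / \<delta>"
    "\<bar>\<Sum>j<m. \<beta> j ^ p * sin (2 * \<beta> j * x)\<bar> \<le> \<beta> m ^ p / \<delta>"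
proof -
  define z where "z = cis (2 * (2 * l * x))"
  define S where "S = (\<Sum>j<m. of_real (\<beta> j ^ p) * cis (2 * \<beta> j * x))"
  have \<beta>0: "\<beta> j \<ge> 0" "\<beta> j \<le> \<beta> (Suc j)" for j using assms by (auto simp: algebra_simps)
  have S: "S = cis (2 * \<gamma> * x) * (\<Sum>j<m. of_real (\<beta> j ^ p) * z ^ j)"
    unfolding S_def sum_distrib_left
  proof (intro sum.cong refl)
    fix j
    have "cis (2 * \<beta> j * x) = cis (2 * \<gamma> * x) * z ^ j"
    proof -
      have "2 * \<beta> j * x = 2 * \<gamma> * x + real j * (2 * (2 * l * x))" by (simp add: \<beta>(1) algebra_simps)
      then show ?thesis by (simp only: z_def Complex.DeMoivre cis_mult)
    qed
    then show "of_real (\<beta> j ^ p) * cis (2 * \<beta> j * x) = cis (2 * \<gamma> * x) * (of_real (\<beta> j ^ p) * z ^ j)"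
      by simp
  qed
  have "norm (1 - z) * norm (\<Sum>j<m. of_real (\<beta> j ^ p) * z ^ j) \<le> 2 * \<beta> m ^ p"
    using \<beta>0 by (intro norm_abel_sum_le incseq_SucI power_mono) (auto simp: z_def)
  moreover have "norm (1 - z) = 2 * \<bar>sin (2 * l * x)\<bar>"
    unfolding z_def by (rule norm_one_minus_cis)
  ultimately have "\<bar>sin (2 * l * x)\<bar> * norm S \<le> \<beta> m ^ p"
    unfolding S norm_mult by simp
  then have "\<delta> * norm S \<le> \<beta> m ^ p"
    using mult_right_mono[OF \<delta>(2), of "norm S"] by simp
  then have n: "norm S \<le> \<beta> m ^ p / \<delta>" using \<delta> by (simp add: field_simps)
  have "Re S = (\<Sum>j<m. \<beta> j ^ p * cos (2 * \<beta> j * x))" "Im S = (\<Sum>j<m. \<beta> j ^ p * sin (2 * \<beta> j * x))"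
    unfolding S_def by (simp_all del: of_real_power)
  then show "\<bar>\<Sum>j<m. \<beta> j ^ p * cos (2 * \<beta> j * x)\<bar> \<le> \<beta> m ^ p / \<delta>"
    "\<bar>\<Sum>j<m. \<beta> j ^ p * sin (2 * \<beta> j * x)\<bar> \<le> \<beta> m ^ p / \<delta>"
    using n abs_Re_le_cmod[of S] abs_Im_le_cmod[of S] by auto
qed

text \<open>Each square is compared with the increment of \<open>y ^ 3 / (6 * l)\<close> between \<open>y = 2 * l * j\<close> and
  \<open>y = 2 * l * (j + 1)\<close>.\<close>
lemma sum_squares_progression:
  fixes l \<gamma> :: real
  assumes "l > 0" "l / 2 \<le> \<gamma>" "\<gamma> \<le> 3 * l / 2"
  shows "\<bar>(\<Sum>j<m. (2 * l * real j + \<gamma>)\<^sup>2) - (2 * l * real m) ^ 3 / (6 * l)\<bar> \<le> 7 * l\<^sup>2 * (real m)\<^sup>2"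
proof (induction m)
  case (Suc m)
  have cube: "(2 * l * real (Suc m)) ^ 3 / (6 * l) = (2 * l * real m) ^ 3 / (6 * l)
      + (4 * l\<^sup>2 * (real m)\<^sup>2 + 4 * l\<^sup>2 * real m + 4 * l\<^sup>2 / 3)"
    using assms(1) by (simp add: field_simps power3_eq_cube power2_eq_square)
  have dev: "\<bar>(2 * l * real m + \<gamma>)\<^sup>2 - (4 * l\<^sup>2 * (real m)\<^sup>2 + 4 * l\<^sup>2 * real m + 4 * l\<^sup>2 / 3)\<bar>
      \<le> 2 * l\<^sup>2 * real m + 4 * l\<^sup>2"
  proof -
    have "(2 * l * real m + \<gamma>)\<^sup>2 - (4 * l\<^sup>2 * (real m)\<^sup>2 + 4 * l\<^sup>2 * real m + 4 * l\<^sup>2 / 3)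
        = 4 * l * real m * (\<gamma> - l) + (\<gamma>\<^sup>2 - 4 * l\<^sup>2 / 3)"
      by (simp add: power2_eq_square algebra_simps)
    moreover have "\<bar>4 * l * real m * (\<gamma> - l)\<bar> \<le> 4 * l * real m * (l / 2)"
      unfolding abs_mult using assms by (intro mult_mono) (auto simp: abs_if)
    moreover have "\<gamma>\<^sup>2 \<le> (3 * l / 2)\<^sup>2" using assms by (intro power_mono) auto
    then have "\<gamma>\<^sup>2 \<le> 9 / 4 * l\<^sup>2" by (simp add: power_mult_distrib power_divide)
    then have "\<bar>\<gamma>\<^sup>2 - 4 * l\<^sup>2 / 3\<bar> \<le> 4 * l\<^sup>2"
      using zero_le_power2[of \<gamma>] zero_le_power2[of l] unfolding abs_le_iff by linarith
    ultimately show ?thesis by (simp add: power2_eq_square)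
  qed
  have "7 * l\<^sup>2 * (real (Suc m))\<^sup>2 = 7 * l\<^sup>2 * (real m)\<^sup>2 + (14 * l\<^sup>2 * real m + 7 * l\<^sup>2)"
    by (simp add: power2_eq_square algebra_simps)
  moreover have "0 \<le> l\<^sup>2 * real m" "0 \<le> l\<^sup>2" by simp_all
  moreover have "\<bar>(S + d) - (C + e)\<bar> \<le> p + q" if "\<bar>S - C\<bar> \<le> p" "\<bar>d - e\<bar> \<le> q" for S d C e p q :: real
    using that by linarith
  note this[OF Suc dev]
  ultimately show ?case unfolding cube sum.lessThan_Suc by linarith
qed simp

text \<open>By this inequality, a lower bound on \<open>\<bar>sin (2 * l * x)\<bar>\<close> also keeps \<open>cos (l * x / 2)\<close> away from
  zero.\<close>
lemma abs_sin_4_le: "\<bar>sin (4 * y)\<bar> \<le> 4 * \<bar>cos (y :: real)\<bar>"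
proof -
  have "sin (4 * y) = 4 * (sin y * cos (2 * y)) * cos y"
    using sin_double[of "2 * y"] by (simp add: sin_double)
  moreover have "\<bar>sin y * cos (2 * y)\<bar> \<le> 1 * 1"
    unfolding abs_mult by (intro mult_mono) auto
  ultimately show ?thesis
    by (simp add: abs_mult mult_left_le_one_le mult_right_mono)
qed

section \<open>The variances of a cosine polynomial with paired blocks\<close>

definition first_blocks :: "nat \<Rightarrow> nat \<Rightarrow> nat set" where
  "first_blocks l m = {2 * l * j + k | j k. j < m \<and> k < l}"

lemma sum_first_blocks:
  assumes "l > 0"
  shows "(\<Sum>i\<in>first_blocks l m. f i) = (\<Sum>k<l. \<Sum>j<m. f (2 * l * j + k))"
proof -
  have "bij_betw (\<lambda>(k, j). 2 * l * j + k) ({..<l} \<times> {..<m}) (first_blocks l m)"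
  proof (rule bij_betwI')
    fix x y assume x: "x \<in> {..<l} \<times> {..<m}" and y: "y \<in> {..<l} \<times> {..<m}"
    obtain k j k' j' where xy: "x = (k, j)" "y = (k', j')" by (cases x, cases y)
    have "(2 * l * j + k) div (2 * l) = j" "(2 * l * j + k) mod (2 * l) = k"
      "(2 * l * j' + k') div (2 * l) = j'" "(2 * l * j' + k') mod (2 * l) = k'"
      using x y xy by auto
    then show "((case x of (k, j) \<Rightarrow> 2 * l * j + k) = (case y of (k, j) \<Rightarrow> 2 * l * j + k)) = (x = y)"
      unfolding xy by (metis case_prod_conv prod.inject)
  qed (auto simp: first_blocks_def)
  from sum.reindex_bij_betw[OF this, of f]
  show ?thesis by (simp add: sum.cartesian_product split_def)
qed

lemma first_blocks_less:
  assumes "i \<in> first_blocks l m"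
  shows "i + l < 2 * l * m"
proof -
  obtain j k where i: "i = 2 * l * j + k" "j < m" "k < l" using assms by (auto simp: first_blocks_def)
  have "i + l < 2 * l * Suc j" using i by simp
  also have "\<dots> \<le> 2 * l * m" using i by (intro mult_left_mono) auto
  finally show ?thesis .
qed

lemma finite_first_blocks: "finite (first_blocks l m)"
  by (rule finite_subset[of _ "{..<2 * l * m}"]) (auto dest: first_blocks_less)

lemma free_indices_eq: "free_indices l m n = first_blocks l m \<union> {2 * l * m..n}"
  by (simp add: free_indices_def first_blocks_def)

lemma sum_free_indices:
  "(\<Sum>i\<in>free_indices l m n. f i) = (\<Sum>i\<in>first_blocks l m. f i) + (\<Sum>i\<in>{2 * l * m..n}. f i)"
  unfolding free_indices_eq
  by (rule sum.union_disjoint) (auto simp: finite_first_blocks dest: first_blocks_less)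

lemma sum_all_indices:
  fixes f :: "nat \<Rightarrow> 'b :: comm_monoid_add"
  assumes l: "l > 0" and n: "2 * l * m \<le> n + 1"
  shows "(\<Sum>j\<le>n. f j) = (\<Sum>i\<in>first_blocks l m. f i + f (i + l)) + (\<Sum>i\<in>{2 * l * m..n}. f i)"
proof -
  have "{..n} = {..<m * (2 * l)} \<union> {2 * l * m..n}" using n by (auto simp: mult_ac)
  then have "(\<Sum>j\<le>n. f j) = (\<Sum>j<m * (2 * l). f j) + (\<Sum>i\<in>{2 * l * m..n}. f i)"
    by (simp only:) (rule sum.union_disjoint, auto simp: mult_ac)
  also have "(\<Sum>j<m * (2 * l). f j) = (\<Sum>j<m. \<Sum>i\<in>{j * (2 * l)..<j * (2 * l) + 2 * l}. f i)"
    by (rule sum.nat_group[symmetric])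
  also have "\<dots> = (\<Sum>j<m. \<Sum>k<l. f (2 * l * j + k) + f (2 * l * j + k + l))"
  proof (rule sum.cong)
    fix j
    have "(\<Sum>i\<in>{j * (2 * l)..<j * (2 * l) + 2 * l}. f i) = (\<Sum>k<l + l. f (2 * l * j + k))"
      by (rule sum.reindex_bij_witness[of _ "\<lambda>k. 2 * l * j + k" "\<lambda>i. i - 2 * l * j"]) (auto simp: mult_ac)
    also have "\<dots> = (\<Sum>k<l. f (2 * l * j + k)) + (\<Sum>k\<in>{l..<l + l}. f (2 * l * j + k))"
      by (metis atLeast0LessThan le0 le_add1 sum.atLeastLessThan_concat)
    also have "(\<Sum>k\<in>{l..<l + l}. f (2 * l * j + k)) = (\<Sum>k<l. f (2 * l * j + k + l))"
      by (rule sum.reindex_bij_witness[of _ "\<lambda>k. k + l" "\<lambda>k. k - l"]) (auto simp: add_ac)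
    finally show "(\<Sum>i\<in>{j * (2 * l)..<j * (2 * l) + 2 * l}. f i)
        = (\<Sum>k<l. f (2 * l * j + k) + f (2 * l * j + k + l))"
      by (simp add: sum.distrib)
  qed simp
  also have "\<dots> = (\<Sum>i\<in>first_blocks l m. f i + f (i + l))"
    unfolding sum_first_blocks[OF l] by (rule sum.swap)
  finally show ?thesis .
qed

text \<open>The function by which the free coefficient \<open>i\<close> enters the polynomial.\<close>
definition paired_cos :: "nat \<Rightarrow> nat \<Rightarrow> nat \<Rightarrow> real \<Rightarrow> real" where
  "paired_cos l m i x = (if i < 2 * l * m then cos (real i * x) + cos (real (i + l) * x) else cos (real i * x))"

lemma cos_poly_paired:
  assumes "l > 0" "2 * l * m \<le> n + 1"
    and pair: "\<And>i. i \<in> first_blocks l m \<Longrightarrow> c (i + l) = c i"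
  shows "cos_poly n c x = (\<Sum>i\<in>free_indices l m n. paired_cos l m i x * c i)"
    and "(\<Sum>j\<le>n. \<bar>c j\<bar>) \<le> 2 * (\<Sum>i\<in>free_indices l m n. \<bar>c i\<bar>)"
proof -
  have "(\<Sum>i\<in>first_blocks l m. c i * cos (real i * x) + c (i + l) * cos (real (i + l) * x))
      = (\<Sum>i\<in>first_blocks l m. paired_cos l m i x * c i)"
    using pair first_blocks_less[of _ l m]
    by (intro sum.cong) (force simp: paired_cos_def algebra_simps)+
  moreover have "(\<Sum>i\<in>{2 * l * m..n}. c i * cos (real i * x)) = (\<Sum>i\<in>{2 * l * m..n}. paired_cos l m i x * c i)"
    by (intro sum.cong) (auto simp: paired_cos_def)
  ultimately show "cos_poly n c x = (\<Sum>i\<in>free_indices l m n. paired_cos l m i x * c i)"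
    unfolding cos_poly_def sum_all_indices[OF assms(1,2)] sum_free_indices by simp
  have "(\<Sum>i\<in>first_blocks l m. \<bar>c i\<bar> + \<bar>c (i + l)\<bar>) = (\<Sum>i\<in>first_blocks l m. 2 * \<bar>c i\<bar>)"
    using pair by (intro sum.cong) auto
  moreover have "(\<Sum>i\<in>{2 * l * m..n}. \<bar>c i\<bar>) \<ge> 0" by (simp add: sum_nonneg)
  ultimately show "(\<Sum>j\<le>n. \<bar>c j\<bar>) \<le> 2 * (\<Sum>i\<in>free_indices l m n. \<bar>c i\<bar>)"
    unfolding sum_all_indices[OF assms(1,2)] sum_free_indices by (simp add: sum_distrib_left[symmetric])
qed

text \<open>Dividing by \<open>2 * cos (l * x / 2)\<close> changes neither the zeros nor the angles between the
  coefficient vectors, and it turns the coefficients of the paired blocks into pure cosines.\<close>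
definition half_sec :: "nat \<Rightarrow> real \<Rightarrow> real" where
  "half_sec l x = 1 / (2 * cos (real l * x / 2))"

definition half_sec' :: "nat \<Rightarrow> real \<Rightarrow> real" where
  "half_sec' l x = real l * sin (real l * x / 2) * (half_sec l x)\<^sup>2"

definition half_sec'' :: "nat \<Rightarrow> real \<Rightarrow> real" where
  "half_sec'' l x = (real l)\<^sup>2 / 2 * cos (real l * x / 2) * (half_sec l x)\<^sup>2
     + real l * sin (real l * x / 2) * (2 * half_sec l x * half_sec' l x)"

definition scaled_cos :: "nat \<Rightarrow> nat \<Rightarrow> nat \<Rightarrow> real \<Rightarrow> real" where
  "scaled_cos l m i x = (if i < 2 * l * m then cos ((real i + real l / 2) * x)
     else cos (real i * x) * half_sec l x)"

definition scaled_cos' :: "nat \<Rightarrow> nat \<Rightarrow> nat \<Rightarrow> real \<Rightarrow> real" where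
  "scaled_cos' l m i x = (if i < 2 * l * m then - ((real i + real l / 2) * sin ((real i + real l / 2) * x))
     else - real i * sin (real i * x) * half_sec l x + cos (real i * x) * half_sec' l x)"

definition scaled_cos'' :: "nat \<Rightarrow> nat \<Rightarrow> nat \<Rightarrow> real \<Rightarrow> real" where
  "scaled_cos'' l m i x = (if i < 2 * l * m then - (real i + real l / 2)\<^sup>2 * cos ((real i + real l / 2) * x)
     else - (real i)\<^sup>2 * cos (real i * x) * half_sec l x - 2 * real i * sin (real i * x) * half_sec' l x
       + cos (real i * x) * half_sec'' l x)"

lemma paired_cos_eq:
  assumes "cos (real l * x / 2) \<noteq> 0"
  shows "paired_cos l m i x = 2 * cos (real l * x / 2) * scaled_cos l m i x"
proof (cases "i < 2 * l * m")
  case True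
  define y where "y = (real i + real l / 2) * x"
  have "real i * x = y - real l * x / 2" "real (i + l) * x = y + real l * x / 2"
    by (simp_all add: y_def algebra_simps)
  then show ?thesis
    using True unfolding paired_cos_def scaled_cos_def y_def[symmetric] by (simp add: cos_add cos_diff)
next
  case False
  then show ?thesis using assms by (simp add: paired_cos_def scaled_cos_def half_sec_def)
qed

context
  fixes l :: nat and x :: real
  assumes nz: "cos (real l * x / 2) \<noteq> 0"
begin

lemma DERIV_half_sec: "(half_sec l has_real_derivative half_sec' l x) (at x)"
  unfolding half_sec_def[abs_def] half_sec'_def using nz
  by (auto intro!: derivative_eq_intros simp: half_sec_def power2_eq_square)

lemma DERIV_half_sec': "(half_sec' l has_real_derivative half_sec'' l x) (at x)"
  unfolding half_sec'_def[abs_def] half_sec''_def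
  by (auto intro!: derivative_eq_intros DERIV_half_sec simp: half_sec'_def power2_eq_square)

lemma DERIV_scaled_cos: "(scaled_cos l m i has_real_derivative scaled_cos' l m i x) (at x)"
proof (cases "i < 2 * l * m")
  case True
  then show ?thesis unfolding scaled_cos_def[abs_def] scaled_cos'_def
    by (auto intro!: derivative_eq_intros simp: algebra_simps)
next
  case False
  then show ?thesis unfolding scaled_cos_def[abs_def] scaled_cos'_def
    by (auto intro!: derivative_eq_intros DERIV_half_sec)
qed

lemma DERIV_scaled_cos': "(scaled_cos' l m i has_real_derivative scaled_cos'' l m i x) (at x)"
proof (cases "i < 2 * l * m")
  case True
  then show ?thesis unfolding scaled_cos'_def[abs_def] scaled_cos''_def
    by (auto intro!: derivative_eq_intros simp: power2_eq_square algebra_simps)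
next
  case False
  then show ?thesis unfolding scaled_cos'_def[abs_def] scaled_cos''_def
    by (auto intro!: derivative_eq_intros DERIV_half_sec DERIV_half_sec' simp: power2_eq_square)
qed

lemma isCont_scaled_cos'': "isCont (scaled_cos'' l m i) x"
proof -
  have [continuous_intros]: "isCont (half_sec l) x" "isCont (half_sec' l) x"
    using DERIV_isCont[OF DERIV_half_sec] DERIV_isCont[OF DERIV_half_sec'] .
  have [continuous_intros]: "isCont (half_sec'' l) x"
    unfolding half_sec''_def[abs_def] by (intro continuous_intros) auto
  show ?thesis
  proof (cases "i < 2 * l * m")
    case True
    then show ?thesis unfolding scaled_cos''_def[abs_def] by simp
  next
    case False
    then show ?thesis unfolding scaled_cos''_def[abs_def] by (simp, intro continuous_intros)
  qed
qed

end

lemma sum_first_blocks_shifted: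
  assumes "l > 0"
  shows "(\<Sum>i\<in>first_blocks l m. f (real i + real l / 2))
    = (\<Sum>k<l. \<Sum>j<m. f (2 * real l * real j + (real k + real l / 2)))"
  unfolding sum_first_blocks[OF assms] by (simp add: add.assoc)

lemma power2_le_of_abs_le: "\<bar>y\<bar> \<le> c \<Longrightarrow> y\<^sup>2 \<le> (c :: real)\<^sup>2"
  using power_mono[of "\<bar>y\<bar>" c 2] by simp

lemma abs_sum_le_card:
  assumes "finite S" "real (card S) \<le> c" "B \<ge> 0" "\<And>i. i \<in> S \<Longrightarrow> \<bar>f i\<bar> \<le> B"
  shows "\<bar>\<Sum>i\<in>S. f i :: real\<bar> \<le> c * B"
proof -
  have "\<bar>\<Sum>i\<in>S. f i\<bar> \<le> (\<Sum>i\<in>S. B)" using assms by (intro order_trans[OF sum_abs] sum_mono) auto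
  also have "\<dots> \<le> c * B" using assms by (simp add: mult_right_mono)
  finally show ?thesis .
qed

text \<open>At the points \<open>x\<close> considered here, unweighted trigonometric sums over one residue class of the
  paired blocks are at most \<open>q\<close> and the factor
  \<open>half_sec l x\<close> is at most \<open>2 * q\<close>. The constant in the last assumption only has to be so large that
  the resulting errors stay below a small fraction of the main terms.\<close>
context
  fixes l m n :: nat and \<delta> q x :: real
  assumes l: "l \<ge> 1" and n: "2 * l * m \<le> n + 1" "n + 2 \<le> 2 * l * m + 2 * l"
    and \<delta>: "0 < \<delta>" "\<delta> \<le> 1" "\<delta> \<le> \<bar>sin (2 * real l * x)\<bar>" and q: "q = 1 / \<delta>"
    and large: "13440 * real l * q\<^sup>2 \<le> real n"
begin

private lemma q1: "q \<ge> 1" "q \<le> q\<^sup>2" "1 \<le> q\<^sup>2"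
  using \<delta> by (auto simp: q self_le_power one_le_power)

private lemma l1: "real l \<ge> 1" using l by simp

private lemma n_large: "13440 * real l \<le> real n" "13440 \<le> real n"
proof -
  have "13440 * real l * 1 \<le> 13440 * real l * q\<^sup>2" using q1 by (intro mult_left_mono) auto
  then show "13440 * real l \<le> real n" using large by simp
  then show "13440 \<le> real n" using l1 by linarith
qed

private lemma P_bounds: "2 * real l * real m \<le> real n + 1" "real n + 2 \<le> 2 * real l * real m + 2 * real l"
  using n[THEN of_nat_mono[where 'a = real]] by simp_all

lemma abs_cos_half_ge: "\<delta> / 4 \<le> \<bar>cos (real l * x / 2)\<bar>"
proof -
  have "4 * (real l * x / 2) = 2 * real l * x" by simp
  then show ?thesis using abs_sin_4_le[of "real l * x / 2"] \<delta>(3) by (simp only:)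
qed

lemma cos_half_nonzero: "cos (real l * x / 2) \<noteq> 0"
  using abs_cos_half_ge \<delta>(1) by auto

private lemma half_sec_le: "\<bar>half_sec l x\<bar> \<le> 2 * q"
proof -
  have "1 / (2 * \<bar>cos (real l * x / 2)\<bar>) \<le> 1 / (2 * (\<delta> / 4))"
    using abs_cos_half_ge \<delta> by (intro divide_left_mono) auto
  then show ?thesis by (simp add: half_sec_def q abs_mult)
qed

private lemma half_sec'_le: "\<bar>half_sec' l x\<bar> \<le> 4 * real l * q\<^sup>2"
proof -
  have "(half_sec l x)\<^sup>2 \<le> (2 * q)\<^sup>2" by (rule power2_le_of_abs_le[OF half_sec_le])
  moreover have "\<bar>real l * sin (real l * x / 2)\<bar> \<le> real l * 1"
    unfolding abs_mult by (intro mult_mono) auto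
  ultimately have "\<bar>real l * sin (real l * x / 2)\<bar> * (half_sec l x)\<^sup>2 \<le> real l * 1 * (2 * q)\<^sup>2"
    by (intro mult_mono) auto
  then show ?thesis by (simp add: half_sec'_def abs_mult power_mult_distrib)
qed

private lemma rest_bounds:
  assumes "i \<in> {2 * l * m..n}"
  shows "\<bar>scaled_cos l m i x\<bar> \<le> 2 * q" "\<bar>scaled_cos' l m i x\<bar> \<le> 3 * real n * q"
proof -
  have i: "\<not> i < 2 * l * m" "i \<le> n" using assms by auto
  have "\<bar>cos (real i * x) * half_sec l x\<bar> \<le> 1 * (2 * q)"
    unfolding abs_mult using half_sec_le by (intro mult_mono) auto
  then show "\<bar>scaled_cos l m i x\<bar> \<le> 2 * q" using i by (simp add: scaled_cos_def)
  have "\<bar>- real i * sin (real i * x) * half_sec l x\<bar> \<le> real n * 1 * (2 * q)"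
    unfolding abs_mult using half_sec_le i by (intro mult_mono) auto
  moreover have "\<bar>cos (real i * x) * half_sec' l x\<bar> \<le> 1 * (4 * real l * q\<^sup>2)"
    unfolding abs_mult using half_sec'_le by (intro mult_mono) auto
  moreover have "4 * real l * q\<^sup>2 \<le> real n * q"
  proof -
    have "4 * real l * q\<^sup>2 \<le> 13440 * real l * q\<^sup>2" by (intro mult_right_mono) auto
    also have "\<dots> \<le> real n * 1" using large by simp
    also have "\<dots> \<le> real n * q" using q1 by (intro mult_left_mono) auto
    finally show ?thesis .
  qed
  ultimately show "\<bar>scaled_cos' l m i x\<bar> \<le> 3 * real n * q"
    using i unfolding scaled_cos'_def by (simp add: abs_le_iff)
qed

private lemma card_rest: "real (card {2 * l * m..n}) \<le> 2 * real l"
proof -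
  have "card {2 * l * m..n} \<le> 2 * l" using n by simp
  then show ?thesis by (metis of_nat_le_iff of_nat_mult of_nat_numeral)
qed

private definition "\<beta> k j = 2 * real l * real j + (real k + real l / 2)"

private lemma \<beta>_bounds: "k < l \<Longrightarrow> \<beta> k m \<le> 2 * real n" "\<beta> k j \<ge> 0"
proof -
  assume "k < l"
  then have "real k \<le> real l" by simp
  then show "\<beta> k m \<le> 2 * real n" using P_bounds n_large l1 unfolding \<beta>_def by linarith
qed (simp add: \<beta>_def)

private lemma trig_sums:
  assumes "k < l"
  shows "\<bar>\<Sum>j<m. \<beta> k j ^ p * cos (2 * \<beta> k j * x)\<bar> \<le> (2 * real n) ^ p * q"
    "\<bar>\<Sum>j<m. \<beta> k j ^ p * sin (2 * \<beta> k j * x)\<bar> \<le> (2 * real n) ^ p * q"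
proof -
  have le: "\<beta> k m ^ p / \<delta> \<le> (2 * real n) ^ p * q"
    unfolding q times_divide_eq_right mult_1_right
    using \<beta>_bounds(1)[OF assms] \<beta>_bounds(2)[of k m] \<delta> by (intro divide_right_mono power_mono) auto
  have "0 \<le> real l" "0 \<le> real k + real l / 2" by simp_all
  note w = weighted_trig_sum_le[of "\<beta> k", OF \<beta>_def this \<delta>(1,3)]
  show "\<bar>\<Sum>j<m. \<beta> k j ^ p * cos (2 * \<beta> k j * x)\<bar> \<le> (2 * real n) ^ p * q"
    by (rule order_trans[OF w(1) le])
  show "\<bar>\<Sum>j<m. \<beta> k j ^ p * sin (2 * \<beta> k j * x)\<bar> \<le> (2 * real n) ^ p * q"
    by (rule order_trans[OF w(2) le])
qed

private lemma block_sum: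
  "(\<Sum>i\<in>first_blocks l m. f (real i + real l / 2)) = (\<Sum>k<l. \<Sum>j<m. f (\<beta> k j))"
  using sum_first_blocks_shifted[of l f m] l by (simp add: \<beta>_def)

private definition "A = (\<Sum>i\<in>free_indices l m n. (scaled_cos l m i x)\<^sup>2)"
private definition "B = (\<Sum>i\<in>free_indices l m n. scaled_cos l m i x * scaled_cos' l m i x)"
private definition "C = (\<Sum>i\<in>free_indices l m n. (scaled_cos' l m i x)\<^sup>2)"

private lemma abs_sum_blocks_le:
  assumes "\<And>k. k < l \<Longrightarrow> \<bar>f k\<bar> \<le> c" "c \<ge> 0"
  shows "\<bar>\<Sum>k<l. f k :: real\<bar> \<le> real l * c"
  using assms by (intro abs_sum_le_card) auto

private lemma A_bound: "\<bar>A - real l * real m / 2\<bar> \<le> 9 * real l * q\<^sup>2"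
proof -
  have "(\<Sum>i\<in>first_blocks l m. (scaled_cos l m i x)\<^sup>2)
      = (\<Sum>i\<in>first_blocks l m. (cos ((real i + real l / 2) * x))\<^sup>2)"
    by (intro sum.cong) (auto simp: scaled_cos_def dest: first_blocks_less)
  also have "\<dots> = (\<Sum>k<l. \<Sum>j<m. (cos (\<beta> k j * x))\<^sup>2)"
    by (rule block_sum[where f = "\<lambda>y. (cos (y * x))\<^sup>2"])
  also have "\<dots> = (\<Sum>k<l. \<Sum>j<m. 1 / 2 + 1 / 2 * (\<beta> k j ^ 0 * cos (2 * \<beta> k j * x)))"
    by (intro sum.cong refl) (simp add: mult.assoc cos_double_cos diff_divide_distrib)
  also have "\<dots> = real l * real m / 2 + (\<Sum>k<l. 1 / 2 * (\<Sum>j<m. \<beta> k j ^ 0 * cos (2 * \<beta> k j * x)))"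
    by (simp add: sum.distrib sum_distrib_left)
  finally have "(\<Sum>i\<in>first_blocks l m. (scaled_cos l m i x)\<^sup>2) - real l * real m / 2
      = (\<Sum>k<l. 1 / 2 * (\<Sum>j<m. \<beta> k j ^ 0 * cos (2 * \<beta> k j * x)))" by simp
  also have "\<bar>\<dots>\<bar> \<le> real l * q"
    using trig_sums(1)[of _ 0] q1 by (intro abs_sum_blocks_le) (force simp: abs_mult)+
  also have "\<dots> \<le> real l * q\<^sup>2" using q1 by (intro mult_left_mono) auto
  finally have T: "\<bar>(\<Sum>i\<in>first_blocks l m. (scaled_cos l m i x)\<^sup>2) - real l * real m / 2\<bar> \<le> real l * q\<^sup>2" .
  have "\<bar>\<Sum>i\<in>{2 * l * m..n}. (scaled_cos l m i x)\<^sup>2\<bar> \<le> 2 * real l * (2 * q)\<^sup>2"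
  proof (rule abs_sum_le_card[OF _ card_rest])
    show "\<bar>(scaled_cos l m i x)\<^sup>2\<bar> \<le> (2 * q)\<^sup>2" if "i \<in> {2 * l * m..n}" for i
      unfolding abs_power2 by (rule power2_le_of_abs_le[OF rest_bounds(1)[OF that]])
  qed auto
  then show ?thesis using T unfolding A_def sum_free_indices by (simp add: power_mult_distrib abs_le_iff)
qed

private lemma B_bound: "\<bar>B\<bar> \<le> 13 * real l * real n * q\<^sup>2"
proof -
  have "(\<Sum>i\<in>first_blocks l m. scaled_cos l m i x * scaled_cos' l m i x)
      = (\<Sum>i\<in>first_blocks l m. - ((real i + real l / 2) * (sin ((real i + real l / 2) * x) * cos ((real i + real l / 2) * x))))"
    by (intro sum.cong) (auto simp: scaled_cos_def scaled_cos'_def mult_ac dest: first_blocks_less)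
  also have "\<dots> = (\<Sum>k<l. \<Sum>j<m. - (\<beta> k j * (sin (\<beta> k j * x) * cos (\<beta> k j * x))))"
    by (rule block_sum[where f = "\<lambda>y. - (y * (sin (y * x) * cos (y * x)))"])
  also have "\<dots> = (\<Sum>k<l. \<Sum>j<m. - (1 / 2) * (\<beta> k j ^ 1 * sin (2 * \<beta> k j * x)))"
    by (intro sum.cong refl) (simp add: mult.assoc sin_double)
  also have "\<dots> = (\<Sum>k<l. - (1 / 2) * (\<Sum>j<m. \<beta> k j ^ 1 * sin (2 * \<beta> k j * x)))"
    by (simp only: sum_distrib_left)
  also have "\<bar>\<dots>\<bar> \<le> real l * (real n * q)"
    using trig_sums(2)[of _ 1] q1 by (intro abs_sum_blocks_le) (force simp: abs_mult)+
  also have "\<dots> \<le> real l * (real n * q\<^sup>2)" using q1 by (intro mult_left_mono) auto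
  finally have T: "\<bar>\<Sum>i\<in>first_blocks l m. scaled_cos l m i x * scaled_cos' l m i x\<bar> \<le> real l * real n * q\<^sup>2"
    by (simp add: mult.assoc)
  have "\<bar>\<Sum>i\<in>{2 * l * m..n}. scaled_cos l m i x * scaled_cos' l m i x\<bar> \<le> 2 * real l * (2 * q * (3 * real n * q))"
  proof (rule abs_sum_le_card[OF _ card_rest])
    show "\<bar>scaled_cos l m i x * scaled_cos' l m i x\<bar> \<le> 2 * q * (3 * real n * q)" if "i \<in> {2 * l * m..n}" for i
      unfolding abs_mult using rest_bounds[OF that] q1 by (intro mult_mono) auto
  qed (use q1 in auto)
  also have "\<dots> = 12 * real l * real n * q\<^sup>2" by (simp add: power2_eq_square)
  finally show ?thesis using T unfolding B_def sum_free_indices by (simp add: abs_le_iff)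
qed

text \<open>By \<open>sum_squares_progression\<close> the double sum is close to \<open>P ^ 3 / 6\<close> with \<open>P = 2 * l * m\<close>, and \<open>P\<close>
  differs from \<open>n\<close> by at most \<open>2 * l\<close>.\<close>
private lemma sum_\<beta>_squares: "\<bar>(\<Sum>k<l. \<Sum>j<m. (\<beta> k j)\<^sup>2) - real l * real m * (real n)\<^sup>2 / 3\<bar> \<le> 11 * real l * (real n)\<^sup>2"
proof -
  define P where "P = 2 * real l * real m"
  have P: "0 \<le> P" "P \<le> 11 / 10 * real n" "\<bar>P - real n\<bar> \<le> 2 * real l"
    using P_bounds n_large l1 unfolding P_def[symmetric] by (auto simp: P_def abs_le_iff)
  have "\<bar>(\<Sum>j<m. (\<beta> k j)\<^sup>2) - P ^ 3 / (6 * real l)\<bar> \<le> 7 / 4 * P\<^sup>2" if "k < l" for k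
  proof -
    have "real k \<le> real l" using that by simp
    then show ?thesis
      using sum_squares_progression[of "real l" "real k + real l / 2" m] l1
      by (simp add: \<beta>_def P_def power_mult_distrib)
  qed
  then have "\<bar>\<Sum>k<l. (\<Sum>j<m. (\<beta> k j)\<^sup>2) - P ^ 3 / (6 * real l)\<bar> \<le> real l * (7 / 4 * P\<^sup>2)"
    by (intro abs_sum_blocks_le) auto
  then have "\<bar>(\<Sum>k<l. \<Sum>j<m. (\<beta> k j)\<^sup>2) - P ^ 3 / 6\<bar> \<le> real l * (7 / 4 * P\<^sup>2)"
    using l1 by (simp add: sum_subtractf)
  moreover have "P\<^sup>2 \<le> (11 / 10 * real n)\<^sup>2" using P by (intro power_mono) auto
  then have "P\<^sup>2 \<le> 4 * (real n)\<^sup>2" unfolding power_mult_distrib 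
    by (rule order_trans) (intro mult_right_mono, auto simp: power2_eq_square)
  then have "real l * (7 / 4 * P\<^sup>2) \<le> real l * (7 * (real n)\<^sup>2)" by (intro mult_left_mono) auto
  moreover have "\<bar>P ^ 3 / 6 - P * (real n)\<^sup>2 / 6\<bar> \<le> 2 * real l * (real n)\<^sup>2"
  proof -
    have "P ^ 3 / 6 - P * (real n)\<^sup>2 / 6 = P / 6 * ((P - real n) * (P + real n))"
      by (simp add: power3_eq_cube power2_eq_square algebra_simps)
    also have "\<bar>\<dots>\<bar> = P / 6 * (\<bar>P - real n\<bar> * (P + real n))" using P by (simp add: abs_mult)
    also have "\<dots> \<le> (2 * real n) / 6 * (2 * real l * (3 * real n))"
      using P by (intro mult_mono divide_right_mono) auto
    finally show ?thesis by (simp add: power2_eq_square)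
  qed
  moreover have "P * (real n)\<^sup>2 / 6 = real l * real m * (real n)\<^sup>2 / 3" by (simp add: P_def)
  moreover have "0 \<le> real l * (real n)\<^sup>2" by simp
  ultimately show ?thesis by linarith
qed

private lemma C_bound: "\<bar>C - real l * real m * (real n)\<^sup>2 / 6\<bar> \<le> 26 * real l * (real n)\<^sup>2 * q\<^sup>2"
proof -
  have "(\<Sum>i\<in>first_blocks l m. (scaled_cos' l m i x)\<^sup>2)
      = (\<Sum>i\<in>first_blocks l m. (real i + real l / 2)\<^sup>2 * (sin ((real i + real l / 2) * x))\<^sup>2)"
    by (intro sum.cong) (auto simp: scaled_cos'_def power_mult_distrib dest: first_blocks_less)
  also have "\<dots> = (\<Sum>k<l. \<Sum>j<m. (\<beta> k j)\<^sup>2 * (sin (\<beta> k j * x))\<^sup>2)"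
    by (rule block_sum[where f = "\<lambda>y. y\<^sup>2 * (sin (y * x))\<^sup>2"])
  also have "\<dots> = (\<Sum>k<l. \<Sum>j<m. 1 / 2 * (\<beta> k j)\<^sup>2 + - (1 / 2) * ((\<beta> k j)\<^sup>2 * cos (2 * \<beta> k j * x)))"
  proof (intro sum.cong refl)
    fix k j
    have "cos (2 * \<beta> k j * x) = 1 - 2 * (sin (\<beta> k j * x))\<^sup>2"
      using cos_double_sin[of "\<beta> k j * x"] by (simp add: mult.assoc)
    then show "(\<beta> k j)\<^sup>2 * (sin (\<beta> k j * x))\<^sup>2
        = 1 / 2 * (\<beta> k j)\<^sup>2 + - (1 / 2) * ((\<beta> k j)\<^sup>2 * cos (2 * \<beta> k j * x))"
      by (simp only:) (simp add: algebra_simps)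
  qed
  also have "\<dots> = 1 / 2 * (\<Sum>k<l. \<Sum>j<m. (\<beta> k j)\<^sup>2) + (\<Sum>k<l. - (1 / 2) * (\<Sum>j<m. (\<beta> k j)\<^sup>2 * cos (2 * \<beta> k j * x)))"
    by (simp only: sum.distrib sum_distrib_left)
  finally have "(\<Sum>i\<in>first_blocks l m. (scaled_cos' l m i x)\<^sup>2) - 1 / 2 * (\<Sum>k<l. \<Sum>j<m. (\<beta> k j)\<^sup>2)
      = (\<Sum>k<l. - (1 / 2) * (\<Sum>j<m. (\<beta> k j)\<^sup>2 * cos (2 * \<beta> k j * x)))" by simp
  also have "\<bar>\<dots>\<bar> \<le> real l * (2 * (real n)\<^sup>2 * q)"
    using trig_sums(1)[of _ 2] q1 by (intro abs_sum_blocks_le) (force simp: abs_mult power_mult_distrib)+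
  also have "\<dots> \<le> real l * (2 * (real n)\<^sup>2 * q\<^sup>2)" using q1 by (intro mult_left_mono) auto
  finally have T: "\<bar>(\<Sum>i\<in>first_blocks l m. (scaled_cos' l m i x)\<^sup>2) - 1 / 2 * (\<Sum>k<l. \<Sum>j<m. (\<beta> k j)\<^sup>2)\<bar>
      \<le> 2 * (real l * (real n)\<^sup>2 * q\<^sup>2)" by (simp add: mult_ac)
  have "\<bar>\<Sum>i\<in>{2 * l * m..n}. (scaled_cos' l m i x)\<^sup>2\<bar> \<le> 2 * real l * (3 * real n * q)\<^sup>2"
  proof (rule abs_sum_le_card[OF _ card_rest])
    show "\<bar>(scaled_cos' l m i x)\<^sup>2\<bar> \<le> (3 * real n * q)\<^sup>2" if "i \<in> {2 * l * m..n}" for i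
      unfolding abs_power2 by (rule power2_le_of_abs_le[OF rest_bounds(2)[OF that]])
  qed auto
  then have R: "\<bar>\<Sum>i\<in>{2 * l * m..n}. (scaled_cos' l m i x)\<^sup>2\<bar> \<le> 18 * (real l * (real n)\<^sup>2 * q\<^sup>2)"
    by (simp add: power_mult_distrib mult_ac)
  have "real l * (real n)\<^sup>2 * 1 \<le> real l * (real n)\<^sup>2 * q\<^sup>2" using q1 by (intro mult_left_mono) auto
  then show ?thesis using T R sum_\<beta>_squares unfolding C_def sum_free_indices by linarith
qed

private lemma A_lower: "real n / 8 \<le> A"
proof -
  have "real l * 1 \<le> real l * q\<^sup>2" using q1 by (intro mult_left_mono) auto
  then show ?thesis using A_bound P_bounds large n_large by (simp add: abs_le_iff)
qed

private lemma E_bound: "\<bar>A * C - B\<^sup>2 - (real n)\<^sup>2 / 3 * A\<^sup>2\<bar> \<le> 250 * real l * real n * q\<^sup>2 * A\<^sup>2"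
proof -
  define s where "s = real l * q\<^sup>2"
  have s: "s \<ge> 0" "13440 * s \<le> real n" using large by (simp_all add: s_def mult.assoc)
  have A: "A > 0" using A_lower n_large by linarith
  have "\<bar>C - (real n)\<^sup>2 / 3 * A\<bar> \<le> 29 * (s * (real n)\<^sup>2)"
  proof -
    have "(real n)\<^sup>2 / 3 * \<bar>A - real l * real m / 2\<bar> \<le> (real n)\<^sup>2 / 3 * (9 * s)"
      using A_bound by (intro mult_left_mono) (auto simp: s_def mult.assoc)
    moreover have "(real n)\<^sup>2 / 3 * A - real l * real m * (real n)\<^sup>2 / 6 = (real n)\<^sup>2 / 3 * (A - real l * real m / 2)"
      by (simp add: right_diff_distrib)
    then have "\<bar>(real n)\<^sup>2 / 3 * A - real l * real m * (real n)\<^sup>2 / 6\<bar> = (real n)\<^sup>2 / 3 * \<bar>A - real l * real m / 2\<bar>"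
      by (simp only: abs_mult) simp
    ultimately have "\<bar>(real n)\<^sup>2 / 3 * A - real l * real m * (real n)\<^sup>2 / 6\<bar> \<le> 3 * (s * (real n)\<^sup>2)"
      by simp
    moreover have "\<bar>C - real l * real m * (real n)\<^sup>2 / 6\<bar> \<le> 26 * (s * (real n)\<^sup>2)"
      using C_bound by (simp add: s_def mult_ac)
    ultimately show ?thesis by linarith
  qed
  then have 1: "\<bar>A * (C - (real n)\<^sup>2 / 3 * A)\<bar> \<le> A * (29 * (s * (real n)\<^sup>2))"
    using A by (simp add: abs_mult)
  have 2: "B\<^sup>2 \<le> (13 * s * real n)\<^sup>2"
    using B_bound by (intro power2_le_of_abs_le) (simp add: s_def mult_ac)
  have "real n \<le> 8 * A" using A_lower by simp
  then have nA: "real n * (A * real n * s) \<le> (8 * A) * (A * real n * s)"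
    "real n * real n * (s * s) \<le> (8 * A) * (8 * A) * (s * s)"
    using A s by (intro mult_right_mono mult_mono; simp)+
  have "\<bar>A * C - B\<^sup>2 - (real n)\<^sup>2 / 3 * A\<^sup>2\<bar> \<le> \<bar>A * (C - (real n)\<^sup>2 / 3 * A)\<bar> + B\<^sup>2"
  proof -
    have "A * (C - (real n)\<^sup>2 / 3 * A) = A * C - (real n)\<^sup>2 / 3 * A\<^sup>2"
      by (simp add: right_diff_distrib power2_eq_square)
    then show ?thesis using zero_le_power2[of B] by (simp only:)
  qed
  also have "\<dots> \<le> 29 * (real n * (A * real n * s)) + 169 * (real n * real n * (s * s))"
    using 1 2 by (simp add: power2_eq_square mult_ac)
  also have "\<dots> \<le> 29 * ((8 * A) * (A * real n * s)) + 169 * ((8 * A) * (8 * A) * (s * s))"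
    using nA by linarith
  also have "\<dots> = A\<^sup>2 * (232 * (s * real n) + 10816 * (s * s))"
    by (simp add: power2_eq_square algebra_simps)
  also have "\<dots> \<le> A\<^sup>2 * (250 * (s * real n))"
  proof (rule mult_left_mono)
    have "s * (13440 * s) \<le> s * real n" using s by (intro mult_left_mono) auto
    moreover have "0 \<le> s * s" "0 \<le> s * real n" using s by simp_all
    ultimately show "232 * (s * real n) + 10816 * (s * s) \<le> 250 * (s * real n)"
      by (simp only: mult.left_commute[of s 13440])
  qed simp
  finally show ?thesis by (simp add: s_def mult_ac)
qed

text \<open>The main terms of \<open>A\<close> and \<open>C\<close> are \<open>l * m / 2\<close> and \<open>l * m * n\<^sup>2 / 6\<close>, while \<open>B\<close> has no main term.
  So \<open>E / V\<^sup>2\<close> is \<open>n\<^sup>2 / 3\<close> up to \<open>O(l * n * q\<^sup>2)\<close>, and its square root is \<open>n / sqrt 3\<close> up to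
  \<open>O(l * q\<^sup>2)\<close>.\<close>
lemma zero_density_bounds:
  defines "V \<equiv> \<Sum>i\<in>free_indices l m n. (scaled_cos l m i x)\<^sup>2"
  defines "E \<equiv> V * (\<Sum>i\<in>free_indices l m n. (scaled_cos' l m i x)\<^sup>2)
      - (\<Sum>i\<in>free_indices l m n. scaled_cos l m i x * scaled_cos' l m i x)\<^sup>2"
    and "e \<equiv> 250 * real l * q\<^sup>2"
  shows "real n / 8 \<le> V" "0 \<le> real n / sqrt 3 - e"
    "(real n / sqrt 3 - e)\<^sup>2 * V\<^sup>2 \<le> E" "E \<le> (real n / sqrt 3 + e)\<^sup>2 * V\<^sup>2"
proof -
  have VE: "V = A" "E = A * C - B\<^sup>2" by (simp_all add: V_def E_def A_def B_def C_def)
  have e: "e \<ge> 0" "50 * e \<le> real n" using large by (simp_all add: e_def)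
  show "real n / 8 \<le> V" unfolding VE by (rule A_lower)
  define h where "h = real n / sqrt 3"
  \<comment> \<open>It suffices that \<open>2 / sqrt 3\<close> exceeds \<open>1\<close> by a margin, of which the term \<open>e\<^sup>2\<close> in \<open>(h - e)\<^sup>2\<close> uses a part.\<close>
  have s3: "sqrt 3 \<le> 17321 / 10000" by (rule real_le_lsqrt) (auto simp: power2_eq_square)
  have h: "11 / 20 * real n \<le> h"
  proof -
    have "11 / 20 * real n * sqrt 3 \<le> 11 / 20 * real n * (17321 / 10000)"
      using s3 by (intro mult_left_mono) auto
    also have "\<dots> \<le> real n" by simp
    finally show ?thesis by (simp add: h_def field_simps)
  qed
  have h2: "h\<^sup>2 = (real n)\<^sup>2 / 3" by (simp add: h_def power_divide)
  show "0 \<le> real n / sqrt 3 - e" using h e unfolding h_def[symmetric] by linarith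
  have E: "\<bar>E - h\<^sup>2 * V\<^sup>2\<bar> \<le> e * real n * V\<^sup>2"
    using E_bound unfolding VE h2 e_def by (simp add: mult_ac)
  have he: "e * (11 / 20 * real n) \<le> e * h" using h e by (intro mult_left_mono)
  have ee: "e * (50 * e) \<le> e * real n" using e by (intro mult_left_mono)
  have "(h - e)\<^sup>2 \<le> h\<^sup>2 - e * real n" "h\<^sup>2 + e * real n \<le> (h + e)\<^sup>2"
  proof -
    have "0 \<le> e * real n" "0 \<le> e * e" using e by simp_all
    moreover have "(h - e)\<^sup>2 = h\<^sup>2 - 2 * (e * h) + e * e" "(h + e)\<^sup>2 = h\<^sup>2 + 2 * (e * h) + e * e"
      by (simp_all add: power2_eq_square algebra_simps)
    ultimately show "(h - e)\<^sup>2 \<le> h\<^sup>2 - e * real n" "h\<^sup>2 + e * real n \<le> (h + e)\<^sup>2"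
      using he ee by linarith+
  qed
  then have "(h - e)\<^sup>2 * V\<^sup>2 \<le> (h\<^sup>2 - e * real n) * V\<^sup>2" "(h\<^sup>2 + e * real n) * V\<^sup>2 \<le> (h + e)\<^sup>2 * V\<^sup>2"
    by (intro mult_right_mono; simp)+
  then show "(real n / sqrt 3 - e)\<^sup>2 * V\<^sup>2 \<le> E" "E \<le> (real n / sqrt 3 + e)\<^sup>2 * V\<^sup>2"
    using E unfolding h_def[symmetric] by (simp_all add: algebra_simps abs_le_iff)
qed

end

section \<open>Zeros on the whole period\<close>

lemma sin_ge_half_distance:
  assumes "0 < h" "h \<le> 1" "h \<le> y" "y \<le> pi - h"
  shows "h / 2 \<le> sin y"
proof -
  obtain \<xi> where \<xi>: "0 < \<xi>" "\<xi> < h" "sin h - sin 0 = (h - 0) * cos \<xi>"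
    using MVT2[OF assms(1), of sin cos] by auto
  have "cos (pi / 3) \<le> cos \<xi>"
    using \<xi> assms pi_gt3 by (intro cos_monotone_0_pi_le) auto
  then have "h * (1 / 2) \<le> h * cos \<xi>"
    using assms by (intro mult_left_mono) (auto simp: cos_60)
  then have h: "h / 2 \<le> sin h" using \<xi> by simp
  have "sin h \<le> sin y"
  proof (cases "y \<le> pi / 2")
    case True
    then show ?thesis using assms pi_gt3 by (intro sin_monotone_2pi_le) auto
  next
    case False
    then have "sin h \<le> sin (pi - y)" using assms pi_gt3 by (intro sin_monotone_2pi_le) auto
    then show ?thesis by simp
  qed
  then show ?thesis using h by linarith
qed

lemma abs_sin_ge_away_from_nodes:
  fixes l k :: nat
  defines "p \<equiv> pi / (2 * real l)"
  assumes l: "l \<ge> 1" and d: "d > 0" "2 * real l * d \<le> 1"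
    and x: "real k * p + d \<le> x" "x \<le> real (Suc k) * p - d"
  shows "d \<le> \<bar>sin (2 * real l * x)\<bar>"
proof -
  define y where "y = 2 * real l * (x - real k * p)"
  have lp: "2 * real l * p = pi" using l by (simp add: p_def)
  have "2 * real l * (real k * p) = real k * pi" using lp by (metis mult.left_commute)
  then have "2 * real l * x = y + real k * pi" by (simp add: y_def algebra_simps)
  then have "\<bar>sin (2 * real l * x)\<bar> = \<bar>sin y\<bar>"
    by (simp add: sin_add abs_mult power_abs[symmetric])
  moreover have "2 * real l * d / 2 \<le> sin y"
  proof (rule sin_ge_half_distance)
    show "0 < 2 * real l * d" using l d by simp
    show "2 * real l * d \<le> y"
      unfolding y_def using x(1) l by (intro mult_left_mono) auto
    have "2 * real l * (x - real k * p) \<le> 2 * real l * (p - d)"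
      using x(2) by (intro mult_left_mono) (auto simp: algebra_simps)
    then show "y \<le> pi - 2 * real l * d" unfolding y_def using lp by (simp add: right_diff_distrib)
  qed (use d in simp)
  moreover have "1 * d \<le> real l * d" using l d by (intro mult_right_mono) auto
  ultimately show ?thesis by simp
qed

lemma continuous_on_cos_poly: "continuous_on S (cos_poly n c)"
  unfolding cos_poly_def by (intro continuous_intros)

lemma measurable_zero_count_cos_poly:
  assumes [measurable]: "\<And>j. j \<le> n \<Longrightarrow> c j \<in> borel_measurable M"
  shows "(\<lambda>\<omega>. zero_count (cos_poly n (\<lambda>j. c j \<omega>)) {0<..<2 * pi}) \<in> borel_measurable M"
proof -
  have V [measurable]: "(\<lambda>\<omega>. cos_poly n (\<lambda>j. c j \<omega>) x) \<in> borel_measurable M" for x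
    unfolding cos_poly_def by measurable
  have split: "zero_count f {0<..<2 * pi} = zero_count f {0..<2 * pi} - (if f 0 = 0 then 1 else 0)" for f
  proof -
    have "insert 0 {0<..<2 * pi} = {0..<2 * pi}" by auto
    then have eq: "zero_count f {0..<2 * pi} = zero_count f {0<..<2 * pi} + (if f 0 = 0 then 1 else 0)"
      using zero_count_insert[of 0 "{0<..<2 * pi}" f] by simp
    have ne: "(if f 0 = 0 then 1 else 0) \<noteq> (top :: ennreal)" by simp
    show ?thesis unfolding eq by (rule ennreal_add_diff_cancel_right[OF ne, symmetric])
  qed
  have "(\<lambda>\<omega>. zero_count (\<lambda>x. cos_poly n (\<lambda>j. c j \<omega>) x) {0..<2 * pi}) \<in> borel_measurable M"
    by (intro measurable_zero_count continuous_on_cos_poly V) simp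
  then show ?thesis unfolding split by measurable
qed

lemma sum_const_ennreal: "(\<Sum>k\<in>S. ennreal c) = ennreal (real (card S) * c)"
  by (simp add: ennreal_mult' ennreal_of_nat_eq_real_of_nat)

lemma cos_poly_scale: "cos_poly n (\<lambda>j. c j / \<sigma>) x = cos_poly n c x / \<sigma>"
  by (simp add: cos_poly_def sum_divide_distrib)

text \<open>The nodes \<open>k * p\<close> with \<open>p = pi / (2 * l)\<close> are the zeros of \<open>sin (2 * l * x)\<close>. Away from them, on \<open>4 * l\<close>
  intervals of length \<open>p - 2 * d\<close>, the density of zeros is known; each of the \<open>4 * l + 1\<close> intervals of
  radius \<open>d\<close> around a node contains few zeros.\<close>
lemma expected_zeros_paired:
  fixes l m n K :: nat and \<sigma> d :: real and M :: "'a measure" and a :: "nat \<Rightarrow> 'a \<Rightarrow> real"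
  assumes l: "l \<ge> 1" and \<sigma>: "\<sigma> > 0" and M: "prob_space M" and a: "paired_block_coeffs M l \<sigma> m n a"
    and n: "2 * l * m \<le> n + 1" "n + 2 \<le> 2 * l * m + 2 * l"
    and d: "d > 0" "2 * real l * d \<le> 1" "13440 * real l * (1 / d)\<^sup>2 \<le> real n"
    and K: "exp 2 * (real n * (2 * d)) \<le> real K"
  defines "e \<equiv> 250 * real l * (1 / d)\<^sup>2"
  defines "EN \<equiv> prob_space.expectation M (\<lambda>\<omega>. real (num_zeros (cos_poly n (\<lambda>j. a j \<omega>)) {0<..<2 * pi}))"
  shows "(real n / sqrt 3 - e) * (2 * pi - 8 * real l * d) / pi \<le> EN"
    "EN \<le> 2 * (real n / sqrt 3 + e) + (4 * real l + 1) * (real K + 3 * (48 * real (n + 1) ^ 5 * exp (- real K) + 1))"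
proof -
  interpret prob_space M by (rule M)
  define J where "J = free_indices l m n"
  define b where "b i \<omega> = a i \<omega> / \<sigma>" for i \<omega>
  have J_sub: "J \<subseteq> {..n}"
    using n(1) by (auto simp: J_def free_indices_eq dest!: first_blocks_less)
  then have J: "finite J" "card J \<le> n + 1"
    using finite_subset[OF J_sub] card_mono[OF _ J_sub] by auto
  interpret iid_gaussian M J b
  proof
    show "finite J" by (rule J)
    have "indep_vars (\<lambda>_. borel) a J" using a by (simp add: paired_block_coeffs_def J_def)
    then show "indep_vars (\<lambda>_. borel) b J"
      unfolding b_def by (rule indep_vars_compose2[where Y = "\<lambda>_ x. x / \<sigma>"]) simp
    show "distributed M lborel (b i) std_normal_density" if "i \<in> J" for i
      using a that normal_standard_normal_convert[OF \<sigma>, of "a i" 0]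
      unfolding paired_block_coeffs_def J_def b_def by simp
  qed
  have pair: "b (i + l) \<omega> = b i \<omega>" if "i \<in> first_blocks l m" "\<omega> \<in> space M" for i \<omega>
    using a that unfolding first_blocks_def paired_block_coeffs_def b_def by (auto simp: add_ac)
  have mb: "b j \<in> borel_measurable M" if "j \<le> n" for j
  proof -
    consider "j \<in> J" | i where "i \<in> first_blocks l m" "j = i + l"
    proof -
      have "j \<in> first_blocks l m \<or> (\<exists>i\<in>first_blocks l m. j = i + l) \<or> j \<ge> 2 * l * m"
      proof (cases "j < 2 * l * m")
        case True
        define q r where "q = j div (2 * l)" and "r = j mod (2 * l)"
        have j: "j = 2 * l * q + r" "r < 2 * l" using l by (auto simp: q_def r_def)
        have q: "q < m" using True j by (metis add_lessD1 mult_less_cancel1)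
        show ?thesis
        proof (cases "r < l")
          case True
          then show ?thesis using j q unfolding first_blocks_def by blast
        next
          case False
          then have "r - l < l" "j = (2 * l * q + (r - l)) + l" using j by auto
          then show ?thesis using q unfolding first_blocks_def by blast
        qed
      qed simp
      then show thesis using that \<open>j \<le> n\<close> unfolding J_def free_indices_eq by auto
    qed
    then show ?thesis
    proof cases
      case 1
      then show ?thesis by (rule measurable_b)
    next
      case 2
      then have "i \<in> J" by (simp add: J_def free_indices_eq)
      then have "b i \<in> borel_measurable M" by (rule measurable_b)
      then show ?thesis using pair[OF 2(1)] 2(2) by (simp cong: measurable_cong)
    qed
  qed
  define V where "V \<omega> = cos_poly n (\<lambda>j. b j \<omega>)" for \<omega>
  have V_lin: "V \<omega> x = lin (\<lambda>i. paired_cos l m i x) \<omega>" if "\<omega> \<in> space M" for \<omega> x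
    unfolding V_def lin_def
    using cos_poly_paired(1)[of l m n "\<lambda>j. b j \<omega>" x, folded J_def] l n(1) pair that by simp
  have V_sum: "(\<Sum>j\<le>n. \<bar>b j \<omega>\<bar>) \<le> 2 * (\<Sum>i\<in>J. \<bar>b i \<omega>\<bar>)" if "\<omega> \<in> space M" for \<omega>
    unfolding J_def using cos_poly_paired(2)[of l m n "\<lambda>j. b j \<omega>"] l n(1) pair that by simp
  define p where "p = pi / (2 * real l)"
  have p: "p > 0" "2 * real l * p = pi" using l by (auto simp: p_def)
  have d1: "d \<le> 1" "2 * d < p"
  proof -
    have "1 * d \<le> real l * d" using l d by (intro mult_right_mono) auto
    then show "d \<le> 1" using d by linarith
    have "2 * real l * (2 * d) < 2 * real l * p" using d p pi_gt3 by linarith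
    then show "2 * d < p" using l by simp
  qed
  define lo hi where "lo = real n / sqrt 3 - e" and "hi = real n / sqrt 3 + e"
  define good where "good k = {real k * p + d..<real (Suc k) * p - d}" for k :: nat
  define bad where "bad k = {real k * p - d..real k * p + d}" for k :: nat
  note dens = zero_density_bounds[OF l n d(1) d1(1) _ refl d(3), folded J_def e_def]
  have "0 \<le> e" by (simp add: e_def)
  have lo0: "0 \<le> lo"
  proof -
    have "d \<le> \<bar>sin (2 * real l * (real 0 * p + d))\<bar>"
      by (rule abs_sin_ge_away_from_nodes[OF l d(1,2), folded p_def, of 0]) (use d1 in auto)
    from dens(2)[OF this] show ?thesis by (simp add: lo_def)
  qed
  then have hi0: "0 \<le> hi" using \<open>0 \<le> e\<close> by (simp add: lo_def hi_def)
  have good_int: "ennreal (lo * (p - 2 * d) / pi) \<le> (\<integral>\<^sup>+\<omega>. zero_count (V \<omega>) (good k) \<partial>M) \<and>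
      (\<integral>\<^sup>+\<omega>. zero_count (V \<omega>) (good k) \<partial>M) \<le> ennreal (hi * (p - 2 * d) / pi)" for k
  proof -
    define s t where "s = real k * p + d" and "t = real (Suc k) * p - d"
    have st: "s < t" "t - s = p - 2 * d" using d1 by (auto simp: s_def t_def algebra_simps)
    have sin: "d \<le> \<bar>sin (2 * real l * x)\<bar>" if "x \<in> {s..t}" for x
      using that by (intro abs_sin_ge_away_from_nodes[OF l d(1,2), folded p_def, of k]) (auto simp: s_def t_def)
    have nz: "cos (real l * x / 2) \<noteq> 0" if "x \<in> {s..t}" for x
      by (rule cos_half_nonzero[OF l n d(1) d1(1) sin[OF that] refl d(3)])
    have eq: "(\<integral>\<^sup>+\<omega>. zero_count (V \<omega>) (good k) \<partial>M)
        = (\<integral>\<^sup>+\<omega>. zero_count (\<lambda>x. lin (\<lambda>i. scaled_cos l m i x) \<omega>) {s..<t} \<partial>M)"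
    proof (intro nn_integral_cong)
      fix \<omega> assume w: "\<omega> \<in> space M"
      have "V \<omega> x = 2 * cos (real l * x / 2) * lin (\<lambda>i. scaled_cos l m i x) \<omega>" if "x \<in> {s..<t}" for x
        unfolding V_lin[OF w] lin_def sum_distrib_left
        using paired_cos_eq[OF nz, of x m] that by (intro sum.cong) (auto simp: mult.assoc)
      then show "zero_count (V \<omega>) (good k) = zero_count (\<lambda>x. lin (\<lambda>i. scaled_cos l m i x) \<omega>) {s..<t}"
        unfolding good_def s_def[symmetric] t_def[symmetric]
        using nz by (intro zero_count_cong) auto
    qed
    have n8: "real n / 8 > 0"
    proof -
      have "0 < 13440 * real l * (1 / d)\<^sup>2" using l d by simp
      then show ?thesis using d(3) by linarith
    qed
    have c2: "continuous_on {s..t} (scaled_cos'' l m i)" for i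
      using isCont_scaled_cos''[OF nz] by (intro continuous_at_imp_continuous_on) auto
    show ?thesis
      unfolding eq st(2)[symmetric]
    proof
      show "ennreal (lo * (t - s) / pi) \<le> (\<integral>\<^sup>+\<omega>. zero_count (\<lambda>x. lin (\<lambda>i. scaled_cos l m i x) \<omega>) {s..<t} \<partial>M)"
        by (rule expected_zeros_bounds(1)[where \<mu> = "real n / 8" and G' = "scaled_cos' l m"
              and G'' = "scaled_cos'' l m" and lo = lo and hi = hi];
            (rule st(1) n8 lo0 hi0 c2 dens(1)[OF sin] dens(3)[OF sin, folded lo_def]
              dens(4)[OF sin, folded hi_def] DERIV_scaled_cos[OF nz] DERIV_scaled_cos'[OF nz] | assumption)+)
      show "(\<integral>\<^sup>+\<omega>. zero_count (\<lambda>x. lin (\<lambda>i. scaled_cos l m i x) \<omega>) {s..<t} \<partial>M) \<le> ennreal (hi * (t - s) / pi)"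
        by (rule expected_zeros_bounds(2)[where \<mu> = "real n / 8" and G' = "scaled_cos' l m"
              and G'' = "scaled_cos'' l m" and lo = lo and hi = hi];
            (rule st(1) n8 lo0 hi0 c2 dens(1)[OF sin] dens(3)[OF sin, folded lo_def]
              dens(4)[OF sin, folded hi_def] DERIV_scaled_cos[OF nz] DERIV_scaled_cos'[OF nz] | assumption)+)
    qed
  qed
  define Bd where "Bd = real K + 3 * (48 * real (n + 1) ^ 5 * exp (- real K) + 1)"
  have Bd0: "Bd \<ge> 0" by (simp add: Bd_def)
  have bad_int: "(\<integral>\<^sup>+\<omega>. zero_count (V \<omega>) (bad k) \<partial>M) \<le> ennreal Bd" for k
  proof -
    \<comment> \<open>The right end of the interval is far enough from all nodes for the variance to be large.\<close>
    define x0 where "x0 = real k * p + d"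
    have sin: "d \<le> \<bar>sin (2 * real l * x0)\<bar>"
      unfolding x0_def
      by (rule abs_sin_ge_away_from_nodes[OF l d(1,2), folded p_def, of k]) (use d1 in \<open>auto simp: algebra_simps\<close>)
    have nz: "cos (real l * x0 / 2) \<noteq> 0"
      by (rule cos_half_nonzero[OF l n d(1) d1(1) sin refl d(3)])
    have "1 \<le> (2 * cos (real l * x0 / 2))\<^sup>2 * (\<Sum>i\<in>J. (scaled_cos l m i x0)\<^sup>2)"
    proof -
      have "d / 4 \<le> \<bar>cos (real l * x0 / 2)\<bar>"
        by (rule abs_cos_half_ge[OF l n d(1) d1(1) sin refl d(3)])
      then have "(d / 2)\<^sup>2 \<le> \<bar>2 * cos (real l * x0 / 2)\<bar>\<^sup>2"
        using d by (intro power_mono) (auto simp: abs_mult)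
      moreover have "13440 * real l * (1 / d)\<^sup>2 / 8 \<le> (\<Sum>i\<in>J. (scaled_cos l m i x0)\<^sup>2)"
        using dens(1)[OF sin] d(3) by linarith
      ultimately have "(d / 2)\<^sup>2 * (13440 * real l * (1 / d)\<^sup>2 / 8)
          \<le> \<bar>2 * cos (real l * x0 / 2)\<bar>\<^sup>2 * (\<Sum>i\<in>J. (scaled_cos l m i x0)\<^sup>2)"
        by (intro mult_mono) auto
      moreover have "(d / 2)\<^sup>2 * (13440 * real l * (1 / d)\<^sup>2 / 8) = 420 * real l"
        using d by (simp add: power_divide)
      ultimately have "420 * real l \<le> (2 * cos (real l * x0 / 2))\<^sup>2 * (\<Sum>i\<in>J. (scaled_cos l m i x0)\<^sup>2)"
        by (simp only: power2_abs)
      moreover have "real l \<ge> 1" using l by simp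
      ultimately show ?thesis by linarith
    qed
    also have "\<dots> = (\<Sum>i\<in>J. (paired_cos l m i x0)\<^sup>2)"
      unfolding paired_cos_eq[OF nz] by (simp add: power_mult_distrib sum_distrib_left)
    finally have "1 \<le> (\<Sum>i\<in>J. (paired_cos l m i x0)\<^sup>2)" .
    then have "(\<integral>\<^sup>+\<omega>. zero_count (V \<omega>) (bad k) \<partial>M)
        \<le> ennreal (real K + 3 * (48 * real (card J) ^ 5 * exp (- real K) + 1))"
      unfolding V_def bad_def
      using V_lin V_sum K d
      by (intro expected_zeros_short_interval[where \<xi> = x0 and g = "\<lambda>i. paired_cos l m i x0"])
         (auto simp: x0_def V_def)
    also have "\<dots> \<le> ennreal Bd"
      unfolding Bd_def using J(2)
      by (intro ennreal_leI add_left_mono mult_left_mono add_right_mono mult_right_mono power_mono) auto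
    finally show ?thesis .
  qed
  have mV: "(\<lambda>\<omega>. V \<omega> x) \<in> borel_measurable M" for x
    unfolding V_def cos_poly_def using mb by measurable
  have m_good: "(\<lambda>\<omega>. zero_count (V \<omega>) (good k)) \<in> borel_measurable M" for k
    unfolding good_def
    by (rule measurable_zero_count[where W = "\<lambda>x \<omega>. V \<omega> x"])
       (use d1 in \<open>auto simp: algebra_simps V_def intro!: continuous_on_cos_poly mV[unfolded V_def]\<close>)
  define X where "X \<omega> = zero_count (V \<omega>) {0<..<2 * pi}" for \<omega>
  \<comment> \<open>The expectation is a Bochner integral, which is \<open>0\<close> for functions that are not measurable.\<close>
  have mX [measurable]: "X \<in> borel_measurable M"
    unfolding X_def[abs_def] V_def using mb by (rule measurable_zero_count_cos_poly)
  have lp: "4 * real l * p = 2 * pi" using p by linarith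
  have "(\<Sum>k<4 * l. ennreal (lo * (p - 2 * d) / pi)) \<le> (\<Sum>k<4 * l. (\<integral>\<^sup>+\<omega>. zero_count (V \<omega>) (good k) \<partial>M))"
    using good_int by (intro sum_mono) auto
  also have "\<dots> = (\<integral>\<^sup>+\<omega>. (\<Sum>k<4 * l. zero_count (V \<omega>) (good k)) \<partial>M)"
    by (rule nn_integral_sum[symmetric]) (rule m_good)
  also have "\<dots> \<le> (\<integral>\<^sup>+\<omega>. X \<omega> \<partial>M)"
  proof (rule nn_integral_mono)
    fix \<omega>
    have "disjoint_family_on good {..<4 * l}"
    proof (unfold disjoint_family_on_def, intro ballI impI)
      fix i j :: nat assume "i \<noteq> j"
      have *: "good i \<inter> good j = {}" if "i < j" for i j
      proof -
        have "real (Suc i) * p \<le> real j * p" using that p by (intro mult_right_mono) auto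
        then show ?thesis using d unfolding good_def by auto
      qed
      show "good i \<inter> good j = {}"
        using *[of i j] *[of j i] \<open>i \<noteq> j\<close> by (cases "i < j") auto
    qed
    then have "(\<Sum>k<4 * l. zero_count (V \<omega>) (good k)) = zero_count (V \<omega>) (\<Union>k\<in>{..<4 * l}. good k)"
      by (intro zero_count_UN_disjoint) auto
    also have "\<dots> \<le> X \<omega>"
      unfolding X_def
    proof (rule zero_count_mono, intro UN_least subsetI)
      fix k x assume k: "k \<in> {..<4 * l}" and x: "x \<in> good k"
      have "real (Suc k) \<le> 4 * real l" using k by (simp flip: of_nat_Suc)
      then have "real (Suc k) * p \<le> 4 * real l * p" using p by (intro mult_right_mono) auto
      moreover have "0 \<le> real k * p" using p by simp
      ultimately show "x \<in> {0<..<2 * pi}" using x d unfolding good_def lp by auto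
    qed
    finally show "(\<Sum>k<4 * l. zero_count (V \<omega>) (good k)) \<le> X \<omega>" .
  qed
  finally have lower: "ennreal (real (4 * l) * (lo * (p - 2 * d) / pi)) \<le> (\<integral>\<^sup>+\<omega>. X \<omega> \<partial>M)"
    by (simp only: sum_const_ennreal card_lessThan)
  have cover: "{0<..<2 * pi} \<subseteq> (\<Union>k\<in>{..<4 * l}. good k) \<union> (\<Union>k\<in>{..4 * l}. bad k)"
  proof
    fix x assume x: "x \<in> {0<..<2 * pi}"
    define k where "k = nat \<lfloor>x / p\<rfloor>"
    have "0 \<le> x / p" using x p by simp
    then have "real k \<le> x / p" "x / p < real (Suc k)"
      unfolding k_def by linarith+
    then have k: "real k * p \<le> x" "x < real (Suc k) * p" using p by (simp_all add: field_simps)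
    have "real k * p < 4 * real l * p" using k(1) x unfolding lp by (simp only: greaterThanLessThan_iff) linarith
    then have "real k < real (4 * l)" using p by simp
    then have kl: "k < 4 * l" by (simp only: of_nat_less_iff)
    show "x \<in> (\<Union>k\<in>{..<4 * l}. good k) \<union> (\<Union>k\<in>{..4 * l}. bad k)"
    proof (cases "x \<in> good k")
      case True
      then show ?thesis using kl by blast
    next
      case False
      then have "x < real k * p + d \<or> real (Suc k) * p - d \<le> x" unfolding good_def by auto
      then have "x \<in> bad k \<or> x \<in> bad (Suc k)" using k d unfolding bad_def by auto
      moreover have "k \<in> {..4 * l}" "Suc k \<in> {..4 * l}" using kl by auto
      ultimately show ?thesis by blast
    qed
  qed
  have m_bad: "(\<lambda>\<omega>. zero_count (V \<omega>) (bad k)) \<in> borel_measurable M" for k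
  proof -
    have "bad k = insert (real k * p + d) {real k * p - d..<real k * p + d}"
      using d unfolding bad_def by auto
    then have eq: "zero_count (V \<omega>) (bad k) = zero_count (V \<omega>) {real k * p - d..<real k * p + d}
        + (if V \<omega> (real k * p + d) = 0 then 1 else 0)" for \<omega>
      by (simp add: zero_count_insert)
    have "(\<lambda>\<omega>. zero_count (V \<omega>) {real k * p - d..<real k * p + d}) \<in> borel_measurable M"
      by (rule measurable_zero_count[where W = "\<lambda>x \<omega>. V \<omega> x"])
         (use d in \<open>auto simp: V_def intro!: continuous_on_cos_poly mV[unfolded V_def]\<close>)
    moreover note [measurable] = mV
    ultimately show ?thesis unfolding eq by measurable
  qed
  have "(\<integral>\<^sup>+\<omega>. X \<omega> \<partial>M) \<le> (\<integral>\<^sup>+\<omega>. (\<Sum>k<4 * l. zero_count (V \<omega>) (good k)) + (\<Sum>k\<le>4 * l. zero_count (V \<omega>) (bad k)) \<partial>M)"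
    unfolding X_def
    by (intro nn_integral_mono order_trans[OF zero_count_mono[OF cover]]
          order_trans[OF zero_count_Un] add_mono zero_count_UN_le) auto
  also have "\<dots> = (\<Sum>k<4 * l. (\<integral>\<^sup>+\<omega>. zero_count (V \<omega>) (good k) \<partial>M)) + (\<Sum>k\<le>4 * l. (\<integral>\<^sup>+\<omega>. zero_count (V \<omega>) (bad k) \<partial>M))"
    using m_good m_bad by (subst nn_integral_add) (auto simp: nn_integral_sum)
  also have "\<dots> \<le> (\<Sum>k<4 * l. ennreal (hi * (p - 2 * d) / pi)) + (\<Sum>k\<le>4 * l. ennreal Bd)"
    using good_int bad_int by (intro add_mono sum_mono) auto
  also have "\<dots> = ennreal (real (4 * l) * (hi * (p - 2 * d) / pi)) + ennreal (real (4 * l + 1) * Bd)"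
    by (simp only: sum_const_ennreal card_lessThan card_atMost Suc_eq_plus1)
  also have "\<dots> = ennreal (real (4 * l) * (hi * (p - 2 * d) / pi) + real (4 * l + 1) * Bd)"
    using hi0 d1 Bd0 by (intro ennreal_plus[symmetric]) auto
  finally have upper: "(\<integral>\<^sup>+\<omega>. X \<omega> \<partial>M) \<le> ennreal (real (4 * l) * (hi * (p - 2 * d) / pi) + real (4 * l + 1) * Bd)" .
  then have fin: "(\<integral>\<^sup>+\<omega>. X \<omega> \<partial>M) < \<infinity>" by (auto simp: less_top[symmetric] top_unique)
  have "num_zeros (cos_poly n (\<lambda>j. a j \<omega>)) {0<..<2 * pi} = num_zeros (V \<omega>) {0<..<2 * pi}" for \<omega>
    unfolding V_def b_def cos_poly_scale num_zeros_def using \<sigma> by simp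
  then have "EN = (\<integral>\<omega>. enn2real (X \<omega>) \<partial>M)"
    unfolding EN_def X_def enn2real_zero_count by simp
  also have "\<dots> = enn2real (\<integral>\<^sup>+\<omega>. ennreal (enn2real (X \<omega>)) \<partial>M)"
    by (rule integral_eq_nn_integral) auto
  also have "(\<integral>\<^sup>+\<omega>. ennreal (enn2real (X \<omega>)) \<partial>M) = (\<integral>\<^sup>+\<omega>. X \<omega> \<partial>M)"
    using nn_integral_PInf_AE[OF mX] fin
    by (intro nn_integral_cong_AE) (auto elim!: eventually_mono simp: less_top)
  finally have EN: "ennreal EN = (\<integral>\<^sup>+\<omega>. X \<omega> \<partial>M)" "EN \<ge> 0" using fin by (auto simp: less_top)
  have p4: "real (4 * l) * (c * (p - 2 * d) / pi) = c * (2 * pi - 8 * real l * d) / pi" for c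
  proof -
    have "real (4 * l) * (p - 2 * d) = 2 * pi - 8 * real l * d" using lp by (simp add: algebra_simps)
    then show ?thesis by (metis mult.left_commute times_divide_eq_right)
  qed
  show "(real n / sqrt 3 - e) * (2 * pi - 8 * real l * d) / pi \<le> EN"
    using lower EN(2) unfolding EN(1)[symmetric] p4 by (simp add: ennreal_le_iff lo_def)
  have "0 \<le> real (4 * l) * (hi * (p - 2 * d) / pi) + real (4 * l + 1) * Bd"
    using hi0 d1 Bd0 by simp
  then have "EN \<le> hi * (2 * pi - 8 * real l * d) / pi + real (4 * l + 1) * Bd"
    using upper unfolding EN(1)[symmetric] p4 by (simp add: ennreal_le_iff)
  moreover have "hi * (2 * pi - 8 * real l * d) / pi \<le> hi * (2 * pi) / pi"
    using hi0 l d by (intro divide_right_mono mult_left_mono) auto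
  then have "hi * (2 * pi - 8 * real l * d) / pi \<le> 2 * hi" by simp
  moreover have "real (4 * l + 1) = 4 * real l + 1" by simp
  ultimately have "EN \<le> 2 * hi + (4 * real l + 1) * Bd" by (simp only:)
  then show "EN \<le> 2 * (real n / sqrt 3 + e) + (4 * real l + 1) * (real K + 3 * (48 * real (n + 1) ^ 5 * exp (- real K) + 1))"
    unfolding hi_def Bd_def .
qed

theorem theorem2p1:
  fixes l :: nat and \<sigma> :: real
    and M :: "nat \<Rightarrow> 'a measure"
    and a :: "nat \<Rightarrow> nat \<Rightarrow> 'a \<Rightarrow> real"
  assumes "l \<ge> 1" and "\<sigma> > 0"
    and "\<And>n. prob_space (M n)"
    and "\<And>(n::nat) (m::nat) (r::int).
           m \<ge> 1 \<Longrightarrow> r \<in> {-1..2 * int l - 2} \<Longrightarrow> int n = 2 * int l * int m + r \<Longrightarrow>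
           paired_block_coeffs (M n) l \<sigma> m n (a n)"
  shows "(\<lambda>n. prob_space.expectation (M n)
               (\<lambda>\<omega>. real (num_zeros (cos_poly n (\<lambda>j. a n j \<omega>)) {0<..<2 * pi}))
             - 2 * real n / sqrt 3)
         \<in> O(\<lambda>n. real n powr (5 / 6))"
proof -
  \<comment> \<open>This radius lets the excluded intervals contribute \<open>n * d n = n powr (5 / 6)\<close>, and the error of the
    density elsewhere is \<open>O(1 / (d n)\<^sup>2) = O(n powr (1 / 3))\<close>.\<close>
  define d where "d n = real n powr (- 1 / 6)" for n :: nat
  define K where "K n = nat \<lceil>2 * exp 2 * real n powr (5 / 6)\<rceil>" for n :: nat
  define C where "C = 508 * real l + (4 * real l + 1) * (2 * exp 2 + 148)"
  have e1: "eventually (\<lambda>n. 2 * real l * d n \<le> 1) sequentially"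
    unfolding d_def by real_asymp
  have e2: "eventually (\<lambda>n. 13440 * real l * real n powr (1 / 3) \<le> real n) sequentially"
    by real_asymp
  have e3: "eventually (\<lambda>n. real (n + 1) ^ 5 * exp (- (2 * exp 2 * real n powr (5 / 6))) \<le> 1) sequentially"
    by real_asymp
  have "eventually (\<lambda>n. \<bar>prob_space.expectation (M n)
               (\<lambda>\<omega>. real (num_zeros (cos_poly n (\<lambda>j. a n j \<omega>)) {0<..<2 * pi}))
             - 2 * real n / sqrt 3\<bar> \<le> C * real n powr (5 / 6)) sequentially"
    using e1 e2 e3 eventually_ge_at_top[of "2 * l"]
  proof eventually_elim
    case (elim n)
    define EN where "EN = prob_space.expectation (M n)
               (\<lambda>\<omega>. real (num_zeros (cos_poly n (\<lambda>j. a n j \<omega>)) {0<..<2 * pi}))"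
    define N where "N = real n powr (5 / 6)"
    have n1: "real n \<ge> 1" "n > 0" using elim(4) assms(1) by auto
    have N1: "N \<ge> 1" using n1 by (simp add: N_def ge_one_powr_ge_zero)
    have d0: "d n > 0" using n1 by (simp add: d_def)
    have d2: "(1 / d n)\<^sup>2 = real n powr (1 / 3)"
    proof -
      have "1 / d n = real n powr (1 / 6)" by (simp add: d_def powr_minus_divide)
      then show ?thesis using n1 by (simp add: powr_power)
    qed
    have nd: "real n * d n = N"
    proof -
      have "real n * d n = real n powr 1 * real n powr (- 1 / 6)" using n1 by (simp add: d_def)
      also have "\<dots> = N" unfolding powr_add[symmetric] N_def by simp
      finally show ?thesis .
    qed
    have cube_le: "real n powr (1 / 3) \<le> N" unfolding N_def using n1 by (intro powr_mono) auto
    \<comment> \<open>The remainder \<open>r\<close> starts at \<open>-1\<close>, so it is \<open>n + 1\<close> that is divided by \<open>2 * l\<close>.\<close>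
    define m where "m = (n + 1) div (2 * l)"
    define s where "s = (n + 1) mod (2 * l)"
    have ms: "n + 1 = 2 * l * m + s" "s < 2 * l" using assms(1) by (auto simp: m_def s_def)
    have m1: "m \<ge> 1" using elim(4) assms(1) by (auto simp: m_def div_greater_zero_iff Suc_le_eq)
    have pb: "paired_block_coeffs (M n) l \<sigma> m n (a n)"
    proof (rule assms(4)[OF m1, of "int s - 1"])
      have "int (n + 1) = int (2 * l * m + s)" using ms(1) by simp
      then show "int n = 2 * int l * int m + (int s - 1)" by simp
    qed (use ms(2) in auto)
    have nm: "2 * l * m \<le> n + 1" "n + 2 \<le> 2 * l * m + 2 * l" using ms by auto
    have K: "2 * exp 2 * N \<le> real (K n)" "real (K n) \<le> 2 * exp 2 * N + 1"
    proof -
      have "2 * exp 2 * N \<ge> 0" using N1 by simp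
      then show "2 * exp 2 * N \<le> real (K n)" "real (K n) \<le> 2 * exp 2 * N + 1"
        unfolding K_def N_def[symmetric] by linarith+
    qed
    have KL: "exp 2 * (real n * (2 * d n)) \<le> real (K n)"
    proof -
      have "exp 2 * (real n * (2 * d n)) = 2 * exp 2 * (real n * d n)" by simp
      then show ?thesis using K(1) unfolding nd by (simp only:)
    qed
    define e where "e = 250 * real l * (1 / d n)\<^sup>2"
    have e: "0 \<le> e" "e \<le> 250 * real l * N"
      unfolding e_def d2 using cube_le by (auto intro!: mult_left_mono)
    have large: "13440 * real l * (1 / d n)\<^sup>2 \<le> real n" unfolding d2 by (rule elim(2))
    note main = expected_zeros_paired[OF assms(1,2) assms(3)[of n] pb nm d0 elim(1) large KL,
        folded EN_def e_def]
    have tail: "real (n + 1) ^ 5 * exp (- real (K n)) \<le> 1"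
    proof -
      have "real (n + 1) ^ 5 * exp (- real (K n)) \<le> real (n + 1) ^ 5 * exp (- (2 * exp 2 * N))"
        using K(1) by (intro mult_left_mono) auto
      then show ?thesis using elim(3) unfolding N_def by linarith
    qed
    have up: "EN - 2 * real n / sqrt 3 \<le> C * N"
    proof -
      have "real (K n) + 3 * (48 * real (n + 1) ^ 5 * exp (- real (K n)) + 1) \<le> (2 * exp 2 + 148) * N"
      proof -
        have gen: "k + 3 * (z + 1) \<le> y + 148" if "z \<le> 48" "k \<le> y + 1" for k y z :: real
          using that by simp
        have "48 * real (n + 1) ^ 5 * exp (- real (K n)) \<le> 48" using tail by simp
        from gen[OF this K(2)] have "real (K n) + 3 * (48 * real (n + 1) ^ 5 * exp (- real (K n)) + 1) \<le> 2 * exp 2 * N + 148"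
          .
        also have "\<dots> \<le> (2 * exp 2 + 148) * N" using N1 by (simp add: distrib_right)
        finally show ?thesis .
      qed
      then have "(4 * real l + 1) * (real (K n) + 3 * (48 * real (n + 1) ^ 5 * exp (- real (K n)) + 1))
          \<le> (4 * real l + 1) * ((2 * exp 2 + 148) * N)"
        by (intro mult_left_mono) auto
      moreover have "0 \<le> 8 * real l * N" using N1 by simp
      moreover have "C * N = 500 * real l * N + 8 * real l * N + (4 * real l + 1) * ((2 * exp 2 + 148) * N)"
        by (simp add: C_def algebra_simps)
      moreover have "2 * (real n / sqrt 3 + e) = 2 * real n / sqrt 3 + 2 * e" by simp
      ultimately show ?thesis using main(2) e(2) by linarith
    qed
    have low: "2 * real n / sqrt 3 - EN \<le> C * N"
    proof -
      have "(real n / sqrt 3 - e) * (2 * pi - 8 * real l * d n) / pi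
          = 2 * real n / sqrt 3 - 2 * e - 8 * real l * (real n * d n) / (sqrt 3 * pi) + e * (8 * real l * d n) / pi"
        by (simp add: field_simps)
      moreover have "0 \<le> e * (8 * real l * d n) / pi" using e(1) d0 by simp
      moreover have "8 * real l * (real n * d n) / (sqrt 3 * pi) \<le> 8 * real l * N / 1"
      proof -
        have "1 * 1 \<le> sqrt 3 * pi" using pi_gt3 by (intro mult_mono) auto
        then show ?thesis unfolding nd using N1 by (intro divide_left_mono) auto
      qed
      moreover have "C * N = 500 * real l * N + 8 * real l * N + (4 * real l + 1) * ((2 * exp 2 + 148) * N)"
        by (simp add: C_def algebra_simps)
      moreover have "0 \<le> (4 * real l + 1) * ((2 * exp 2 + 148) * N)" using N1 by simp
      ultimately show ?thesis using main(1) e(2) by linarith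
    qed
    show ?case
      using up low unfolding EN_def[symmetric] N_def[symmetric] by linarith
  qed
  then show ?thesis
    by (intro bigoI[of _ C]) (auto elim!: eventually_mono)
qed

end
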